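(* Let $\mathcal{K}$ be either the class of finite alternating groups or the class of finite symmetric groups. A group $G$ is sofic if and only if $G$ is isomorphic to a subgroup of a quotient of an (unrestricted) direct product of groups from $\mathcal{K}$.
   Context: $S_m$ is the group of all permutations of $[m]=\{1,\dots,m\}$ and $A_m$ is the alternating subgroup of $S_m$. The normalized Hamming length on $S_m$ is $\|h\|=|\{x\in[m] : xh\neq x\}|/m$. A group $G$ is sofic if there is a function $\alpha:G\to\mathbb{R}$ with $\alpha_1=0$ and $\alpha_g>0$ for $g\ne 1$ such that for every finite $\Phi\subset G$ and every $\epsilon>0$ there exist $m$ and a function $\phi:\Phi\to S_m$ with: $\phi(1)=1$ (when $1\in\Phi$); $\|\phi(g)\|\ge\alpha_g$ for all $g\in\Phi$; and $\|\phi(gh)(\phi(g)\phi(h))^{-1}\|<\epsilon$ whenever $g,h,gh\in\Phi$. *)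

theory Defs
  imports Complex_Main "HOL-Algebra.Sym_Groups" "HOL-Algebra.Product_Groups"
begin

text \<open>Normalized Hamming length on the symmetric group of \<open>{1..m}\<close>, where \<open>m \<ge> 1\<close>.\<close>

definition hamming_length :: "nat \<Rightarrow> (nat \<Rightarrow> nat) \<Rightarrow> real" where
  "hamming_length m h = real (card {x \<in> {1..m}. h x \<noteq> x}) / real m"

text \<open>Permutations act on the left here, i.e. the product in \<^const>\<open>sym_group\<close> is composition of
  functions. For permutations acting on the right one gets the opposite group; inversion is an
  isomorphism between the two that preserves the Hamming length, so the notion of soficity is
  the same.\<close>

definition sofic :: "('a, 'b) monoid_scheme \<Rightarrow> bool" where
  "sofic G \<longleftrightarrow>
    (\<exists>\<alpha> :: 'a \<Rightarrow> real.
      \<alpha> \<one>\<^bsub>G\<^esub> = 0 \<and>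
      (\<forall>g \<in> carrier G. g \<noteq> \<one>\<^bsub>G\<^esub> \<longrightarrow> \<alpha> g > 0) \<and>
      (\<forall>\<Phi> (\<epsilon> :: real). finite \<Phi> \<and> \<Phi> \<subseteq> carrier G \<and> \<epsilon> > 0 \<longrightarrow>
        (\<exists>m \<ge> 1. \<exists>\<phi> \<in> \<Phi> \<rightarrow> carrier (sym_group m).
          (\<one>\<^bsub>G\<^esub> \<in> \<Phi> \<longrightarrow> \<phi> \<one>\<^bsub>G\<^esub> = \<one>\<^bsub>sym_group m\<^esub>) \<and>
          (\<forall>g \<in> \<Phi>. hamming_length m (\<phi> g) \<ge> \<alpha> g) \<and>
          (\<forall>g \<in> \<Phi>. \<forall>h \<in> \<Phi>. g \<otimes>\<^bsub>G\<^esub> h \<in> \<Phi> \<longrightarrow>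
            hamming_length m
              (\<phi> (g \<otimes>\<^bsub>G\<^esub> h) \<otimes>\<^bsub>sym_group m\<^esub>
                inv\<^bsub>sym_group m\<^esub> (\<phi> g \<otimes>\<^bsub>sym_group m\<^esub> \<phi> h)) < \<epsilon>))))"

definition finite_symmetric_groups :: "(nat \<Rightarrow> nat) monoid set" where
  "finite_symmetric_groups = {sym_group m |m. m \<ge> 1}"

definition finite_alternating_groups :: "(nat \<Rightarrow> nat) monoid set" where
  "finite_alternating_groups = {alt_group m |m. m \<ge> 1}"

text \<open>The type of the indices of the product is a parameter, because HOL cannot quantify over
  types inside a formula. \<^const>\<open>product_group\<close> is the unrestricted product.\<close>

definition subgroup_of_quotient_of_product ::
  "'i itself \<Rightarrow> (nat \<Rightarrow> nat) monoid set \<Rightarrow> ('a, 'b) monoid_scheme \<Rightarrow> bool" where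
  "subgroup_of_quotient_of_product _ \<K> G \<longleftrightarrow>
    (\<exists>(I :: 'i set) H N S.
      (\<forall>i \<in> I. H i \<in> \<K>) \<and>
      N \<lhd> product_group I H \<and>
      subgroup S (product_group I H Mod N) \<and>
      G \<cong> (product_group I H Mod N)\<lparr>carrier := S\<rparr>)"

end

theory Submission
  imports Defs
begin

text \<open>
  A sofic group embeds in the quotient of a product of symmetric groups by the sequences of Hamming
  length tending to zero; doubling the action turns symmetric groups into alternating ones.

  For the converse let \<open>P\<close> be the product, \<open>N\<close> its normal subgroup, \<open>s\<close> a section of the embedding
  \<open>G \<rightarrow> P / N\<close>, and \<open>g \<noteq> 1\<close>. By product actions, approximate actions of \<open>G\<close> moving a single \<open>g\<close> can be
  combined, and one in which \<open>g\<close> moves proportionally many more points than all defects of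
  multiplicativity can be amplified. So suppose that no coordinate \<open>i\<close> is of this kind: \<open>s g\<close> moves
  at most \<open>K\<close> times as many points as some defect, at every \<open>i\<close>. If \<open>b\<close> and an even permutation \<open>a\<close> of at least
  8 points satisfy \<open>|a| \<le> K |b|\<close>, then \<open>a\<close> is a product of boundedly many conjugates of double commutators
  \<open>[[b, x], y]\<close>, with a bound depending only on \<open>K\<close>. As such commutators can be formed in any subset of the
  coordinates without leaving \<open>N\<close>, the element \<open>s g\<close> would lie in \<open>N\<close>. What remains are the factors of
  degree less than 8 and the signs; they form a product of boundedly many different finite groups, which is
  locally finite, so that finitely many elements can be separated by an honest finite action.
\<close>

section \<open>Double commutators of permutations\<close>

text \<open>The obstacle is that a defect \<open>b\<close> is known only through the number of
  points it moves; its cycle type and its sign are arbitrary. The first commutator, with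
  \<open>x\<close>, still involves \<open>b\<close>. A second one, with a suitable \<open>y\<close>,
  leaves up to conjugation only the commutator of x^-1 and \<open>y\<close>, whose shape can be
  prescribed. If \<open>x\<close> and \<open>y\<close> are 3-cycles with one common point, taken in
  many disjoint blocks at once, the result is a 3-cycle in each block, and the number of blocks can
  be made proportional to the support of \<open>b\<close>. This is why the number of factors depends
  only on \<open>K\<close>. Two constraints shape the rest. The number of factors has to be the same
  in all coordinates, because a normal subgroup of an infinite product is in general closed only
  under finite products. All auxiliary permutations have to be even, because the factors may be
  alternating groups. The degree 8 comes from counting the points to be avoided when the blocks are
  chosen.\<close>

definition moved :: "('a \<Rightarrow> 'a) \<Rightarrow> 'a set" where
  "moved p = {x. p x \<noteq> x}"

definition even_perms :: "'a set \<Rightarrow> ('a \<Rightarrow> 'a) set" where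
  "even_perms S = {p. p permutes S \<and> evenperm p}"

definition commutator :: "('a \<Rightarrow> 'a) \<Rightarrow> ('a \<Rightarrow> 'a) \<Rightarrow> 'a \<Rightarrow> 'a" where
  "commutator x y = x \<circ> y \<circ> inv' x \<circ> inv' y"

text \<open>The outer conjugation makes the set invariant under even conjugation. The auxiliary
  permutations are even so that they belong to the factor of the product even if it is alternating;
  \<open>b\<close> itself may be odd.\<close>

definition double_commutators :: "'a set \<Rightarrow> ('a \<Rightarrow> 'a) \<Rightarrow> ('a \<Rightarrow> 'a) set" where
  "double_commutators S b =
    {\<sigma> \<circ> commutator (commutator b x) y \<circ> inv' \<sigma> |\<sigma> x y.
      \<sigma> \<in> even_perms S \<and> x \<in> even_perms S \<and> y \<in> even_perms S}"

primrec double_commutator_products :: "'a set \<Rightarrow> ('a \<Rightarrow> 'a) \<Rightarrow> nat \<Rightarrow> ('a \<Rightarrow> 'a) set" where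
  "double_commutator_products S b 0 = {id}"
| "double_commutator_products S b (Suc n) =
    {z \<circ> w |z w. z \<in> double_commutators S b \<and> w \<in> double_commutator_products S b n}"

lemma moved_subset: "p permutes S \<Longrightarrow> moved p \<subseteq> S"
  by (auto simp: moved_def permutes_def)

lemma even_perms_id [simp]: "id \<in> even_perms S"
  by (simp add: even_perms_def)

lemma even_perms_permutes: "p \<in> even_perms S \<Longrightarrow> p permutes S"
  by (simp add: even_perms_def)

lemma even_perms_comp:
  assumes "finite S" "p \<in> even_perms S" "q \<in> even_perms S"
  shows "p \<circ> q \<in> even_perms S"
  using assms evenperm_comp[of p q] permutes_compose[of q S p] permutes_imp_permutation[of S]
  by (auto simp: even_perms_def)

lemma even_perms_inv:
  assumes "finite S" "p \<in> even_perms S"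
  shows "inv' p \<in> even_perms S"
  using assms evenperm_inv[of p] permutes_inv[of p S] permutes_imp_permutation[of S]
  by (auto simp: even_perms_def)

lemma inv_comp_permutes:
  assumes "p permutes S" "q permutes S"
  shows "inv' (p \<circ> q) = inv' q \<circ> inv' p"
  using assms by (intro o_inv_distrib permutes_bij)

lemma conj_even_perms:
  assumes "finite S" "b permutes S" "x \<in> even_perms S"
  shows "b \<circ> x \<circ> inv' b \<in> even_perms S"
proof -
  have p: "permutation b" "permutation x" "permutation (inv' b)"
    using assms permutes_imp_permutation permutes_inv even_perms_permutes by blast+
  have "evenperm (b \<circ> x \<circ> inv' b)"
    using p assms(3) evenperm_inv[OF p(1)]
    by (auto simp: evenperm_comp permutation_compose even_perms_def)
  then show ?thesis
    using assms by (auto simp: even_perms_def intro!: permutes_compose permutes_inv)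
qed

lemma conjugate_in_double_commutators:
  assumes "\<sigma> \<in> even_perms S" "x \<in> even_perms S" "y \<in> even_perms S"
  shows "\<sigma> \<circ> commutator (commutator b x) y \<circ> inv' \<sigma> \<in> double_commutators S b"
  using assms unfolding double_commutators_def by blast

lemma double_commutators_conj:
  assumes "finite S" "\<tau> \<in> even_perms S" "z \<in> double_commutators S b"
  shows "\<tau> \<circ> z \<circ> inv' \<tau> \<in> double_commutators S b"
proof -
  obtain \<sigma> x y where e: "\<sigma> \<in> even_perms S" "x \<in> even_perms S" "y \<in> even_perms S"
    and z: "z = \<sigma> \<circ> commutator (commutator b x) y \<circ> inv' \<sigma>"
    using assms(3) by (auto simp: double_commutators_def)
  have "\<tau> \<circ> z \<circ> inv' \<tau> = (\<tau> \<circ> \<sigma>) \<circ> commutator (commutator b x) y \<circ> inv' (\<tau> \<circ> \<sigma>)"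
    using e(1) assms(2) by (simp add: z inv_comp_permutes[of _ S] even_perms_permutes comp_assoc)
  then show ?thesis
    using e assms even_perms_comp unfolding double_commutators_def by blast
qed

lemma id_in_double_commutators: "id \<in> double_commutators S b" if "b permutes S"
proof -
  have "id \<circ> commutator (commutator b id) id \<circ> inv' id = id"
    using that by (simp add: commutator_def permutes_inv_o)
  then show ?thesis
    unfolding double_commutators_def
    by (metis (mono_tags, lifting) even_perms_id mem_Collect_eq)
qed

text \<open>If \<open>y\<close> commutes with \<open>u = b x b\<inverse>\<close>, then \<open>[[b, x], y] = [u x\<inverse>, y] = u [x\<inverse>, y] u\<inverse>\<close>.\<close>

lemma double_commutatorsI:
  assumes fin: "finite S" and b: "b permutes S"
    and x: "x \<in> even_perms S" and y: "y \<in> even_perms S"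
    and comm: "y \<circ> (b \<circ> x \<circ> inv' b) = (b \<circ> x \<circ> inv' b) \<circ> y"
  shows "commutator (inv' x) y \<in> double_commutators S b"
proof -
  define u where "u = b \<circ> x \<circ> inv' b"
  have u: "u \<in> even_perms S" unfolding u_def using fin b x by (rule conj_even_perms)
  have iu: "inv' u \<in> even_perms S" using even_perms_inv fin u by blast
  have perms: "u permutes S" "x permutes S" "y permutes S"
    "inv' u permutes S" "inv' x permutes S" "inv' y permutes S"
    using u iu x y by (auto simp: even_perms_permutes permutes_inv)
  have inv_inv: "inv' (inv' u) = u" "inv' (inv' x) = x"
    using perms permutes_inv_inv by blast+
  have yu: "y (u t) = u (y t)" for t using comm unfolding u_def[symmetric] by (metis comp_apply)
  have iyu: "inv' y (u t) = u (inv' y t)" for t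
    using yu[of "inv' y t"] permutes_inverses[OF perms(3)] by metis
  have "commutator b x = u \<circ> inv' x"
    by (simp add: commutator_def u_def)
  then have "commutator (commutator b x) y = u \<circ> inv' x \<circ> y \<circ> (x \<circ> inv' u) \<circ> inv' y"
    using perms by (simp add: commutator_def[of "u \<circ> inv' x"] inv_comp_permutes[of _ S] inv_inv comp_assoc)
  then have "commutator (commutator b x) y t = u (inv' x (y (x (inv' u (inv' y t)))))" for t
    by simp
  then have "inv' u \<circ> commutator (commutator b x) y \<circ> inv' (inv' u) = commutator (inv' x) y"
    using permutes_inverses[OF perms(1)]
    by (simp add: fun_eq_iff commutator_def[of "inv' x"] inv_inv iyu)
  then show ?thesis
    using conjugate_in_double_commutators[OF iu x y, of b] by simp
qed

lemma double_commutators_subset: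
  assumes "finite S" "b permutes S"
  shows "double_commutators S b \<subseteq> even_perms S"
proof -
  have "commutator (commutator b x) y \<in> even_perms S"
    if "x \<in> even_perms S" "y \<in> even_perms S" for x y
  proof -
    have c: "commutator b x \<in> even_perms S"
      unfolding commutator_def
      by (intro even_perms_comp[OF assms(1)] conj_even_perms[OF assms] even_perms_inv[OF assms(1)] that)
    show ?thesis
      unfolding commutator_def[of "commutator b x"]
      by (intro even_perms_comp[OF assms(1)] c even_perms_inv[OF assms(1)] that)
  qed
  then show ?thesis
    using assms conj_even_perms[OF assms(1)] even_perms_permutes
    by (fastforce simp: double_commutators_def)
qed

lemma double_commutator_products_subset:
  assumes "finite S" "b permutes S"
  shows "double_commutator_products S b n \<subseteq> even_perms S"
  using double_commutators_subset[OF assms]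
  by (induction n) (auto intro!: even_perms_comp[OF assms(1)])

lemma double_commutator_products_comp:
  assumes "z \<in> double_commutator_products S b n" "w \<in> double_commutator_products S b n'"
  shows "z \<circ> w \<in> double_commutator_products S b (n + n')"
  using assms(1)
proof (induction n arbitrary: z)
  case 0 then show ?case using assms(2) by simp
next
  case (Suc n)
  then obtain z1 z2 where "z = z1 \<circ> z2" and "z1 \<in> double_commutators S b"
    and "z2 \<in> double_commutator_products S b n" by auto
  have "z \<circ> w = z1 \<circ> (z2 \<circ> w)" by (simp only: \<open>z = z1 \<circ> z2\<close> comp_assoc)
  moreover have "z2 \<circ> w \<in> double_commutator_products S b (n + n')"
    using \<open>z2 \<in> _\<close> by (rule Suc.IH)
  ultimately show ?case
    using \<open>z1 \<in> _\<close> unfolding add_Suc double_commutator_products.simps by blast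
qed

lemma double_commutator_products_1:
  "z \<in> double_commutators S b \<Longrightarrow> z \<in> double_commutator_products S b 1"
  by (auto simp: exI[of _ z])

text \<open>The identity is itself a double commutator, so a product can be padded with trivial
  factors and exactly \<open>n\<close> factors amount to at most \<open>n\<close>.\<close>

lemma double_commutator_products_mono:
  assumes "b permutes S" "n \<le> n'" "z \<in> double_commutator_products S b n"
  shows "z \<in> double_commutator_products S b n'"
  using assms(2,3)
proof (induction n' rule: dec_induct)
  case (step n')
  then show ?case using id_in_double_commutators[OF assms(1)]
    by (auto intro: exI[of _ id])
qed

section \<open>Permutations acting in parallel on blocks of five points\<close>

definition three_cycle :: "'a \<Rightarrow> 'a \<Rightarrow> 'a \<Rightarrow> 'a \<Rightarrow> 'a" where
  "three_cycle a b c x = (if x = a then b else if x = b then c else if x = c then a else x)"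

definition blocks :: "nat \<Rightarrow> (nat \<Rightarrow> nat) \<Rightarrow> nat \<times> nat \<Rightarrow> nat \<times> nat" where
  "blocks j \<pi> = (\<lambda>(i, c). if i < j then (i, \<pi> c) else (i, c))"

text \<open>The map \<open>f\<close> lays out \<open>j\<close> blocks of five points, and
  \<open>\<pi>\<close> acts in all of them simultaneously; every other point is fixed. Five is the
  number of points occupied by two 3-cycles with one common point.\<close>

definition spread :: "(nat \<times> nat \<Rightarrow> 'a) \<Rightarrow> nat \<Rightarrow> (nat \<Rightarrow> nat) \<Rightarrow> 'a \<Rightarrow> 'a" where
  "spread f j \<pi> = map_permutation ({..<j} \<times> {..<5}) f (blocks j \<pi>)"

lemma three_cycle_cube:
  assumes "distinct [a, b, c]"
  shows "three_cycle a b c \<circ> three_cycle a b c \<circ> three_cycle a b c = id"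
  using assms by (auto simp: three_cycle_def fun_eq_iff)

lemma three_cycle_permutes:
  assumes "distinct [a, b, c]" "{a, b, c} \<subseteq> S"
  shows "three_cycle a b c permutes S"
proof -
  have 1: "three_cycle a b c \<circ> (three_cycle a b c \<circ> three_cycle a b c) = id"
      "(three_cycle a b c \<circ> three_cycle a b c) \<circ> three_cycle a b c = id"
    using three_cycle_cube[OF assms(1)] by (simp_all add: comp_assoc)
  then have "bij (three_cycle a b c)" by (meson o_bij)
  moreover have "three_cycle a b c x = x" if "x \<notin> S" for x
    using that assms(2) by (auto simp: three_cycle_def)
  ultimately show ?thesis by (simp add: permutes_def bij_iff)
qed

lemma inv_three_cycle:
  assumes "distinct [a, b, c]"
  shows "inv' (three_cycle a b c) = three_cycle c b a"
  by (rule inv_unique_comp) (use assms in \<open>auto simp: three_cycle_def fun_eq_iff\<close>)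

lemma blocks_comp: "blocks j (\<pi> \<circ> \<rho>) = blocks j \<pi> \<circ> blocks j \<rho>"
  by (auto simp: blocks_def fun_eq_iff)

lemma blocks_id: "blocks j id = id"
  by (auto simp: blocks_def fun_eq_iff)

lemma blocks_permutes:
  assumes "\<pi> permutes {..<5}"
  shows "blocks j \<pi> permutes {..<j} \<times> {..<5}"
proof -
  have "blocks j \<pi> \<circ> blocks j (inv' \<pi>) = id" "blocks j (inv' \<pi>) \<circ> blocks j \<pi> = id"
    using permutes_inv_o[OF assms] by (simp_all flip: blocks_comp add: blocks_id)
  then have "bij (blocks j \<pi>)" by (meson o_bij)
  moreover have "blocks j \<pi> x = x" if "x \<notin> {..<j} \<times> {..<5}" for x
    using that permutes_not_in[OF assms] by (cases x) (auto simp: blocks_def)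
  ultimately show ?thesis by (simp add: permutes_def bij_iff)
qed

lemma spread_comp:
  assumes "inj_on f ({..<j} \<times> {..<5})" "\<rho> permutes {..<5}"
  shows "spread f j (\<pi> \<circ> \<rho>) = spread f j \<pi> \<circ> spread f j \<rho>"
  using assms by (simp add: spread_def blocks_comp map_permutation_compose' blocks_permutes)

lemma spread_id: "inj_on f ({..<j} \<times> {..<5}) \<Longrightarrow> spread f j id = id"
  by (simp add: spread_def blocks_id map_permutation_id')

lemma spread_apply:
  assumes "inj_on f ({..<j} \<times> {..<5})" "i < j" "c < 5"
  shows "spread f j \<pi> (f (i, c)) = f (i, \<pi> c)"
  using assms by (simp add: spread_def map_permutation_apply) (simp add: blocks_def)

lemma spread_outside: "y \<notin> f ` ({..<j} \<times> {..<5}) \<Longrightarrow> spread f j \<pi> y = y"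
  by (simp add: spread_def map_permutation_def)

lemma spread_permutes:
  assumes "inj_on f ({..<j} \<times> {..<5})" "f ` ({..<j} \<times> {..<5}) \<subseteq> S" "\<pi> permutes {..<5}"
  shows "spread f j \<pi> permutes S"
  unfolding spread_def
  using assms by (intro permutes_subset[OF map_permutation_permutes[OF _ blocks_permutes]])
    (auto simp: bij_betw_def)

lemma spread_inv:
  assumes "inj_on f ({..<j} \<times> {..<5})" "\<pi> permutes {..<5}"
  shows "spread f j (inv' \<pi>) = inv' (spread f j \<pi>)"
proof (rule inv_unique_comp[symmetric])
  show "spread f j \<pi> \<circ> spread f j (inv' \<pi>) = id" "spread f j (inv' \<pi>) \<circ> spread f j \<pi> = id"
    using spread_comp[OF assms(1) permutes_inv[OF assms(2)], of \<pi>]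
      spread_comp[OF assms, of "inv' \<pi>"] permutes_inv_o[OF assms(2)] spread_id[OF assms(1)] by simp_all
qed

lemma spread_commutator:
  assumes "inj_on f ({..<j} \<times> {..<5})" "\<pi> permutes {..<5}" "\<rho> permutes {..<5}"
  shows "spread f j (commutator \<pi> \<rho>) = commutator (spread f j \<pi>) (spread f j \<rho>)"
  using assms by (simp add: commutator_def spread_comp spread_inv permutes_compose permutes_inv)

text \<open>Signs multiply, so \<open>p\<close> has the sign of its cube. This shows that a 3-cycle
  spread over any number of blocks is even, without decomposing it into transpositions.\<close>

lemma evenperm_if_cube_id:
  assumes "permutation p" "p \<circ> p \<circ> p = id"
  shows "evenperm p"
proof -
  have "evenperm (p \<circ> p \<circ> p)" using assms(2) by simp
  then show ?thesis
    using assms(1) by (simp add: evenperm_comp permutation_compose)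
qed

lemma spread_three_cycle_even:
  assumes "finite S" "inj_on f ({..<j} \<times> {..<5})" "f ` ({..<j} \<times> {..<5}) \<subseteq> S"
    and "distinct [a, b, c]" "{a, b, c} \<subseteq> {..<5}"
  shows "spread f j (three_cycle a b c) \<in> even_perms S"
proof -
  let ?p = "three_cycle a b c"
  have p: "?p permutes {..<5}" using assms(4,5) by (rule three_cycle_permutes)
  have perm: "spread f j ?p permutes S" using assms p by (intro spread_permutes)
  have "spread f j ?p \<circ> spread f j ?p \<circ> spread f j ?p = spread f j (?p \<circ> ?p \<circ> ?p)"
    using assms(2) p by (simp add: spread_comp permutes_compose)
  also have "\<dots> = id"
    using assms(2) by (simp add: three_cycle_cube[OF assms(4)] spread_id)
  finally show ?thesis
    using perm evenperm_if_cube_id permutes_imp_permutation[OF assms(1) perm]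
    by (simp add: even_perms_def)
qed

text \<open>Conjugation relabels points, so spreads of one \<open>\<pi>\<close> over two layouts are
  conjugate as soon as some \<open>\<sigma>\<close> carries one layout to the other.\<close>

lemma conj_spread:
  assumes "inj_on f ({..<j} \<times> {..<5})" "\<pi> permutes {..<5}" "\<sigma> permutes S"
  shows "\<sigma> \<circ> spread f j \<pi> \<circ> inv' \<sigma> = spread (\<sigma> \<circ> f) j \<pi>"
proof
  fix y
  have inj: "inj_on (\<sigma> \<circ> f) ({..<j} \<times> {..<5})"
    using assms(1) permutes_inj[OF assms(3)] by (simp add: comp_inj_on inj_on_subset)
  have inv: "inv' \<sigma> (\<sigma> x) = x" "\<sigma> (inv' \<sigma> x) = x" for x
    using permutes_inverses[OF assms(3)] by auto
  show "(\<sigma> \<circ> spread f j \<pi> \<circ> inv' \<sigma>) y = spread (\<sigma> \<circ> f) j \<pi> y"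
  proof (cases "y \<in> (\<sigma> \<circ> f) ` ({..<j} \<times> {..<5})")
    case True
    then obtain i c where ic: "i < j" "c < 5" and y: "y = (\<sigma> \<circ> f) (i, c)" by auto
    have "spread (\<sigma> \<circ> f) j \<pi> y = \<sigma> (f (i, \<pi> c))"
      unfolding y by (subst spread_apply[OF inj ic]) simp
    then show ?thesis
      using spread_apply[OF assms(1) ic] by (simp add: y inv)
  next
    case False
    then have "inv' \<sigma> y \<notin> f ` ({..<j} \<times> {..<5})"
      using inv(2)[of y] by (force simp: image_iff)
    with False show ?thesis by (simp add: spread_outside inv)
  qed
qed

text \<open>A conjugation inside the columns is absorbed by the layout. Hence other 3-cycles can be
  obtained from (0 1 2) by a change of layout, and \<open>\<theta>\<close> may be odd.\<close>

lemma spread_conj: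
  assumes "inj_on f ({..<j} \<times> {..<5})" "\<pi> permutes {..<5}" "\<theta> permutes {..<5}"
  shows "spread f j (\<theta> \<circ> \<pi> \<circ> inv' \<theta>) = spread (f \<circ> blocks j \<theta>) j \<pi>"
proof
  fix y
  let ?D = "{..<j} \<times> {..<5::nat}"
  have bl: "blocks j \<theta> permutes ?D" using assms(3) by (rule blocks_permutes)
  have inj: "inj_on (f \<circ> blocks j \<theta>) ?D"
    using assms(1) bl by (simp add: comp_inj_on permutes_inj_on permutes_image)
  have img: "(f \<circ> blocks j \<theta>) ` ?D = f ` ?D"
    using bl by (simp only: image_comp[symmetric] permutes_image)
  show "spread f j (\<theta> \<circ> \<pi> \<circ> inv' \<theta>) y = spread (f \<circ> blocks j \<theta>) j \<pi> y"
  proof (cases "y \<in> (f \<circ> blocks j \<theta>) ` ?D")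
    case True
    then obtain i c where ic: "i < j" "c < 5" and y: "y = (f \<circ> blocks j \<theta>) (i, c)" by auto
    have "\<theta> c < 5" "\<pi> c < 5" using permutes_in_image[OF assms(3)] permutes_in_image[OF assms(2)] ic by auto
    have "spread (f \<circ> blocks j \<theta>) j \<pi> y = f (i, \<theta> (\<pi> c))"
      unfolding y by (subst spread_apply[OF inj ic]) (simp add: blocks_def ic)
    moreover have "spread f j (\<theta> \<circ> \<pi> \<circ> inv' \<theta>) y = f (i, \<theta> (\<pi> c))"
      using spread_apply[OF assms(1) ic(1) \<open>\<theta> c < 5\<close>] permutes_inverses[OF assms(3)] 
      by (simp add: y blocks_def ic)
    ultimately show ?thesis by simp
  next
    case False
    then show ?thesis using img by (simp add: spread_outside)
  qed
qed

text \<open>A bijection between the complements of the images extends the required partial map to a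
  permutation. If that is odd, a transposition of two points outside the image of \<open>g\<close>
  corrects the sign; the two spare points in the bound serve this purpose.\<close>

lemma extend_injection_even:
  assumes S: "finite S" and D: "finite D" "card D + 2 \<le> card S"
    and f: "inj_on f D" "f ` D \<subseteq> S" and g: "inj_on g D" "g ` D \<subseteq> S"
  shows "\<exists>\<sigma>\<in>even_perms S. \<forall>d\<in>D. \<sigma> (f d) = g d"
proof -
  have c: "card (S - f ` D) = card S - card D" "card (S - g ` D) = card S - card D"
    using S D f g by (auto simp: card_Diff_subset card_image)
  then obtain h where h: "bij_betw h (S - f ` D) (S - g ` D)"
    using S finite_same_card_bij[of "S - f ` D" "S - g ` D"] by auto
  define h1 where "h1 = g \<circ> inv_into D f"
  have h1: "bij_betw h1 (f ` D) (g ` D)"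
    unfolding h1_def using f g by (intro bij_betw_trans[OF bij_betw_inv_into]) (auto simp: bij_betw_def)
  define \<sigma> where "\<sigma> = (\<lambda>y. if y \<in> S then if y \<in> f ` D then h1 y else h y else y)"
  have "bij_betw (\<lambda>y. if y \<in> f ` D then h1 y else h y) (f ` D \<union> (S - f ` D)) (g ` D \<union> (S - g ` D))"
    using h h1 by (intro bij_betw_disjoint_Un) auto
  then have "bij_betw (\<lambda>y. if y \<in> f ` D then h1 y else h y) S S"
    using f g by (simp add: Un_absorb1)
  then have "bij_betw \<sigma> S S"
    by (rule bij_betw_cong[THEN iffD1, rotated]) (simp add: \<sigma>_def)
  then have \<sigma>: "\<sigma> permutes S" by (rule bij_imp_permutes) (simp add: \<sigma>_def)
  have \<sigma>f: "\<sigma> (f d) = g d" if "d \<in> D" for d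
    using that f by (auto simp: \<sigma>_def h1_def)
  have "2 \<le> card (S - g ` D)" using c D by simp
  then obtain T where "T \<subseteq> S - g ` D" "card T = 2"
    by (meson obtain_subset_with_card_n)
  then obtain p q where pq: "p \<in> S - g ` D" "q \<in> S - g ` D" "p \<noteq> q"
    by (auto simp: card_2_iff)
  show ?thesis
  proof (cases "evenperm \<sigma>")
    case True
    with \<sigma> \<sigma>f show ?thesis by (auto simp: even_perms_def)
  next
    case False
    let ?\<tau> = "Transposition.transpose p q \<circ> \<sigma>"
    have "?\<tau> permutes S"
      using \<sigma> pq by (intro permutes_compose permutes_swap_id) auto
    moreover have "evenperm ?\<tau>"
      using False pq \<sigma> S permutes_imp_permutation
      by (subst evenperm_comp) (auto simp: evenperm_swap permutation_swap_id)
    moreover have "?\<tau> (f d) = g d" if "d \<in> D" for d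
      using \<sigma>f[OF that] pq that by (auto simp: Transposition.transpose_def)
    ultimately show ?thesis by (auto simp: even_perms_def)
  qed
qed

text \<open>This is (0 1)(2 3) with 4 as an idle fifth point. The factorization into two 3-cycles is
  what exhibits it as a product of two double commutators.\<close>

definition double_swap :: "nat \<Rightarrow> nat" where
  "double_swap = three_cycle 0 1 2 \<circ> three_cycle 1 2 3"

lemma double_swap_simps [simp]:
  "double_swap 0 = 1" "double_swap (Suc 0) = 0" "double_swap 2 = 3" "double_swap 3 = 2"
  "double_swap 4 = 4"
  by (simp_all add: double_swap_def three_cycle_def)

text \<open>Take \<open>T\<close> maximal among the sets of moved points that are disjoint from
  their image. A moved point outside \<open>T\<close>, its image and its preimage could be added, so
  these three sets, each of size at most \<open>card T\<close>, cover the support.\<close>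

lemma displaced_subset:
  assumes "finite S" "b permutes S"
  obtains T where "T \<subseteq> moved b" "T \<inter> b ` T = {}" "card (moved b) \<le> 3 * card T"
proof -
  have finM: "finite (moved b)" using assms moved_subset finite_subset by blast
  define \<F> where "\<F> = {T. T \<subseteq> moved b \<and> T \<inter> b ` T = {}}"
  have "finite \<F>" "\<F> \<noteq> {}" using finM by (auto simp: \<F>_def)
  then obtain T where T: "T \<in> \<F>" "\<And>T'. T' \<in> \<F> \<Longrightarrow> T \<subseteq> T' \<Longrightarrow> T = T'"
    using finite_has_maximal[of \<F>] by blast
  have "moved b \<subseteq> T \<union> b ` T \<union> inv' b ` T"
  proof
    fix x assume x: "x \<in> moved b"
    show "x \<in> T \<union> b ` T \<union> inv' b ` T"
    proof (rule ccontr)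
      assume nx: "x \<notin> T \<union> b ` T \<union> inv' b ` T"
      have "b x \<notin> T"
        using nx permutes_inverses(2)[OF assms(2), of x] by (metis UnCI imageI)
      then have "insert x T \<in> \<F>"
        using nx x T(1) permutes_inj[OF assms(2)] by (auto simp: \<F>_def moved_def)
      then show False using T(2)[of "insert x T"] nx by blast
    qed
  qed
  moreover have "finite T" using T(1) finM finite_subset by (auto simp: \<F>_def)
  ultimately have "card (moved b) \<le> card T + card (b ` T) + card (inv' b ` T)"
    by (meson card_Un_le card_mono finite_Un finite_imageI order_trans add_mono order_refl)
  also have "\<dots> \<le> 3 * card T"
    using card_image_le[OF \<open>finite T\<close>, of b] card_image_le[OF \<open>finite T\<close>, of "inv' b"] by simp
  finally show ?thesis using that T(1) by (auto simp: \<F>_def)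
qed

lemma comp_commute_if_moved_disjoint:
  assumes "inj p" "inj q" "moved p \<inter> moved q = {}"
  shows "p \<circ> q = q \<circ> p"
proof
  fix x
  show "(p \<circ> q) x = (q \<circ> p) x"
  proof (cases "p x = x")
    case True
    then show ?thesis
      using assms by (cases "q x = x") (auto simp: moved_def disjoint_iff dest: injD)
  next
    case False
    then have "q x = x" using assms(3) by (auto simp: moved_def)
    moreover have "p (p x) \<noteq> p x" using False assms(1) by (auto dest: injD)
    ultimately show ?thesis using assms(3) by (auto simp: moved_def)
  qed
qed

lemma moved_spread:
  assumes "inj_on f ({..<j} \<times> {..<5})"
  shows "moved (spread f j \<pi>) \<subseteq> f ` ({..<j} \<times> (moved \<pi> \<inter> {..<5}))"
proof
  fix y assume y: "y \<in> moved (spread f j \<pi>)"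
  then obtain i c where ic: "i < j" "c < 5" "y = f (i, c)"
    using spread_outside[of y f j \<pi>] by (auto simp: moved_def)
  then show "y \<in> f ` ({..<j} \<times> (moved \<pi> \<inter> {..<5}))"
    using y spread_apply[OF assms ic(1,2)] by (auto simp: moved_def)
qed

text \<open>
  In every block take \<open>x = (0 3 1)\<close> and \<open>y = (0 2 4)\<close>, so that \<open>[x\<inverse>, y] = (0 1 2)\<close>. The points of column 0
  are chosen in \<open>T\<close>, those of the other columns generically, so that \<open>b\<close> carries the support of \<open>x\<close>
  away from the support of \<open>y\<close> although the two supports meet.
\<close>

lemma spread_three_cycle_in_double_commutators_ex:
  assumes S: "finite S" and b: "b permutes S" and j: "8 * j \<le> card S" "j \<le> card T"
    and T: "T \<subseteq> moved b" "T \<inter> b ` T = {}"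
  shows "\<exists>f. inj_on f ({..<j} \<times> {..<5}) \<and> f ` ({..<j} \<times> {..<5}) \<subseteq> S \<and>
    spread f j (three_cycle 0 1 2) \<in> double_commutators S b"
proof -
  have bi: "b (inv' b x) = x" "inv' b (b x) = x" for x
    using permutes_inverses[OF b] by auto
  have bS: "b x \<in> S \<longleftrightarrow> x \<in> S" for x using permutes_in_image[OF b] .
  obtain P where P: "P \<subseteq> T" "card P = j" "finite P"
    using j(2) obtain_subset_with_card_n by metis
  have "P \<subseteq> S" using P(1) T(1) moved_subset[OF b] by blast
  then have PS: "P \<subseteq> S" "inv' b ` P \<subseteq> S" "b ` P \<subseteq> S"
    using bS permutes_in_image[OF permutes_inv[OF b]] by auto
  \<comment> \<open>Avoiding the preimage of \<open>P\<close> ensures that \<open>b\<close> carries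
    \<open>R\<close> off \<open>P\<close>.\<close>
  have "card (P \<union> inv' b ` P) \<le> 2 * j"
    using card_Un_le[of P "inv' b ` P"] card_image_le[OF P(3), of "inv' b"] P(2) by simp
  then have "2 * j \<le> card (S - (P \<union> inv' b ` P))"
    using S PS P(3) j(1) by (subst card_Diff_subset) auto
  then obtain R where R: "R \<subseteq> S - (P \<union> inv' b ` P)" "card R = 2 * j" "finite R"
    using obtain_subset_with_card_n by metis
  \<comment> \<open>At most \<open>6 * j\<close> points are forbidden for \<open>Q\<close> and
    \<open>2 * j\<close> are wanted. This is the origin of \<open>8 * j \<le> card S\<close>, and so
    of the degree 8.\<close>
  have "card (P \<union> R \<union> b ` P \<union> b ` R) \<le> card P + card R + card (b ` P) + card (b ` R)"
    by (meson card_Un_le order_trans add_mono order_refl)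
  then have "card (P \<union> R \<union> b ` P \<union> b ` R) \<le> 6 * j"
    using card_image_le[OF P(3), of b] card_image_le[OF R(3), of b] P(2) R(2) by simp
  moreover have "b ` R \<subseteq> S" using R(1) bS by auto
  ultimately have "2 * j \<le> card (S - (P \<union> R \<union> b ` P \<union> b ` R))"
    using S PS P(3) R(1,3) j(1) by (subst card_Diff_subset) auto
  then obtain Q where Q: "Q \<subseteq> S - (P \<union> R \<union> b ` P \<union> b ` R)" "card Q = 2 * j" "finite Q"
    using obtain_subset_with_card_n by metis
  obtain p where p: "bij_betw p {..<j} P"
    using finite_same_card_bij[of "{..<j}" P] P by auto
  obtain r where r: "bij_betw r ({..<j} \<times> {1, 3::nat}) R"
    using finite_same_card_bij[of "{..<j} \<times> {1, 3::nat}" R] R by (auto simp: card_cartesian_product)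
  obtain q where q: "bij_betw q ({..<j} \<times> {2, 4::nat}) Q"
    using finite_same_card_bij[of "{..<j} \<times> {2, 4::nat}" Q] Q by (auto simp: card_cartesian_product)
  \<comment> \<open>Column 0 will be moved by both 3-cycles, columns 1 and 3 only by the one spread
    to \<open>x\<close>, columns 2 and 4 only by the one spread to \<open>y\<close>.\<close>
  define f where "f = (\<lambda>(i, c). if c = 0 then p i else if c = 1 \<or> c = 3 then r (i, c) else q (i, c))"
  have five: "{..<5::nat} = {0} \<union> {1, 3} \<union> {2, 4}" by auto
  have f0: "bij_betw f ({..<j} \<times> {0}) P"
  proof -
    have "bij_betw (p \<circ> fst) ({..<j} \<times> {0::nat}) P"
      by (rule bij_betw_trans[OF _ p]) (auto simp: bij_betw_def inj_on_def)
    then show ?thesis by (rule bij_betw_cong[THEN iffD1, rotated]) (auto simp: f_def)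
  qed
  have f1: "bij_betw f ({..<j} \<times> {1, 3}) R"
    using r by (rule bij_betw_cong[THEN iffD1, rotated]) (auto simp: f_def)
  have f2: "bij_betw f ({..<j} \<times> {2, 4}) Q"
    using q by (rule bij_betw_cong[THEN iffD1, rotated]) (auto simp: f_def)
  have "bij_betw f ({..<j} \<times> {0} \<union> {..<j} \<times> {1, 3} \<union> {..<j} \<times> {2, 4}) (P \<union> R \<union> Q)"
    using f0 f1 f2 R(1) Q(1) by (intro bij_betw_combine) auto
  then have f: "bij_betw f ({..<j} \<times> {..<5}) (P \<union> R \<union> Q)"
    by (simp only: five Sigma_Un_distrib2)
  then have inj: "inj_on f ({..<j} \<times> {..<5})" and img: "f ` ({..<j} \<times> {..<5}) \<subseteq> S"
    using PS R(1) Q(1) by (auto simp: bij_betw_def)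
  let ?cx = "three_cycle 0 3 (1::nat)" and ?cy = "three_cycle 0 2 (4::nat)"
  let ?x = "spread f j ?cx" and ?y = "spread f j ?cy"
  have x: "?x \<in> even_perms S" and y: "?y \<in> even_perms S"
    using S inj img by (auto intro!: spread_three_cycle_even)
  have p0: "?cx permutes {..<5}" "?cy permutes {..<5}"
    by (auto intro!: three_cycle_permutes)
  have "moved ?cx \<inter> {..<5} \<subseteq> {0} \<union> {1, 3}" "moved ?cy \<inter> {..<5} \<subseteq> {0} \<union> {2, 4}"
    by (auto simp: moved_def three_cycle_def split: if_splits)
  then have "f ` ({..<j} \<times> (moved ?cx \<inter> {..<5})) \<subseteq> f ` ({..<j} \<times> {0}) \<union> f ` ({..<j} \<times> {1, 3})"
    "f ` ({..<j} \<times> (moved ?cy \<inter> {..<5})) \<subseteq> f ` ({..<j} \<times> {0}) \<union> f ` ({..<j} \<times> {2, 4})"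
    by blast+
  then have mx: "moved ?x \<subseteq> P \<union> R" and my: "moved ?y \<subseteq> P \<union> Q"
    using moved_spread[OF inj, of ?cx] moved_spread[OF inj, of ?cy]
    unfolding bij_betw_imp_surj_on[OF f0] bij_betw_imp_surj_on[OF f1] bij_betw_imp_surj_on[OF f2]
    by (meson order_trans)+
  have mu: "moved (b \<circ> ?x \<circ> inv' b) \<subseteq> b ` (P \<union> R)"
  proof
    fix z assume "z \<in> moved (b \<circ> ?x \<circ> inv' b)"
    then have "inv' b z \<in> moved ?x" using bi(1)[of z] by (auto simp: moved_def)
    then have "b (inv' b z) \<in> b ` (P \<union> R)" using mx by blast
    then show "z \<in> b ` (P \<union> R)" by (simp add: bi)
  qed
  have "P \<inter> b ` P = {}" using P(1) T(2) by blast
  moreover have "P \<inter> b ` R = {}"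
  proof (rule ccontr)
    assume "P \<inter> b ` R \<noteq> {}"
    then obtain z where "z \<in> R" "b z \<in> P" by auto
    then have "inv' b (b z) \<in> inv' b ` P" by blast
    with \<open>z \<in> R\<close> R(1) show False by (auto simp: bi)
  qed
  ultimately have "(P \<union> Q) \<inter> b ` (P \<union> R) = {}"
    using Q(1) by (simp add: Int_Un_distrib Int_Un_distrib2 image_Un disjoint_iff subset_eq)
  then have "moved ?y \<inter> moved (b \<circ> ?x \<circ> inv' b) = {}"
    using mu my by (meson disjoint_iff subset_iff)
  then have comm: "?y \<circ> (b \<circ> ?x \<circ> inv' b) = (b \<circ> ?x \<circ> inv' b) \<circ> ?y"
    using permutes_inj[OF even_perms_permutes[OF y]]
      permutes_inj[OF even_perms_permutes[OF conj_even_perms[OF S b x]]]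
    by (intro comp_commute_if_moved_disjoint)
  have "inv' ?cx = three_cycle 1 3 0" "inv' ?cy = three_cycle 4 2 0"
    by (rule inv_three_cycle; simp)+
  moreover have "inv' (inv' ?cx) = ?cx" using p0(1) by (rule permutes_inv_inv)
  ultimately have "commutator (inv' ?cx) ?cy = three_cycle 1 3 0 \<circ> ?cy \<circ> ?cx \<circ> three_cycle 4 2 0"
    by (simp only: commutator_def)
  also have "\<dots> = three_cycle 0 1 2"
    by (rule ext) (simp add: three_cycle_def)
  finally have "commutator (inv' ?cx) ?cy = three_cycle 0 1 2" .
  moreover have "commutator (inv' ?x) ?y \<in> double_commutators S b"
    using S b x y comm by (rule double_commutatorsI)
  moreover have "spread f j (commutator (inv' ?cx) ?cy) = commutator (inv' ?x) ?y"
    by (subst spread_commutator[OF inj permutes_inv[OF p0(1)] p0(2)])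
      (simp only: spread_inv[OF inj p0(1)])
  ultimately have "spread f j (three_cycle 0 1 2) \<in> double_commutators S b" by metis
  with inj img show ?thesis by blast
qed

lemma spread_cong:
  assumes "inj_on f ({..<j} \<times> {..<5})" "\<pi> permutes {..<5}"
    and "\<And>d. d \<in> {..<j} \<times> {..<5} \<Longrightarrow> f d = g d"
  shows "spread f j \<pi> = spread g j \<pi>"
  unfolding spread_def using assms by (intro map_permutation_cong blocks_permutes) auto

text \<open>The layout that is known to exist is carried to the prescribed one by an even
  permutation, and double commutators are invariant under even conjugation. The two spare points are
  available because \<open>5 * j + 2 \<le> 8 * j\<close> for positive \<open>j\<close>.\<close>

lemma spread_three_cycle_in_double_commutators:
  assumes S: "finite S" and b: "b permutes S" and j: "0 < j" "8 * j \<le> card S" "j \<le> card T"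
    and T: "T \<subseteq> moved b" "T \<inter> b ` T = {}"
    and g: "inj_on g ({..<j} \<times> {..<5})" "g ` ({..<j} \<times> {..<5}) \<subseteq> S"
  shows "spread g j (three_cycle 0 1 2) \<in> double_commutators S b"
proof -
  obtain f where f: "inj_on f ({..<j} \<times> {..<5})" "f ` ({..<j} \<times> {..<5}) \<subseteq> S"
    "spread f j (three_cycle 0 1 2) \<in> double_commutators S b"
    using spread_three_cycle_in_double_commutators_ex[OF S b j(2,3) T] by blast
  have "card ({..<j} \<times> {..<5::nat}) + 2 \<le> card S"
    using j by (simp add: card_cartesian_product)
  then obtain \<sigma> where \<sigma>: "\<sigma> \<in> even_perms S" "\<And>d. d \<in> {..<j} \<times> {..<5} \<Longrightarrow> \<sigma> (f d) = g d"
    using extend_injection_even[OF S _ _ f(1,2) g] by auto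
  have p: "three_cycle 0 1 (2::nat) permutes {..<5}" by (auto intro!: three_cycle_permutes)
  have "\<sigma> \<circ> spread f j (three_cycle 0 1 2) \<circ> inv' \<sigma> = spread (\<sigma> \<circ> f) j (three_cycle 0 1 2)"
    using conj_spread[OF f(1) p even_perms_permutes[OF \<sigma>(1)]] .
  also have "\<dots> = spread g j (three_cycle 0 1 2)"
    using \<sigma>(2) g(1) p by (intro spread_cong[symmetric]) auto
  finally show ?thesis using double_commutators_conj[OF S \<sigma>(1) f(3)] by simp
qed

text \<open>The 3-cycle (1 2 3) is (0 1 2) with columns 0 and 3 exchanged, hence a spread of the
  same 3-cycle over another layout. So each factor of \<open>double_swap\<close> costs one double
  commutator.\<close>

lemma spread_double_swap_in_products:
  assumes S: "finite S" and b: "b permutes S" and j: "0 < j" "8 * j \<le> card S" "j \<le> card T"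
    and T: "T \<subseteq> moved b" "T \<inter> b ` T = {}"
    and g: "inj_on g ({..<j} \<times> {..<5})" "g ` ({..<j} \<times> {..<5}) \<subseteq> S"
  shows "spread g j double_swap \<in> double_commutator_products S b 2"
proof -
  let ?D = "{..<j} \<times> {..<5::nat}" and ?\<theta> = "Transposition.transpose 0 (3::nat)"
  have p: "three_cycle 0 1 (2::nat) permutes {..<5}" "three_cycle 1 2 (3::nat) permutes {..<5}"
    by (auto intro!: three_cycle_permutes)
  have \<theta>: "?\<theta> permutes {..<5}" by (intro permutes_swap_id) auto
  have bl: "blocks j ?\<theta> permutes ?D" using \<theta> by (rule blocks_permutes)
  have "(g \<circ> blocks j ?\<theta>) ` ?D = g ` ?D"
    using bl by (simp only: image_comp[symmetric] permutes_image)
  then have g': "inj_on (g \<circ> blocks j ?\<theta>) ?D" "(g \<circ> blocks j ?\<theta>) ` ?D \<subseteq> S"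
    using g permutes_image[OF bl] permutes_inj_on[OF bl] by (auto intro!: comp_inj_on)
  have "three_cycle 1 2 3 = ?\<theta> \<circ> three_cycle 0 1 2 \<circ> inv' ?\<theta>"
    by (auto simp: fun_eq_iff three_cycle_def Transposition.transpose_def)
  then have "spread g j (three_cycle 1 2 3) = spread (g \<circ> blocks j ?\<theta>) j (three_cycle 0 1 2)"
    using spread_conj[OF g(1) p(1) \<theta>] by simp
  then have "spread g j double_swap =
      spread g j (three_cycle 0 1 2) \<circ> spread (g \<circ> blocks j ?\<theta>) j (three_cycle 0 1 2)"
    using g(1) p(2) by (simp add: double_swap_def spread_comp)
  moreover have "spread g j (three_cycle 0 1 2) \<in> double_commutator_products S b 1"
    "spread (g \<circ> blocks j ?\<theta>) j (three_cycle 0 1 2) \<in> double_commutator_products S b 1"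
    by (intro double_commutator_products_1 spread_three_cycle_in_double_commutators[OF S b j T] g g')+
  ultimately show ?thesis
    using double_commutator_products_comp[of _ S b 1 _ 1] by (simp add: numeral_2_eq_2)
qed

text \<open>From \<open>t\<close> a set of \<open>2 * j\<close> of its 2-cycles is split off, two
  for each block. Column 4 is filled with arbitrary points outside these cycles, which
  \<open>double_swap\<close> leaves alone. The remaining involution \<open>t'\<close> has disjoint
  support from the part split off, so both orders of the factors are available.\<close>

lemma involution_split_block:
  fixes t :: "'a::linorder \<Rightarrow> 'a"
  assumes S: "finite S" and t: "t permutes S" "t \<circ> t = id"
    and j: "8 * j \<le> card S" "4 * j \<le> card (moved t)"
  obtains f t' where "inj_on f ({..<j} \<times> {..<5})" "f ` ({..<j} \<times> {..<5}) \<subseteq> S"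
    "t' permutes S" "t' \<circ> t' = id" "t = spread f j double_swap \<circ> t'"
    "t = t' \<circ> spread f j double_swap" "card (moved t') = card (moved t) - 4 * j"
proof -
  have tt: "t (t x) = x" for x using t(2) by (metis comp_apply id_apply)
  have injt: "inj t" using t(1) by (rule permutes_inj)
  have finM: "finite (moved t)" using S t(1) moved_subset finite_subset by blast
  \<comment> \<open>The linear order serves to select one point from every 2-cycle of
    \<open>t\<close>.\<close>
  define H where "H = {x. x < t x}"
  have H: "moved t = H \<union> t ` H" "H \<inter> t ` H = {}"
  proof -
    have "x \<in> H \<union> t ` H" if "t x \<noteq> x" for x
      using that tt[of x] by (cases "x < t x") (auto simp: H_def image_iff intro!: exI[of _ "t x"])
    then show "moved t = H \<union> t ` H" by (auto simp: moved_def H_def tt)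
    show "H \<inter> t ` H = {}" by (auto simp: H_def tt)
  qed
  then have finH: "finite H" using finM by simp
  then have "card (moved t) = 2 * card H"
    using H injt by (simp add: card_Un_disjoint card_image inj_on_subset)
  then have "2 * j \<le> card H" using j(2) by simp
  then obtain H' where H': "H' \<subseteq> H" "card H' = 2 * j" "finite H'"
    using obtain_subset_with_card_n by metis
  define V where "V = H' \<union> t ` H'"
  have disj: "H' \<inter> t ` H' = {}" using H'(1) H(2) by blast
  have cardV: "card V = 4 * j"
    using H' disj injt by (simp add: V_def card_Un_disjoint card_image inj_on_subset)
  have VM: "V \<subseteq> moved t" using H' H by (auto simp: V_def)
  then have VS: "V \<subseteq> S" using moved_subset[OF t(1)] by blast
  have tV: "t x \<in> V \<longleftrightarrow> x \<in> V" for x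
    using tt by (auto simp: V_def image_iff) metis+
  have "j \<le> card (S - V)"
    using S VS j(1) cardV by (subst card_Diff_subset) (auto intro: finite_subset)
  then obtain W where W: "W \<subseteq> S - V" "card W = j" "finite W"
    using obtain_subset_with_card_n by metis
  obtain e where e: "bij_betw e ({..<j} \<times> {0, 2::nat}) H'"
    using finite_same_card_bij[of "{..<j} \<times> {0, 2::nat}" H'] H' by (auto simp: card_cartesian_product)
  obtain w where w: "bij_betw w {..<j} W"
    using finite_same_card_bij[of "{..<j}" W] W by auto
  \<comment> \<open>Columns 1 and 3 are the partners under \<open>t\<close> of columns 0 and 2, so
    that \<open>double_swap\<close> acts on \<open>V\<close> exactly as \<open>t\<close>
    does.\<close>
  define f where "f = (\<lambda>(i, c). if c = 0 \<or> c = 2 then e (i, c)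
    else if c = 1 \<or> c = 3 then t (e (i, c - 1)) else w i)"
  have five: "{..<5::nat} = {0, 2} \<union> {1, 3} \<union> {4}" by auto
  have f0: "bij_betw f ({..<j} \<times> {0, 2}) H'"
    using e by (rule bij_betw_cong[THEN iffD1, rotated]) (auto simp: f_def)
  have f1: "bij_betw f ({..<j} \<times> {1, 3}) (t ` H')"
  proof -
    have "bij_betw (\<lambda>(i, c). (i, c - 1)) ({..<j} \<times> {1, 3}) ({..<j} \<times> {0, 2::nat})"
      by (auto simp: bij_betw_def inj_on_def image_iff)
    moreover have "bij_betw t H' (t ` H')"
      using inj_on_subset[OF injt] by (intro inj_on_imp_bij_betw) simp
    ultimately have "bij_betw (t \<circ> (e \<circ> (\<lambda>(i, c). (i, c - 1)))) ({..<j} \<times> {1, 3}) (t ` H')"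
      by (intro bij_betw_trans[OF bij_betw_trans[OF _ e]])
    then show ?thesis by (rule bij_betw_cong[THEN iffD1, rotated]) (auto simp: f_def)
  qed
  have f2: "bij_betw f ({..<j} \<times> {4}) W"
  proof -
    have "bij_betw (w \<circ> fst) ({..<j} \<times> {4::nat}) W"
      by (rule bij_betw_trans[OF _ w]) (auto simp: bij_betw_def inj_on_def)
    then show ?thesis by (rule bij_betw_cong[THEN iffD1, rotated]) (auto simp: f_def)
  qed
  have "bij_betw f ({..<j} \<times> {0, 2} \<union> {..<j} \<times> {1, 3} \<union> {..<j} \<times> {4}) (H' \<union> t ` H' \<union> W)"
    using f0 f1 f2 disj W(1) by (intro bij_betw_combine) (auto simp: V_def)
  then have "bij_betw f ({..<j} \<times> {..<5}) (V \<union> W)"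
    by (simp only: five Sigma_Un_distrib2 V_def)
  then have inj: "inj_on f ({..<j} \<times> {..<5})" and img: "f ` ({..<j} \<times> {..<5}) = V \<union> W"
    by (auto simp: bij_betw_def)
  define t' where "t' = (\<lambda>x. if x \<in> V then x else t x)"
  have t'2: "t' \<circ> t' = id" using tt tV by (auto simp: t'_def fun_eq_iff)
  then have "bij t'" by (meson o_bij)
  moreover have "t' x = x" if "x \<notin> S" for x
    using that permutes_not_in[OF t(1)] by (simp add: t'_def)
  ultimately have t'S: "t' permutes S" by (simp add: permutes_def bij_iff)
  have sp: "spread f j double_swap (f (i, c)) = (if c = 4 then f (i, c) else t (f (i, c)))"
    if "i < j" "c < 5" for i c
  proof -
    have "c \<in> {0, 1, 2, 3, 4}" using that(2) by auto
    then show ?thesis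
      using spread_apply[OF inj that, of double_swap] by (auto simp: f_def tt)
  qed
  have fW: "c = 4" if "i < j" "c < 5" "f (i, c) \<notin> V" for i c
  proof (rule ccontr)
    assume "c \<noteq> 4"
    then have "(i, c) \<in> {..<j} \<times> {0, 2} \<union> {..<j} \<times> {1, 3}" using that(1,2) by auto
    then have "f (i, c) \<in> V" using f0 f1 unfolding V_def bij_betw_def by blast
    then show False using that(3) by blast
  qed
  have fV: "c \<noteq> 4" if "i < j" "f (i, c) \<in> V" for i c
    using that W(1) f2 unfolding bij_betw_def by blast
  have "t x = (spread f j double_swap \<circ> t') x" for x
  proof (cases "x \<in> V")
    case True
    then have "x \<in> f ` ({..<j} \<times> {..<5})" using img by simp
    then obtain i c where ic: "i < j" "c < 5" "x = f (i, c)" by auto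
    then show ?thesis using True sp[OF ic(1,2)] fV[of i c] by (simp add: t'_def)
  next
    case False
    then have nV: "t x \<notin> V" by (simp add: tV)
    have "spread f j double_swap (t x) = t x"
    proof (cases "t x \<in> f ` ({..<j} \<times> {..<5})")
      case True
      then obtain i c where ic: "i < j" "c < 5" "t x = f (i, c)" by auto
      then show ?thesis using sp[OF ic(1,2)] fW[OF ic(1,2)] nV by simp
    qed (rule spread_outside)
    then show ?thesis using False by (simp add: t'_def)
  qed
  then have t_eq: "t = spread f j double_swap \<circ> t'" by auto
  have "double_swap permutes {..<5}"
    unfolding double_swap_def by (intro permutes_compose three_cycle_permutes) auto
  from spread_comp[OF inj this, of double_swap]
  have "spread f j (double_swap \<circ> double_swap) = spread f j double_swap \<circ> spread f j double_swap" .
  moreover have "double_swap \<circ> double_swap = id"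
    by (auto simp: double_swap_def three_cycle_def fun_eq_iff)
  ultimately have "spread f j double_swap \<circ> spread f j double_swap = id"
    using spread_id[OF inj] by simp
  then have "t' \<circ> spread f j double_swap = t"
    using t(2) t'2 t_eq by (metis comp_assoc comp_id id_comp)
  moreover have "card (moved t') = card (moved t) - 4 * j"
  proof -
    have "moved t' = moved t - V" by (auto simp: moved_def t'_def)
    then show ?thesis using VM finM cardV by (simp add: card_Diff_subset finite_subset)
  qed
  ultimately show ?thesis using that[OF inj _ t'S t'2 t_eq] img VS W(1) by blast
qed

section \<open>Even permutations as bounded products of double commutators\<close>

text \<open>The involution \<open>t\<close> below reflects every orbit of \<open>a\<close> in a chosen point: \<open>t (a\<^sup>n r) = a\<^sup>-\<^sup>n r\<close>.\<close>

lemma permutation_eq_comp_involutions: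
  assumes "finite S" "a permutes S"
  obtains t1 t2 where "t1 permutes S" "t2 permutes S" "t1 \<circ> t1 = id" "t2 \<circ> t2 = id"
    "a = t1 \<circ> t2" "moved t1 \<subseteq> moved a" "moved t2 \<subseteq> moved a"
proof -
  define orb where "orb x = {y. \<exists>n. y = (a ^^ n) x}" for x
  define r where "r x = (SOME y. y \<in> orb x)" for x
  have inj: "inj (a ^^ n)" for n using permutes_inj[OF assms(2)] by simp
  have self: "x \<in> orb x" for x unfolding orb_def by (auto intro: exI[of _ 0])
  \<comment> \<open>Every point has a finite period, so going forward by \<open>k * n - n\<close>
    steps leads from \<open>y\<close> back to \<open>x\<close>. This makes the forward orbits
    equivalence classes.\<close>
  have sym: "x \<in> orb y" if y: "y \<in> orb x" for x y
  proof -
    obtain n where n: "y = (a ^^ n) x" using y by (auto simp: orb_def)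
    obtain k where k: "k > 0" "(a ^^ k) x = x"
      using permutation_self permutes_imp_permutation[OF assms] by metis
    have "(a ^^ (k * n)) x = x" for n
      using k(2) by (induction n) (simp_all add: funpow_add)
    moreover have "k * n = (k * n - n) + n" using k(1) by (cases k) auto
    ultimately have "(a ^^ (k * n - n)) y = x" by (metis n funpow_add comp_apply)
    then show ?thesis by (auto simp: orb_def)
  qed
  have trans: "z \<in> orb x" if "y \<in> orb x" "z \<in> orb y" for x y z
    using that by (auto simp: orb_def) (metis funpow_add comp_apply)
  have orb_eq: "orb y = orb x" if "y \<in> orb x" for x y
    using that sym trans by blast
  have r_orb: "r x \<in> orb x" for x unfolding r_def by (rule someI) (rule self)
  have r_eq: "r y = r x" if "y \<in> orb x" for x y unfolding r_def using orb_eq[OF that] by simp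
  have ex: "\<exists>n. x = (a ^^ n) (r x)" for x using sym[OF r_orb[of x]] by (auto simp: orb_def)
  have ex_pre: "\<exists>z. (a ^^ n) z = y" for n y
    using permutes_surj[OF assms(2)] by (metis surj_fn surjD)
  \<comment> \<open>The reflected point a^-n (r x) is described as the solution of an equation,
    which avoids negative powers. By \<open>t_char\<close> all admissible \<open>n\<close> give the
    same point, because powers of \<open>a\<close> commute and are injective.\<close>
  define t where "t x = (SOME z. \<exists>n. x = (a ^^ n) (r x) \<and> (a ^^ n) z = r x)" for x
  have t_char: "(a ^^ m) (t x) = r x" if m: "x = (a ^^ m) (r x)" for m x
  proof -
    have "\<exists>n. x = (a ^^ n) (r x) \<and> (a ^^ n) (t x) = r x"
      unfolding t_def by (rule someI_ex) (use ex[of x] ex_pre in metis)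
    then obtain n where n: "x = (a ^^ n) (r x)" "(a ^^ n) (t x) = r x" by blast
    have "(a ^^ n) ((a ^^ m) (t x)) = (a ^^ m) ((a ^^ n) (t x))"
      by (metis add.commute comp_apply funpow_add)
    then have "(a ^^ n) ((a ^^ m) (t x)) = (a ^^ n) (r x)" using m n by metis
    then show ?thesis using inj injD by metis
  qed
  have r_t: "r (t x) = r x" for x
  proof -
    obtain n where "x = (a ^^ n) (r x)" using ex by blast
    then have "r x = (a ^^ n) (t x)" using t_char[of x n] by simp
    then have "r x \<in> orb (t x)" unfolding orb_def by blast
    then show ?thesis using r_eq r_orb sym by metis
  qed
  have tt: "t (t x) = x" for x
  proof -
    obtain n where n: "x = (a ^^ n) (r x)" using ex by blast
    obtain m where m: "t x = (a ^^ m) (r x)" using ex[of "t x"] r_t by metis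
    have "(a ^^ m) x = (a ^^ n) (t x)" by (metis n m add.commute comp_apply funpow_add)
    also have "\<dots> = r x" using t_char n .
    finally have "(a ^^ m) x = (a ^^ m) (t (t x))" using t_char[of "t x" m] m r_t by metis
    then show ?thesis using inj injD by metis
  qed
  \<comment> \<open>This is the dihedral relation a t a = t. As \<open>t\<close> is an involution,
    it says that \<open>a \<circ> t\<close> is one too.\<close>
  have ata: "a (t (a x)) = t x" for x
  proof -
    obtain n where n: "x = (a ^^ n) (r x)" using ex by blast
    have "a x \<in> orb x" unfolding orb_def by (auto intro: exI[of _ 1])
    then have rax: "r (a x) = r x" by (rule r_eq)
    have "a x = (a ^^ Suc n) (r (a x))" using n by (simp add: rax)
    then have "(a ^^ Suc n) (t (a x)) = r x" using t_char[of "a x" "Suc n"] rax by simp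
    then have "(a ^^ n) (a (t (a x))) = (a ^^ n) (t x)"
      using t_char[OF n] by (simp add: funpow_swap1)
    then show ?thesis using inj injD by metis
  qed
  have fix_t: "t x = x" if "a x = x" for x
  proof -
    have "(a ^^ n) x = x" for n using that by (induction n) auto
    then have "r x = x" using r_orb[of x] by (auto simp: orb_def)
    then show ?thesis using t_char[of x 0] by simp
  qed
  have perm: "p permutes S" if "p \<circ> p = id" "moved p \<subseteq> moved a" for p
  proof -
    have "bij p" using that(1) by (meson o_bij)
    moreover have "p x = x" if "x \<notin> S" for x
      using \<open>moved p \<subseteq> _\<close> permutes_not_in[OF assms(2) that] by (auto simp: moved_def)
    ultimately show ?thesis by (simp add: permutes_def bij_iff)
  qed
  have 1: "(a \<circ> t) \<circ> (a \<circ> t) = id" using ata tt by (auto simp: fun_eq_iff)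
  have 2: "t \<circ> t = id" using tt by (auto simp: fun_eq_iff)
  have 3: "moved (a \<circ> t) \<subseteq> moved a" "moved t \<subseteq> moved a"
    using fix_t by (auto simp: moved_def)
  have "a = (a \<circ> t) \<circ> t" using 2 by (simp add: comp_assoc)
  with that[of "a \<circ> t" t] perm 1 2 3 show ?thesis by blast
qed

text \<open>The moved points of an involution come in pairs, and two pairs would already be four
  points.\<close>

lemma involution_moving_less_than_four:
  assumes t: "t permutes S" "t \<circ> t = id" and c: "finite S" "card (moved t) < 4"
  shows "t = id \<or> (\<exists>x\<in>S. \<exists>y\<in>S. x \<noteq> y \<and> t = Transposition.transpose x y)"
proof (rule disjCI)
  assume "\<not> (\<exists>x\<in>S. \<exists>y\<in>S. x \<noteq> y \<and> t = Transposition.transpose x y)"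
  note no = this
  have tt: "t (t x) = x" for x using t(2) by (metis comp_apply id_apply)
  show "t = id"
  proof (rule ccontr)
    assume "t \<noteq> id"
    then obtain x where x: "t x \<noteq> x" by (auto simp: fun_eq_iff)
    then have "x \<in> S" "t x \<in> S" using t(1) permutes_not_in permutes_in_image by metis+
    then have "t \<noteq> Transposition.transpose x (t x)" using no x by metis
    then obtain z where "t z \<noteq> Transposition.transpose x (t x) z" by auto
    then have z: "z \<noteq> x" "z \<noteq> t x" "t z \<noteq> z"
      using tt by (auto simp: Transposition.transpose_def split: if_splits)
    have "t z \<noteq> x" "t z \<noteq> t x" using z tt by metis+
    then have "card {x, t x, z, t z} = 4" using x z by (simp add: eq_commute)
    moreover have "t (t x) \<noteq> t x" "t (t z) \<noteq> t z" using x z tt by metis+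
    then have "{x, t x, z, t z} \<subseteq> moved t" using x z by (simp add: moved_def)
    ultimately show False
      using c(2) card_mono[OF finite_subset[OF moved_subset[OF t(1)] c(1)], of "{x, t x, z, t z}"] by linarith
  qed
qed

text \<open>The transposition \<open>\<tau>\<close> takes care of the parity and of supports whose size is not divisible by 4.\<close>

lemma involution_double_commutator_products:
  fixes t :: "'a::linorder \<Rightarrow> 'a"
  assumes S: "finite S" and b: "b permutes S" and k: "0 < k" "8 * k \<le> card S" "k \<le> card T"
    and T: "T \<subseteq> moved b" "T \<inter> b ` T = {}"
    and t: "t permutes S" "t \<circ> t = id" "card (moved t) < 4 * k * q + 4"
  shows "\<exists>B\<in>double_commutator_products S b (2 * q). \<exists>B'\<in>double_commutator_products S b (2 * q). \<exists>\<tau>.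
    t = B \<circ> \<tau> \<and> t = \<tau> \<circ> B' \<and>
    (\<tau> = id \<or> (\<exists>x\<in>S. \<exists>y\<in>S. x \<noteq> y \<and> \<tau> = Transposition.transpose x y))"
  using t
proof (induction q arbitrary: t)
  case 0
  then have "card (moved t) < 4" by simp
  from involution_moving_less_than_four[OF 0(1,2) S this]
  show ?case unfolding mult_0_right double_commutator_products.simps by (metis id_comp comp_id insertI1)
next
  case (Suc q)
  \<comment> \<open>A full round removes \<open>4 * k\<close> moved points at the cost of two
    factors; when fewer are left, the largest possible multiple of 4 is removed.\<close>
  define j where "j = min k (card (moved t) div 4)"
  show ?case
  proof (cases "j = 0")
    case True
    then have "card (moved t) < 4" using k by (auto simp: j_def min_def split: if_splits)
    moreover have "id \<in> double_commutator_products S b (2 * Suc q)"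
      using double_commutator_products_mono[OF b, of 0 "2 * Suc q" id] by simp
    ultimately show ?thesis
      using involution_moving_less_than_four[OF Suc.prems(1,2) S] by (metis id_comp comp_id)
  next
    case False
    have j: "8 * j \<le> card S" "4 * j \<le> card (moved t)" "j \<le> card T" "0 < j"
      using k False by (auto simp: j_def)
    obtain f t' where f: "inj_on f ({..<j} \<times> {..<5})" "f ` ({..<j} \<times> {..<5}) \<subseteq> S"
      and t': "t' permutes S" "t' \<circ> t' = id" "t = spread f j double_swap \<circ> t'"
        "t = t' \<circ> spread f j double_swap" "card (moved t') = card (moved t) - 4 * j"
      using involution_split_block[OF S Suc.prems(1,2) j(1,2)] by metis
    have "card (moved t') < 4 * k * q + 4"
    proof (cases "k \<le> card (moved t) div 4")
      case True
      then show ?thesis using t'(5) Suc.prems(3) by (auto simp: j_def algebra_simps)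
    next
      case False
      then show ?thesis using t'(5) by (auto simp: j_def min_def)
    qed
    from Suc.IH[OF t'(1,2) this] obtain B B' \<tau> where
      B: "B \<in> double_commutator_products S b (2 * q)" "B' \<in> double_commutator_products S b (2 * q)"
      "t' = B \<circ> \<tau>" "t' = \<tau> \<circ> B'"
      "\<tau> = id \<or> (\<exists>x\<in>S. \<exists>y\<in>S. x \<noteq> y \<and> \<tau> = Transposition.transpose x y)" by blast
    have sp: "spread f j double_swap \<in> double_commutator_products S b 2"
      using S b j(4,1,3) T f by (rule spread_double_swap_in_products)
    have "spread f j double_swap \<circ> B \<in> double_commutator_products S b (2 * Suc q)"
      "B' \<circ> spread f j double_swap \<in> double_commutator_products S b (2 * Suc q)"
      using double_commutator_products_comp[OF sp B(1)] double_commutator_products_comp[OF B(2) sp]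
      by (simp_all only: mult_Suc_right add.commute)
    moreover have "t = spread f j double_swap \<circ> B \<circ> \<tau>" "t = \<tau> \<circ> (B' \<circ> spread f j double_swap)"
      using t'(3) t'(4)[unfolded B(4)] B(3) by (simp_all only: comp_assoc)
    ultimately show ?thesis using B(5) by blast
  qed
qed

text \<open>Such a product is an involution with exactly four moved points, so splitting off a
  single block leaves the identity.\<close>

lemma transpositions_double_commutator_products:
  fixes x y p q :: "'a::linorder"
  assumes S: "finite S" and b: "b permutes S" and c: "8 \<le> card S" "1 \<le> card T"
    and T: "T \<subseteq> moved b" "T \<inter> b ` T = {}"
    and d: "distinct [x, y, p, q]" "{x, y, p, q} \<subseteq> S"
  shows "Transposition.transpose x y \<circ> Transposition.transpose p q \<in> double_commutator_products S b 2"
proof -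
  let ?t = "Transposition.transpose x y \<circ> Transposition.transpose p q"
  have t: "?t permutes S" "?t \<circ> ?t = id"
    using d by (auto intro!: permutes_compose permutes_swap_id
        simp: fun_eq_iff Transposition.transpose_def)
  have "moved ?t = {x, y, p, q}"
    using d by (auto simp: moved_def Transposition.transpose_def)
  then have m: "card (moved ?t) = 4" using d by simp
  obtain f t' where f: "inj_on f ({..<1} \<times> {..<5})" "f ` ({..<1} \<times> {..<5}) \<subseteq> S"
    and t': "t' permutes S" "?t = spread f 1 double_swap \<circ> t'" "card (moved t') = card (moved ?t) - 4 * 1"
    using involution_split_block[OF S t, of 1] c m by (metis mult.right_neutral order_refl)
  have "moved t' = {}"
    using t'(3) m finite_subset[OF moved_subset[OF t'(1)] S] by simp
  then have "t' = id" by (auto simp: moved_def)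
  then show ?thesis
    using spread_double_swap_in_products[OF S b, of 1 T f] c T f t'(2) by simp
qed

text \<open>The permutation \<open>a\<close> is a product of two involutions. With blocks in number
  \<open>k\<close> comparable to the support of \<open>b\<close>, each involution is exhausted up to
  a transposition in \<open>4 * K\<close> rounds of two factors, which gives \<open>16 * K\<close>
  in all. The additional 4 factors pay for the two transpositions left over.\<close>

lemma even_perm_double_commutator_products:
  fixes a b :: "'a::linorder \<Rightarrow> 'a"
  assumes S: "finite S" "8 \<le> card S" and b: "b permutes S" "b \<noteq> id" and a: "a \<in> even_perms S"
    and K: "card (moved a) \<le> K * card (moved b)"
  shows "a \<in> double_commutator_products S b (16 * K + 4)"
proof -
  obtain T where T: "T \<subseteq> moved b" "T \<inter> b ` T = {}" "card (moved b) \<le> 3 * card T"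
    using displaced_subset[OF S(1) b(1)] by metis
  have finM: "finite (moved p)" "card (moved p) \<le> card S" if "p permutes S" for p
    using that S(1) moved_subset finite_subset card_mono by metis+
  have "moved b \<noteq> {}" using b(2) by (auto simp: moved_def fun_eq_iff)
  then have mb: "0 < card (moved b)" using finM[OF b(1)] by (simp add: card_gt_0_iff)
  \<comment> \<open>The divisor 8 respects the bound by \<open>card S\<close>, and also the bound by
    \<open>card T\<close>, which is at least a third of the support. Rounding costs at most another
    factor 2, whence \<open>card (moved b) \<le> 16 * k\<close>. The maximum with 1 covers supports
    of fewer than 8 points and relies on \<open>8 \<le> card S\<close>.\<close>
  define k where "k = max 1 (card (moved b) div 8)"
  have k: "0 < k" "8 * k \<le> card S" "k \<le> card T" "card (moved b) \<le> 16 * k" "1 \<le> card T"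
    using S(2) T(3) mb finM(2)[OF b(1)] by (auto simp: k_def max_def)
  obtain t1 t2 where t: "t1 permutes S" "t2 permutes S" "t1 \<circ> t1 = id" "t2 \<circ> t2 = id"
    "a = t1 \<circ> t2" "moved t1 \<subseteq> moved a" "moved t2 \<subseteq> moved a"
    using permutation_eq_comp_involutions[OF S(1) even_perms_permutes[OF a]] by metis
  have "K * card (moved b) \<le> 4 * k * (4 * K)" using k(4) by simp
  then have "card (moved a) \<le> 4 * k * (4 * K)" using K by linarith
  then have lt: "card (moved t1) < 4 * k * (4 * K) + 4" "card (moved t2) < 4 * k * (4 * K) + 4"
    using card_mono[OF finM(1)[OF even_perms_permutes[OF a]]] t(6,7) by (meson le_less_trans less_add_same_cancel1 zero_less_numeral order_trans)+
  obtain B1 \<tau>1 where B1: "B1 \<in> double_commutator_products S b (2 * (4 * K))" "t1 = B1 \<circ> \<tau>1"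
    "\<tau>1 = id \<or> (\<exists>x\<in>S. \<exists>y\<in>S. x \<noteq> y \<and> \<tau>1 = Transposition.transpose x y)"
    using involution_double_commutator_products[OF S(1) b(1) k(1-3) T(1,2) t(1,3) lt(1)] by blast
  obtain B2 \<tau>2 where B2: "B2 \<in> double_commutator_products S b (2 * (4 * K))" "t2 = \<tau>2 \<circ> B2"
    "\<tau>2 = id \<or> (\<exists>x\<in>S. \<exists>y\<in>S. x \<noteq> y \<and> \<tau>2 = Transposition.transpose x y)"
    using involution_double_commutator_products[OF S(1) b(1) k(1-3) T(1,2) t(2,4) lt(2)] by blast
  note prod_even = double_commutator_products_subset[OF S(1) b(1), THEN subsetD]
  \<comment> \<open>The first involution is used with its transposition on the right, the second
    with its transposition on the left. So the two meet in the middle, where the evenness of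
    \<open>a\<close> forces both or neither to be trivial.\<close>
  have a_eq: "a = B1 \<circ> (\<tau>1 \<circ> \<tau>2) \<circ> B2" using t(5) B1(2) B2(2) by (simp add: comp_assoc)
  have "permutation \<tau>1" "permutation \<tau>2"
    using B1(3) B2(3) by (auto simp: permutation_swap_id)
  moreover have "permutation B1" "permutation B2"
    using B1(1) B2(1) prod_even even_perms_permutes permutes_imp_permutation[OF S(1)] by blast+
  ultimately have perm: "permutation \<tau>1" "permutation \<tau>2" "permutation B1" "permutation B2" .
  have "evenperm B1" "evenperm B2" "evenperm a"
    using prod_even[OF B1(1)] prod_even[OF B2(1)] a by (auto simp: even_perms_def)
  then have ev: "evenperm \<tau>1 \<longleftrightarrow> evenperm \<tau>2"
    using perm by (auto simp: a_eq evenperm_comp permutation_compose)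
  have "\<tau>1 \<circ> \<tau>2 \<in> double_commutator_products S b 4"
  proof (cases "\<tau>1 = id")
    case True
    then have "\<tau>2 = id" using ev B2(3) by (auto simp: evenperm_swap)
    then show ?thesis
      using True double_commutator_products_mono[OF b(1), of 0 4 id] by simp
  next
    case False
    then obtain x y where xy: "x \<in> S" "y \<in> S" "x \<noteq> y" "\<tau>1 = Transposition.transpose x y"
      using B1(3) by blast
    then have "\<tau>2 \<noteq> id" using ev by (auto simp: evenperm_swap)
    then obtain u v where uv: "u \<in> S" "v \<in> S" "u \<noteq> v" "\<tau>2 = Transposition.transpose u v"
      using B2(3) by blast
    \<comment> \<open>The two transpositions may overlap or coincide, so a third one, disjoint from
      both, is inserted twice between them. The eight points of \<open>S\<close> leave room for
      it.\<close>
    have "card {x, y, u, v} \<le> 4" by (simp add: card_insert_if)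
    then have "2 \<le> card (S - {x, y, u, v})"
      using S xy uv by (subst card_Diff_subset) auto
    then obtain T' where "T' \<subseteq> S - {x, y, u, v}" "card T' = 2"
      by (meson obtain_subset_with_card_n)
    then obtain p q where pq: "p \<in> S - {x, y, u, v}" "q \<in> S - {x, y, u, v}" "p \<noteq> q"
      by (auto simp: card_2_iff)
    have "Transposition.transpose x y \<circ> Transposition.transpose p q \<in> double_commutator_products S b 2"
      "Transposition.transpose p q \<circ> Transposition.transpose u v \<in> double_commutator_products S b 2"
      using pq xy uv by (auto intro!: transpositions_double_commutator_products[OF S(1) b(1) S(2) k(5) T(1,2)])
    moreover have "\<tau>1 \<circ> \<tau>2 = (Transposition.transpose x y \<circ> Transposition.transpose p q) \<circ>
        (Transposition.transpose p q \<circ> Transposition.transpose u v)"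
      unfolding xy(4) uv(4) by (metis comp_assoc id_comp transpose_comp_involutory)
    ultimately show ?thesis
      using double_commutator_products_comp[of _ S b 2 _ 2] by simp
  qed
  from double_commutator_products_comp[OF double_commutator_products_comp[OF B1(1) this] B2(1)]
  show ?thesis by (simp add: a_eq)
qed

section \<open>Approximate actions and their amplification\<close>

text \<open>
  Here \<open>\<delta>\<close> bounds the proportion of the points at which multiplicativity fails, and \<open>c g\<close> the
  proportion of the points fixed by \<open>g\<close>. Under product actions the former add up and the latter
  multiply.
\<close>

definition approx_on ::
  "('a, 'b) monoid_scheme \<Rightarrow> 'a set \<Rightarrow> real \<Rightarrow> ('a \<Rightarrow> real) \<Rightarrow> 'x set \<Rightarrow> ('a \<Rightarrow> 'x \<Rightarrow> 'x) \<Rightarrow> bool" where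
  "approx_on G \<Phi> \<delta> c X \<phi> \<longleftrightarrow>
    finite X \<and> X \<noteq> {} \<and> (\<forall>g\<in>\<Phi>. \<phi> g permutes X) \<and> (\<one>\<^bsub>G\<^esub> \<in> \<Phi> \<longrightarrow> \<phi> \<one>\<^bsub>G\<^esub> = id) \<and>
    (\<forall>g\<in>\<Phi>. \<forall>h\<in>\<Phi>. g \<otimes>\<^bsub>G\<^esub> h \<in> \<Phi> \<longrightarrow>
      real (card {x \<in> X. \<phi> (g \<otimes>\<^bsub>G\<^esub> h) x \<noteq> \<phi> g (\<phi> h x)}) \<le> \<delta> * real (card X)) \<and>
    (\<forall>g\<in>\<Phi>. real (card {x \<in> X. \<phi> g x = x}) \<le> c g * real (card X))"

text \<open>A formula cannot quantify over the type of \<open>X\<close>. Sets of natural numbers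
  represent all finite sets, as \<open>approximableI\<close> confirms.\<close>

definition approximable ::
  "('a, 'b) monoid_scheme \<Rightarrow> 'a set \<Rightarrow> real \<Rightarrow> ('a \<Rightarrow> real) \<Rightarrow> bool" where
  "approximable G \<Phi> \<delta> c \<longleftrightarrow> (\<exists>(X :: nat set) \<phi>. approx_on G \<Phi> \<delta> c X \<phi>)"

section \<open>Transport, products and powers of approximate actions\<close>

lemma approx_on_transport:
  assumes a: "approx_on G \<Phi> \<delta> c X \<phi>" and f: "bij_betw f X Y"
  shows "approx_on G \<Phi> \<delta> c Y (\<lambda>g. map_permutation X f (\<phi> g))"
proof -
  have inj: "inj_on f X" and Y: "Y = f ` X" using f by (auto simp: bij_betw_def)
  let ?\<psi> = "\<lambda>g. map_permutation X f (\<phi> g)"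
  have card_eq: "card {y \<in> Y. P y} = card {x \<in> X. P (f x)}" for P
  proof -
    have "{y \<in> Y. P y} = f ` {x \<in> X. P (f x)}" using Y by auto
    then show ?thesis using inj by (auto intro!: card_image intro: inj_on_subset)
  qed
  have perm: "\<phi> g permutes X" if "g \<in> \<Phi>" for g using a that by (simp add: approx_on_def)
  have app: "?\<psi> g (f x) = f (\<phi> g x)" if "x \<in> X" for g x
    using inj that by (rule map_permutation_apply)
  have feq: "f x = f y \<longleftrightarrow> x = y" if "x \<in> X" "y \<in> X" for x y
    using inj that by (auto dest: inj_onD)
  have mem: "\<phi> g x \<in> X" if "g \<in> \<Phi>" "x \<in> X" for g x
    using permutes_in_image[OF perm[OF that(1)]] that(2) by simp
  have cY: "card Y = card X" using f by (metis bij_betw_same_card)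
  have 1: "card {y \<in> Y. ?\<psi> (g \<otimes>\<^bsub>G\<^esub> h) y \<noteq> ?\<psi> g (?\<psi> h y)} =
      card {x \<in> X. \<phi> (g \<otimes>\<^bsub>G\<^esub> h) x \<noteq> \<phi> g (\<phi> h x)}"
    if "g \<in> \<Phi>" "h \<in> \<Phi>" "g \<otimes>\<^bsub>G\<^esub> h \<in> \<Phi>" for g h
    unfolding card_eq using that
    by (intro arg_cong[where f = card] Collect_cong conj_cong refl) (simp add: app feq mem)
  have 2: "card {y \<in> Y. ?\<psi> g y = y} = card {x \<in> X. \<phi> g x = x}" if "g \<in> \<Phi>" for g
    unfolding card_eq using that
    by (intro arg_cong[where f = card] Collect_cong conj_cong refl) (simp add: app feq mem)
  have 3: "?\<psi> g permutes Y" if "g \<in> \<Phi>" for g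
    using f perm[OF that] by (rule map_permutation_permutes)
  have 4: "?\<psi> \<one>\<^bsub>G\<^esub> = id" if "\<one>\<^bsub>G\<^esub> \<in> \<Phi>"
    using a that inj by (simp add: approx_on_def map_permutation_id')
  show ?thesis using a 1 2 3 4 cY Y by (simp add: approx_on_def)
qed

lemma approximableI:
  assumes "approx_on G \<Phi> \<delta> c X \<phi>"
  shows "approximable G \<Phi> \<delta> c"
proof -
  have "finite X" using assms by (simp add: approx_on_def)
  then obtain h where "bij_betw h X {0..<card X}" using ex_bij_betw_finite_nat by blast
  from approx_on_transport[OF assms this] show ?thesis unfolding approximable_def by blast
qed

lemma approximable_mono:
  assumes "approximable G \<Phi> \<delta> c" "\<delta> \<le> \<delta>'" "\<And>g. g \<in> \<Phi> \<Longrightarrow> c g \<le> c' g"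
  shows "approximable G \<Phi> \<delta>' c'"
proof -
  obtain X :: "nat set" and \<phi> where a: "approx_on G \<Phi> \<delta> c X \<phi>"
    using assms(1) by (auto simp: approximable_def)
  have le: "\<delta> * real (card X) \<le> \<delta>' * real (card X)"
    "g \<in> \<Phi> \<Longrightarrow> c g * real (card X) \<le> c' g * real (card X)" for g
    using assms(2,3) by (auto intro!: mult_right_mono)
  have "approx_on G \<Phi> \<delta>' c' X \<phi>"
    using a le unfolding approx_on_def by (meson order_trans)
  then show ?thesis by (rule approximableI)
qed

lemma approximable_trivial: "approximable G \<Phi> 0 (\<lambda>_. 1)"
  by (rule approximableI[of _ _ _ _ "{()}" "\<lambda>_. id"]) (simp add: approx_on_def)

text \<open>A pair is fixed if and only if both coordinates are, whereas multiplicativity fails at a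
  pair only if it fails at one of the coordinates.\<close>

lemma approximable_mult:
  assumes "approximable G \<Phi> \<delta> c" "approximable G \<Phi> \<delta>' c'"
  shows "approximable G \<Phi> (\<delta> + \<delta>') (\<lambda>g. c g * c' g)"
proof -
  obtain X :: "nat set" and \<phi> where a: "approx_on G \<Phi> \<delta> c X \<phi>"
    using assms(1) by (auto simp: approximable_def)
  obtain Y :: "nat set" and \<psi> where b: "approx_on G \<Phi> \<delta>' c' Y \<psi>"
    using assms(2) by (auto simp: approximable_def)
  define \<chi> where "\<chi> g z = (if z \<in> X \<times> Y then (\<phi> g (fst z), \<psi> g (snd z)) else z)" for g z
  have fin: "finite X" "finite Y" "X \<noteq> {}" "Y \<noteq> {}" using a b by (auto simp: approx_on_def)
  have perm: "\<phi> g permutes X" "\<psi> g permutes Y" if "g \<in> \<Phi>" for g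
    using a b that by (auto simp: approx_on_def)
  have mem: "\<phi> g x \<in> X" "\<psi> g y \<in> Y" if "g \<in> \<Phi>" "x \<in> X" "y \<in> Y" for g x y
    using permutes_in_image[OF perm(1)[OF that(1)]] permutes_in_image[OF perm(2)[OF that(1)]] that
    by auto
  have 1: "\<chi> g permutes X \<times> Y" if g: "g \<in> \<Phi>" for g
  proof (rule inj_imp_permutes)
    show "finite (X \<times> Y)" using fin by simp
    have eq: "\<phi> g x = \<phi> g x' \<longleftrightarrow> x = x'" "\<psi> g y = \<psi> g y' \<longleftrightarrow> y = y'" for x x' y y'
      using permutes_inj[OF perm(1)[OF g]] permutes_inj[OF perm(2)[OF g]] by (simp_all add: inj_eq)
    show "inj_on (\<chi> g) (X \<times> Y)"
      by (rule inj_onI) (simp add: \<chi>_def eq prod_eq_iff)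
    show "\<chi> g z \<in> X \<times> Y" if "z \<in> X \<times> Y" for z
      using that mem[OF g] by (auto simp: \<chi>_def)
    show "\<chi> g z = z" if "z \<notin> X \<times> Y" for z
      using that by (simp only: \<chi>_def if_False)
  qed
  have 2: "\<chi> \<one>\<^bsub>G\<^esub> = id" if "\<one>\<^bsub>G\<^esub> \<in> \<Phi>"
    using a b that by (auto simp: approx_on_def \<chi>_def fun_eq_iff)
  have cXY: "real (card (X \<times> Y)) = real (card X) * real (card Y)"
    by (simp add: card_cartesian_product)
  have 3: "real (card {z \<in> X \<times> Y. \<chi> (g \<otimes>\<^bsub>G\<^esub> h) z \<noteq> \<chi> g (\<chi> h z)}) \<le> (\<delta> + \<delta>') * real (card (X \<times> Y))"
    if g: "g \<in> \<Phi>" "h \<in> \<Phi>" "g \<otimes>\<^bsub>G\<^esub> h \<in> \<Phi>" for g h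
  proof -
    define A where "A = {x \<in> X. \<phi> (g \<otimes>\<^bsub>G\<^esub> h) x \<noteq> \<phi> g (\<phi> h x)}"
    define B where "B = {x \<in> Y. \<psi> (g \<otimes>\<^bsub>G\<^esub> h) x \<noteq> \<psi> g (\<psi> h x)}"
    have AB: "real (card A) \<le> \<delta> * real (card X)" "real (card B) \<le> \<delta>' * real (card Y)"
      using a b g by (auto simp: approx_on_def A_def B_def)
    have fAB: "finite A" "finite B" using fin by (auto simp: A_def B_def)
    have "{z \<in> X \<times> Y. \<chi> (g \<otimes>\<^bsub>G\<^esub> h) z \<noteq> \<chi> g (\<chi> h z)} \<subseteq> A \<times> Y \<union> X \<times> B"
    proof
      fix z assume z: "z \<in> {z \<in> X \<times> Y. \<chi> (g \<otimes>\<^bsub>G\<^esub> h) z \<noteq> \<chi> g (\<chi> h z)}"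
      then obtain x y where xy: "z = (x, y)" "x \<in> X" "y \<in> Y" by auto
      then have "\<chi> g (\<chi> h z) = (\<phi> g (\<phi> h x), \<psi> g (\<psi> h y))"
        "\<chi> (g \<otimes>\<^bsub>G\<^esub> h) z = (\<phi> (g \<otimes>\<^bsub>G\<^esub> h) x, \<psi> (g \<otimes>\<^bsub>G\<^esub> h) y)"
        using mem[OF g(2), of x y] by (simp_all add: \<chi>_def)
      then show "z \<in> A \<times> Y \<union> X \<times> B"
        using z xy by (auto simp: A_def B_def)
    qed
    then have "card {z \<in> X \<times> Y. \<chi> (g \<otimes>\<^bsub>G\<^esub> h) z \<noteq> \<chi> g (\<chi> h z)} \<le> card (A \<times> Y \<union> X \<times> B)"
      using fAB fin by (intro card_mono) auto
    also have "\<dots> \<le> card A * card Y + card X * card B"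
      using card_Un_le[of "A \<times> Y" "X \<times> B"] by (simp add: card_cartesian_product)
    finally have "real (card {z \<in> X \<times> Y. \<chi> (g \<otimes>\<^bsub>G\<^esub> h) z \<noteq> \<chi> g (\<chi> h z)}) \<le>
        real (card A) * real (card Y) + real (card X) * real (card B)"
      by (simp only: of_nat_le_iff flip: of_nat_add of_nat_mult)
    also have "\<dots> \<le> (\<delta> * real (card X)) * real (card Y) + real (card X) * (\<delta>' * real (card Y))"
      using AB by (intro add_mono mult_right_mono mult_left_mono) auto
    finally show ?thesis by (simp add: cXY algebra_simps)
  qed
  have 4: "real (card {z \<in> X \<times> Y. \<chi> g z = z}) \<le> c g * c' g * real (card (X \<times> Y))"
    if g: "g \<in> \<Phi>" for g
  proof -
    have "{z \<in> X \<times> Y. \<chi> g z = z} = {x \<in> X. \<phi> g x = x} \<times> {x \<in> Y. \<psi> g x = x}"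
    proof (rule Set.set_eqI)
      fix z :: "nat \<times> nat"
      obtain x y where z: "z = (x, y)" by (cases z)
      have "\<chi> g z = (\<phi> g x, \<psi> g y)" if "z \<in> X \<times> Y"
        using that by (simp only: \<chi>_def if_True z fst_conv snd_conv)
      then show "z \<in> {z \<in> X \<times> Y. \<chi> g z = z} \<longleftrightarrow> z \<in> {x \<in> X. \<phi> g x = x} \<times> {x \<in> Y. \<psi> g x = x}"
        unfolding z by (cases "x \<in> X \<and> y \<in> Y") auto
    qed
    then have "real (card {z \<in> X \<times> Y. \<chi> g z = z}) =
        real (card {x \<in> X. \<phi> g x = x}) * real (card {x \<in> Y. \<psi> g x = x})"
      by (simp add: card_cartesian_product)
    also have "\<dots> \<le> (c g * real (card X)) * (c' g * real (card Y))"
    proof (rule mult_mono)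
      show 1: "real (card {x \<in> X. \<phi> g x = x}) \<le> c g * real (card X)"
        using a g by (simp add: approx_on_def)
      then show "0 \<le> c g * real (card X)" by (rule order_trans[OF of_nat_0_le_iff])
      show "real (card {x \<in> Y. \<psi> g x = x}) \<le> c' g * real (card Y)"
        using b g by (simp add: approx_on_def)
    qed simp
    finally show ?thesis by (simp add: cXY algebra_simps)
  qed
  have "approx_on G \<Phi> (\<delta> + \<delta>') (\<lambda>g. c g * c' g) (X \<times> Y) \<chi>"
    unfolding approx_on_def using fin 1 2 3 4 by simp
  then show ?thesis by (rule approximableI)
qed

lemma approximable_power:
  assumes "approximable G \<Phi> \<delta> c"
  shows "approximable G \<Phi> (real k * \<delta>) (\<lambda>g. c g ^ k)"
proof (induction k)
  case 0 then show ?case using approximable_trivial by simp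
next
  case (Suc k)
  from approximable_mult[OF assms Suc] show ?case by (simp add: algebra_simps)
qed

lemma approximable_prod:
  assumes "finite \<Psi>" "\<And>i. i \<in> \<Psi> \<Longrightarrow> approximable G \<Phi> \<delta> (c i)"
  shows "approximable G \<Phi> (real (card \<Psi>) * \<delta>) (\<lambda>g. \<Prod>i\<in>\<Psi>. c i g)"
  using assms
proof (induction \<Psi> rule: finite_induct)
  case empty then show ?case using approximable_trivial by simp
next
  case (insert i \<Psi>)
  from approximable_mult[OF insert.prems[of i] insert.IH[OF insert.prems]] insert.hyps
  show ?case by (simp add: algebra_simps)
qed

text \<open>About 1/\<mu> copies suffice: the proportion of fixed points drops to (1 -
  \<mu>)^(1/\<mu>) \<le> 1/e < 1/2, while the defect grows at most to 2 \<delta> / \<mu> \<le>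
  \<epsilon>. The factor 2 absorbs the rounding of 1/\<mu>, by \<mu> \<le> 1.\<close>

lemma approximable_amplify:
  assumes a: "approximable G \<Phi> \<delta> (\<lambda>g. if g = g0 then 1 - \<mu> else 1)"
    and \<mu>: "0 < \<mu>" "\<mu> \<le> 1" and \<delta>: "0 \<le> \<delta>" "2 * \<delta> \<le> \<epsilon> * \<mu>"
  shows "approximable G \<Phi> \<epsilon> (\<lambda>g. if g = g0 then 1 / 2 else 1)"
proof -
  define k where "k = nat \<lceil>1 / \<mu>\<rceil>"
  have k: "1 / \<mu> \<le> real k" "real k \<le> 1 / \<mu> + 1"
  proof -
    have "0 < 1 / \<mu>" using \<mu> by simp
    then have "0 \<le> \<lceil>1 / \<mu>\<rceil>" by linarith
    then have "real k = of_int \<lceil>1 / \<mu>\<rceil>" by (simp add: k_def)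
    then show "1 / \<mu> \<le> real k" "real k \<le> 1 / \<mu> + 1" by linarith+
  qed
  have "real k \<le> 2 / \<mu>"
  proof -
    have "1 \<le> 1 / \<mu>" using \<mu> by simp
    then show ?thesis using k(2) by simp
  qed
  then have "real k * \<delta> \<le> (2 / \<mu>) * \<delta>" using \<delta>(1) by (rule mult_right_mono)
  also have "\<dots> \<le> \<epsilon>" using \<delta>(2) \<mu>(1) by (simp add: field_simps)
  finally have 1: "real k * \<delta> \<le> \<epsilon>" .
  have "1 - \<mu> \<le> exp (- \<mu>)" using exp_ge_add_one_self[of "- \<mu>"] by simp
  then have "(1 - \<mu>) ^ k \<le> exp (- \<mu>) ^ k" using \<mu> by (intro power_mono) auto
  also have "\<dots> = exp (- (real k * \<mu>))" by (simp flip: exp_of_nat_mult)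
  also have "\<dots> \<le> exp (- 1)" using k(1) \<mu>(1) by (simp add: field_simps)
  also have "\<dots> \<le> 1 / 2"
    using exp_ge_add_one_self[of 1] by (simp add: exp_minus field_simps)
  finally have 2: "(1 - \<mu>) ^ k \<le> 1 / 2" .
  show ?thesis
    by (rule approximable_mono[OF approximable_power[OF a, of k] 1]) (use 2 in auto)
qed

section \<open>From approximate actions to soficity\<close>

lemma card_permutes_disagree:
  assumes p: "p permutes X" and q: "q permutes X"
  shows "card {x \<in> X. (p \<circ> inv' q) x \<noteq> x} = card {x \<in> X. p x \<noteq> q x}"
proof -
  have "{x \<in> X. (p \<circ> inv' q) x \<noteq> x} = q ` {x \<in> X. p x \<noteq> q x}"
  proof (intro Set.set_eqI iffI)
    fix y assume y: "y \<in> {x \<in> X. (p \<circ> inv' q) x \<noteq> x}"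
    then have "inv' q y \<in> {x \<in> X. p x \<noteq> q x}"
      using permutes_in_image[OF permutes_inv[OF q]] permutes_inverses[OF q] by auto
    then have "q (inv' q y) \<in> q ` {x \<in> X. p x \<noteq> q x}" by blast
    then show "y \<in> q ` {x \<in> X. p x \<noteq> q x}" by (simp add: permutes_inverses[OF q])
  qed (use permutes_in_image[OF q] permutes_inverses[OF q] in auto)
  then show ?thesis using permutes_inj_on[OF q] by (simp add: card_image)
qed

text \<open>The product of the actions obtained for the various \<open>g0\<close> moves every
  nontrivial element of \<open>\<Phi>\<close> on at least half of the points, because in each
  product one factor is 1/2 and no other exceeds 1. So the constant 1/2 can serve as the lower bound
  for all nontrivial elements.\<close>

lemma soficI_approximable:
  assumes G: "group G"
    and a: "\<And>\<Phi> \<epsilon> g0. finite \<Phi> \<Longrightarrow> \<Phi> \<subseteq> carrier G \<Longrightarrow> \<epsilon> > 0 \<Longrightarrow> g0 \<in> \<Phi> \<Longrightarrow> g0 \<noteq> \<one>\<^bsub>G\<^esub> \<Longrightarrow>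
      approximable G \<Phi> \<epsilon> (\<lambda>g. if g = g0 then 1 / 2 else 1)"
  shows "sofic G"
proof -
  have main: "\<exists>m \<ge> 1. \<exists>\<phi> \<in> \<Phi> \<rightarrow> carrier (sym_group m).
          (\<one>\<^bsub>G\<^esub> \<in> \<Phi> \<longrightarrow> \<phi> \<one>\<^bsub>G\<^esub> = \<one>\<^bsub>sym_group m\<^esub>) \<and>
          (\<forall>g \<in> \<Phi>. hamming_length m (\<phi> g) \<ge> (if g = \<one>\<^bsub>G\<^esub> then 0 else 1 / 2)) \<and>
          (\<forall>g \<in> \<Phi>. \<forall>h \<in> \<Phi>. g \<otimes>\<^bsub>G\<^esub> h \<in> \<Phi> \<longrightarrow>
            hamming_length m
              (\<phi> (g \<otimes>\<^bsub>G\<^esub> h) \<otimes>\<^bsub>sym_group m\<^esub>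
                inv\<^bsub>sym_group m\<^esub> (\<phi> g \<otimes>\<^bsub>sym_group m\<^esub> \<phi> h)) < \<epsilon>)"
    if \<Phi>: "finite \<Phi>" "\<Phi> \<subseteq> carrier G" and \<epsilon>: "\<epsilon> > 0" for \<Phi> and \<epsilon> :: real
  proof -
    define \<Psi> where "\<Psi> = \<Phi> - {\<one>\<^bsub>G\<^esub>}"
    \<comment> \<open>The summand 1 makes the total defect strictly smaller than
      \<open>\<epsilon>\<close>, as the definition of \<open>sofic\<close> demands.\<close>
    define \<delta> where "\<delta> = \<epsilon> / (real (card \<Psi>) + 1)"
    have \<Psi>: "finite \<Psi>" using \<Phi>(1) by (simp add: \<Psi>_def)
    have "approximable G \<Phi> (real (card \<Psi>) * \<delta>) (\<lambda>g. \<Prod>i\<in>\<Psi>. if g = i then 1 / 2 else 1)"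
      using \<Phi> \<epsilon> by (intro approximable_prod[OF \<Psi>] a) (auto simp: \<Psi>_def \<delta>_def)
    moreover have "(\<Prod>i\<in>\<Psi>. if g = i then 1 / 2 else 1) = (if g \<in> \<Psi> then 1 / 2 else (1::real))" for g
      using prod.delta'[OF \<Psi>, of g "\<lambda>_. 1 / 2 :: real"] by simp
    ultimately obtain X :: "nat set" and \<phi>0
      where \<phi>0: "approx_on G \<Phi> (real (card \<Psi>) * \<delta>) (\<lambda>g. if g \<in> \<Psi> then 1 / 2 else 1) X \<phi>0"
      by (auto simp: approximable_def)
    have X: "finite X" "X \<noteq> {}" using \<phi>0 by (auto simp: approx_on_def)
    define m where "m = card X"
    have m: "1 \<le> m" using X by (simp add: m_def Suc_le_eq card_gt_0_iff)
    have "card X = card {1..m}" by (simp add: m_def)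
    then obtain f where "bij_betw f X {1..m}"
      using finite_same_card_bij[OF X(1) finite_atLeastAtMost] by blast
    from approx_on_transport[OF \<phi>0 this] obtain \<phi>
      where \<phi>: "approx_on G \<Phi> (real (card \<Psi>) * \<delta>) (\<lambda>g. if g \<in> \<Psi> then 1 / 2 else 1) {1..m} \<phi>"
      by blast
    have perm: "\<phi> g permutes {1..m}" if "g \<in> \<Phi>" for g using \<phi> that by (simp add: approx_on_def)
    have "hamming_length m (\<phi> g) \<ge> 1 / 2" if g: "g \<in> \<Phi>" "g \<noteq> \<one>\<^bsub>G\<^esub>" for g
    proof -
      have "{x \<in> {1..m}. \<phi> g x \<noteq> x} = {1..m} - {x \<in> {1..m}. \<phi> g x = x}" by auto
      moreover have "card ({1..m} - {x \<in> {1..m}. \<phi> g x = x}) = m - card {x \<in> {1..m}. \<phi> g x = x}"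
        by (subst card_Diff_subset) auto
      ultimately have "card {x \<in> {1..m}. \<phi> g x \<noteq> x} = m - card {x \<in> {1..m}. \<phi> g x = x}"
        by (simp only:)
      moreover have "card {x \<in> {1..m}. \<phi> g x = x} \<le> m"
        using card_mono[OF finite_atLeastAtMost, of "{x \<in> {1..m}. \<phi> g x = x}" 1 m]
        by (simp add: subset_iff)
      moreover have "real (card {x \<in> {1..m}. \<phi> g x = x}) \<le> 1 / 2 * real m"
        using \<phi> g by (auto simp: approx_on_def \<Psi>_def)
      ultimately have "real (card {x \<in> {1..m}. \<phi> g x \<noteq> x}) \<ge> 1 / 2 * real m"
        by (simp add: of_nat_diff)
      then show ?thesis using m by (simp add: hamming_length_def field_simps)
    qed
    moreover have "hamming_length m (\<phi> g) \<ge> 0" for g by (simp add: hamming_length_def)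
    moreover have "hamming_length m (\<phi> (g \<otimes>\<^bsub>G\<^esub> h) \<otimes>\<^bsub>sym_group m\<^esub>
        inv\<^bsub>sym_group m\<^esub> (\<phi> g \<otimes>\<^bsub>sym_group m\<^esub> \<phi> h)) < \<epsilon>"
      if g: "g \<in> \<Phi>" "h \<in> \<Phi>" "g \<otimes>\<^bsub>G\<^esub> h \<in> \<Phi>" for g h
    proof -
      have pgh: "\<phi> g \<circ> \<phi> h permutes {1..m}" using perm g by (simp add: permutes_compose)
      then have inv: "inv\<^bsub>sym_group m\<^esub> (\<phi> g \<circ> \<phi> h) = inv' (\<phi> g \<circ> \<phi> h)"
        by (intro sym_group_inv_equality) (simp add: sym_group_carrier)
      have "real (card {x \<in> {1..m}. \<phi> (g \<otimes>\<^bsub>G\<^esub> h) x \<noteq> (\<phi> g \<circ> \<phi> h) x}) \<le> real (card \<Psi>) * \<delta> * real m"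
        using \<phi> g by (auto simp: approx_on_def)
      also have "\<dots> < \<epsilon> * real m"
        using \<epsilon> m by (simp add: \<delta>_def field_simps)
      finally show ?thesis
        using m card_permutes_disagree[OF perm[OF g(3)] pgh]
        by (simp add: hamming_length_def sym_group_mult inv divide_less_eq mult.commute del: comp_apply)
    qed
    moreover have "\<phi> \<in> \<Phi> \<rightarrow> carrier (sym_group m)" using perm by (simp add: sym_group_carrier)
    moreover have "\<one>\<^bsub>G\<^esub> \<in> \<Phi> \<longrightarrow> \<phi> \<one>\<^bsub>G\<^esub> = \<one>\<^bsub>sym_group m\<^esub>"
      using \<phi> by (simp add: approx_on_def sym_group_one)
    ultimately show ?thesis using m by (intro exI[of _ m] conjI bexI[of _ \<phi>] ballI impI) simp_all
  qed
  show ?thesis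
    unfolding sofic_def
  proof (intro exI[of _ "\<lambda>g. if g = \<one>\<^bsub>G\<^esub> then 0 else 1 / 2"] conjI allI impI)
    fix \<Phi> and \<epsilon> :: real
    assume "finite \<Phi> \<and> \<Phi> \<subseteq> carrier G \<and> \<epsilon> > 0"
    then show "\<exists>m \<ge> 1. \<exists>\<phi> \<in> \<Phi> \<rightarrow> carrier (sym_group m).
          (\<one>\<^bsub>G\<^esub> \<in> \<Phi> \<longrightarrow> \<phi> \<one>\<^bsub>G\<^esub> = \<one>\<^bsub>sym_group m\<^esub>) \<and>
          (\<forall>g \<in> \<Phi>. hamming_length m (\<phi> g) \<ge> (if g = \<one>\<^bsub>G\<^esub> then 0 else 1 / 2)) \<and>
          (\<forall>g \<in> \<Phi>. \<forall>h \<in> \<Phi>. g \<otimes>\<^bsub>G\<^esub> h \<in> \<Phi> \<longrightarrow>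
            hamming_length m
              (\<phi> (g \<otimes>\<^bsub>G\<^esub> h) \<otimes>\<^bsub>sym_group m\<^esub>
                inv\<^bsub>sym_group m\<^esub> (\<phi> g \<otimes>\<^bsub>sym_group m\<^esub> \<phi> h)) < \<epsilon>)"
      by (elim conjE) (rule main)
  qed simp_all
qed

section \<open>Quotients of products of symmetric and alternating groups\<close>

lemma (in normal) rcos_eq_iff:
  assumes "x \<in> carrier G" "y \<in> carrier G"
  shows "H #> x = H #> y \<longleftrightarrow> x \<otimes> inv y \<in> H"
proof
  assume "H #> x = H #> y"
  then have "x \<in> H #> y" using rcos_self[OF assms(1) subgroup_axioms] by simp
  then show "x \<otimes> inv y \<in> H" by (rule rcos_module_imp[OF is_group assms(2)])
next
  assume "x \<otimes> inv y \<in> H"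
  then have "x \<in> H #> y" by (rule rcos_module_rev[OF is_group assms(2,1)])
  then show "H #> x = H #> y" using repr_independence[OF _ assms(2) subgroup_axioms] by simp
qed

text \<open>Left multiplication by \<open>s g\<close> acts on the cosets of the normal subgroup
  \<open>M\<close>, multiplicatively because the defects of \<open>s\<close> lie in
  \<open>M\<close>. A coset is fixed only by multipliers from \<open>M\<close>, so \<open>g0\<close>
  fixes none. The set \<open>A\<close> cuts out a finite invariant part, on which an injective map
  is a permutation.\<close>

lemma approximable_of_coset_action:
  fixes G :: "('a, 'b) monoid_scheme" and P :: "('p, 'q) monoid_scheme"
  assumes M: "M \<lhd> P" and s: "\<And>g. g \<in> \<Phi> \<Longrightarrow> s g \<in> carrier P"
    and s_mult: "\<And>g h. g \<in> \<Phi> \<Longrightarrow> h \<in> \<Phi> \<Longrightarrow> g \<otimes>\<^bsub>G\<^esub> h \<in> \<Phi> \<Longrightarrow>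
      s (g \<otimes>\<^bsub>G\<^esub> h) \<otimes>\<^bsub>P\<^esub> inv\<^bsub>P\<^esub> (s g \<otimes>\<^bsub>P\<^esub> s h) \<in> M"
    and s_one: "s \<one>\<^bsub>G\<^esub> = \<one>\<^bsub>P\<^esub>" and g0: "g0 \<in> \<Phi>" "s g0 \<notin> M"
    and A: "A \<subseteq> carrier P" "A \<noteq> {}" "\<And>g p. g \<in> \<Phi> \<Longrightarrow> p \<in> A \<Longrightarrow> s g \<otimes>\<^bsub>P\<^esub> p \<in> A"
    and fin: "finite ((\<lambda>p. M #>\<^bsub>P\<^esub> p) ` A)"
  shows "approximable G \<Phi> 0 (\<lambda>g. if g = g0 then 0 else 1)"
proof -
  interpret M: normal M P by (rule M)
  define X where "X = (\<lambda>p. M #>\<^bsub>P\<^esub> p) ` A"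
  define \<phi> where "\<phi> g C = (if C \<in> X then (M #>\<^bsub>P\<^esub> s g) <#>\<^bsub>P\<^esub> C else C)" for g C
  have Ac: "p \<in> carrier P" if "p \<in> A" for p using A(1) that by blast
  have act: "\<phi> g (M #>\<^bsub>P\<^esub> p) = M #>\<^bsub>P\<^esub> (s g \<otimes>\<^bsub>P\<^esub> p)" if "g \<in> \<Phi>" "p \<in> A" for g p
    using that s[OF that(1)] Ac[OF that(2)] by (simp add: \<phi>_def X_def M.rcos_sum)
  have eq: "M #>\<^bsub>P\<^esub> (x \<otimes>\<^bsub>P\<^esub> p) = M #>\<^bsub>P\<^esub> (y \<otimes>\<^bsub>P\<^esub> p) \<longleftrightarrow> x \<otimes>\<^bsub>P\<^esub> inv\<^bsub>P\<^esub> y \<in> M"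
    if "x \<in> carrier P" "y \<in> carrier P" "p \<in> carrier P" for x y p
    using that by (simp add: M.rcos_eq_iff M.inv_mult_group M.m_assoc M.inv_solve_left
        flip: M.m_assoc[of p "inv\<^bsub>P\<^esub> p" "inv\<^bsub>P\<^esub> y"])
  have perm: "\<phi> g permutes X" if g: "g \<in> \<Phi>" for g
  proof (rule inj_imp_permutes)
    show "inj_on (\<phi> g) X"
    proof (rule inj_onI)
      fix C C' assume "C \<in> X" "C' \<in> X" and e: "\<phi> g C = \<phi> g C'"
      then obtain p p' where p: "p \<in> A" "p' \<in> A" "C = M #>\<^bsub>P\<^esub> p" "C' = M #>\<^bsub>P\<^esub> p'"
        by (auto simp: X_def)
      note c = s[OF g] Ac[OF p(1)] Ac[OF p(2)]
      have "(s g \<otimes>\<^bsub>P\<^esub> p) \<otimes>\<^bsub>P\<^esub> inv\<^bsub>P\<^esub> (s g \<otimes>\<^bsub>P\<^esub> p') \<in> M"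
        using e p c by (simp add: act g M.rcos_eq_iff)
      then have "inv\<^bsub>P\<^esub> s g \<otimes>\<^bsub>P\<^esub> ((s g \<otimes>\<^bsub>P\<^esub> p) \<otimes>\<^bsub>P\<^esub> inv\<^bsub>P\<^esub> (s g \<otimes>\<^bsub>P\<^esub> p')) \<otimes>\<^bsub>P\<^esub> s g \<in> M"
        using c by (intro M.inv_op_closed1)
      also have "inv\<^bsub>P\<^esub> s g \<otimes>\<^bsub>P\<^esub> ((s g \<otimes>\<^bsub>P\<^esub> p) \<otimes>\<^bsub>P\<^esub> inv\<^bsub>P\<^esub> (s g \<otimes>\<^bsub>P\<^esub> p')) \<otimes>\<^bsub>P\<^esub> s g = p \<otimes>\<^bsub>P\<^esub> inv\<^bsub>P\<^esub> p'"
        using c by (simp add: M.inv_mult_group M.m_assoc)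
          (simp add: M.m_assoc[symmetric])
      finally show "C = C'" using c p by (simp add: M.rcos_eq_iff)
    qed
    show "finite X" using fin by (simp add: X_def)
    show "\<phi> g C \<in> X" if "C \<in> X" for C
      using that act[OF g] A(3)[OF g] by (auto simp: X_def)
    show "\<phi> g C = C" if "C \<notin> X" for C using that by (simp add: \<phi>_def)
  qed
  have one: "\<phi> \<one>\<^bsub>G\<^esub> = id" if "\<one>\<^bsub>G\<^esub> \<in> \<Phi>"
  proof
    fix C
    show "\<phi> \<one>\<^bsub>G\<^esub> C = id C"
    proof (cases "C \<in> X")
      case True
      then obtain p where "p \<in> A" "C = M #>\<^bsub>P\<^esub> p" by (auto simp: X_def)
      then show ?thesis using act[OF that] Ac by (simp add: s_one)
    qed (simp add: \<phi>_def)
  qed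
  have mult: "\<phi> (g \<otimes>\<^bsub>G\<^esub> h) C = \<phi> g (\<phi> h C)"
    if g: "g \<in> \<Phi>" "h \<in> \<Phi>" "g \<otimes>\<^bsub>G\<^esub> h \<in> \<Phi>" and C: "C \<in> X" for g h C
  proof -
    obtain p where p: "p \<in> A" "C = M #>\<^bsub>P\<^esub> p" using C by (auto simp: X_def)
    have "\<phi> g (\<phi> h C) = M #>\<^bsub>P\<^esub> (s g \<otimes>\<^bsub>P\<^esub> s h \<otimes>\<^bsub>P\<^esub> p)"
      using p g A(3) Ac s by (simp add: act M.m_assoc)
    then show ?thesis
      using p g s_mult[OF g] s Ac by (simp add: act eq)
  qed
  have free: "\<phi> g0 C \<noteq> C" if C: "C \<in> X" for C
  proof
    assume a: "\<phi> g0 C = C"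
    obtain p where p: "p \<in> A" "C = M #>\<^bsub>P\<^esub> p" using C by (auto simp: X_def)
    then have "M #>\<^bsub>P\<^esub> (s g0 \<otimes>\<^bsub>P\<^esub> p) = M #>\<^bsub>P\<^esub> (\<one>\<^bsub>P\<^esub> \<otimes>\<^bsub>P\<^esub> p)"
      using a act[OF g0(1) p(1)] Ac by simp
    then show False using eq[of "s g0" "\<one>\<^bsub>P\<^esub>" p] s[OF g0(1)] Ac[OF p(1)] g0(2) by simp
  qed
  have "card {C \<in> X. \<phi> g C = C} \<le> card X" for g
    using fin by (intro card_mono) (auto simp: X_def)
  moreover have "{C \<in> X. \<phi> g0 C = C} = {}" using free by blast
  moreover have "{C \<in> X. \<phi> (g \<otimes>\<^bsub>G\<^esub> h) C \<noteq> \<phi> g (\<phi> h C)} = {}"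
    if "g \<in> \<Phi>" "h \<in> \<Phi>" "g \<otimes>\<^bsub>G\<^esub> h \<in> \<Phi>" for g h
    using mult[OF that] by blast
  ultimately have "approx_on G \<Phi> 0 (\<lambda>g. if g = g0 then 0 else 1) X \<phi>"
    using perm one fin A(2) by (simp add: approx_on_def X_def[symmetric]) (simp add: X_def)
  then show ?thesis by (rule approximableI)
qed

text \<open>
  The representation \<open>residue m\<close> of the permutations of \<open>{1..m}\<close> has values in the symmetric group
  on 8 points; its kernel is trivial for \<open>m < 8\<close> and the alternating group otherwise.
\<close>

definition residue :: "nat \<Rightarrow> (nat \<Rightarrow> nat) \<Rightarrow> nat \<Rightarrow> nat" where
  "residue m p = (if m < 8 then p else if evenperm p then id else Transposition.transpose 1 2)"

lemma residue_permutes: "p permutes {1..m} \<Longrightarrow> residue m p permutes {1..8}"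
  by (auto simp: residue_def intro: permutes_subset permutes_swap_id)

lemma residue_comp:
  assumes "p permutes {1..m}" "q permutes {1..m}"
  shows "residue m (p \<circ> q) = residue m p \<circ> residue m q"
  using assms permutes_imp_permutation[of "{1..m}"] by (auto simp: residue_def evenperm_comp)

lemma residue_id [simp]: "residue m id = id"
  by (simp add: residue_def)

lemma residue_inv:
  assumes "p permutes {1..m}"
  shows "residue m (inv' p) = inv' (residue m p)"
  using assms permutes_imp_permutation[of "{1..m}"] by (auto simp: residue_def evenperm_inv)

lemma residue_eq_idD:
  assumes "p permutes {1..m}" "residue m p = id" "p \<noteq> id"
  shows "8 \<le> m" "p \<in> even_perms {1..m}"
proof -
  have "Transposition.transpose 1 (2::nat) \<noteq> id" by (metis id_apply numeral_eq_one_iff semiring_norm(85) transpose_apply_first)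
  then show "8 \<le> m" "p \<in> even_perms {1..m}"
    using assms by (auto simp: residue_def even_perms_def split: if_splits)
qed

section \<open>Products of permutation groups and their normal subgroups\<close>

locale perm_product =
  fixes I :: "'i set" and H :: "'i \<Rightarrow> (nat \<Rightarrow> nat) monoid" and m :: "'i \<Rightarrow> nat"
  assumes H: "\<And>i. i \<in> I \<Longrightarrow> H i = alt_group (m i) \<or> H i = sym_group (m i)"
    and m: "\<And>i. i \<in> I \<Longrightarrow> 1 \<le> m i"
begin

definition "P = product_group I H"

lemma group_H: "i \<in> I \<Longrightarrow> group (H i)"
  using H[of i] by (auto simp: alt_group_is_group sym_group_is_group)

lemma carrier_H: "i \<in> I \<Longrightarrow> p \<in> carrier (H i) \<Longrightarrow> p permutes {1..m i}"
  using H[of i] by (auto simp: alt_group_carrier sym_group_carrier)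

lemma even_perms_carrier_H: "i \<in> I \<Longrightarrow> p \<in> even_perms {1..m i} \<Longrightarrow> p \<in> carrier (H i)"
  using H[of i] by (auto simp: alt_group_carrier sym_group_carrier even_perms_def)

lemma inv_H: "i \<in> I \<Longrightarrow> p \<in> carrier (H i) \<Longrightarrow> inv\<^bsub>H i\<^esub> p = inv' p"
  using H[of i] alt_group_inv_equality[of p "m i"] sym_group_inv_equality[of p "m i"] by auto

lemma group_P: "group P"
  by (simp add: P_def group_H)

sublocale P: group P by (rule group_P)

lemma permutes_P: "x \<in> carrier P \<Longrightarrow> i \<in> I \<Longrightarrow> x i permutes {1..m i}"
  by (rule carrier_H) (auto simp: P_def)

lemma mult_P: "i \<in> I \<Longrightarrow> (x \<otimes>\<^bsub>P\<^esub> y) i = x i \<circ> y i"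
  using H[of i] by (auto simp: P_def alt_group_mult sym_group_mult)

lemma one_P: "i \<in> I \<Longrightarrow> \<one>\<^bsub>P\<^esub> i = id"
  using H[of i] by (auto simp: P_def alt_group_one sym_group_one)

lemma inv_P:
  assumes "x \<in> carrier P" "i \<in> I"
  shows "(inv\<^bsub>P\<^esub> x) i = inv' (x i)"
proof -
  have "x \<in> (\<Pi>\<^sub>E i\<in>I. carrier (H i))" using assms(1) by (simp add: P_def)
  moreover from this have "x i \<in> carrier (H i)" using assms(2) by (rule PiE_mem)
  ultimately show ?thesis using assms(2) by (simp add: P_def group_H inv_H)
qed

lemma eq_P: "x \<in> carrier P \<Longrightarrow> y \<in> carrier P \<Longrightarrow> (\<And>i. i \<in> I \<Longrightarrow> x i = y i) \<Longrightarrow> x = y"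
  unfolding P_def carrier_product_group by (rule PiE_ext)

lemma restrict_in_P:
  "(\<And>i. i \<in> I \<Longrightarrow> f i \<in> carrier (H i)) \<Longrightarrow> restrict f I \<in> carrier P"
  by (simp add: P_def)

text \<open>Choosing the auxiliary permutations coordinatewise makes \<open>z\<close> a conjugate of
  a double commutator of \<open>d\<close> in \<open>P\<close>, and each commutator with an element
  of \<open>N\<close> is a product of two elements of \<open>N\<close>. Where
  \<open>z i = id\<close>, trivial auxiliary permutations are chosen; this is how a subset of the
  coordinates is selected.\<close>

lemma double_commutators_in_normal:
  assumes N: "N \<lhd> P" and d: "d \<in> N" and z: "z \<in> carrier P"
    and zd: "\<And>i. i \<in> I \<Longrightarrow> z i = id \<or> z i \<in> double_commutators {1..m i} (d i)"
  shows "z \<in> N"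
proof -
  interpret N: normal N P by (rule N)
  have dP: "d \<in> carrier P" using d N.subset by blast
  have "z i \<in> double_commutators {1..m i} (d i)" if "i \<in> I" for i
    using zd[OF that] id_in_double_commutators[OF permutes_P[OF dP that]] by auto
  then have "\<forall>i\<in>I. \<exists>\<sigma> x y. \<sigma> \<in> even_perms {1..m i} \<and> x \<in> even_perms {1..m i} \<and> y \<in> even_perms {1..m i} \<and>
      z i = \<sigma> \<circ> commutator (commutator (d i) x) y \<circ> inv' \<sigma>"
    unfolding double_commutators_def by blast
  then obtain \<sigma> x y where e: "\<And>i. i \<in> I \<Longrightarrow> \<sigma> i \<in> even_perms {1..m i}"
      "\<And>i. i \<in> I \<Longrightarrow> x i \<in> even_perms {1..m i}" "\<And>i. i \<in> I \<Longrightarrow> y i \<in> even_perms {1..m i}"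
    and zi: "\<And>i. i \<in> I \<Longrightarrow> z i = \<sigma> i \<circ> commutator (commutator (d i) (x i)) (y i) \<circ> inv' (\<sigma> i)"
    by metis
  define \<sigma>' x' y' where "\<sigma>' = restrict \<sigma> I" "x' = restrict x I" "y' = restrict y I"
  have c: "\<sigma>' \<in> carrier P" "x' \<in> carrier P" "y' \<in> carrier P"
    using e even_perms_carrier_H by (auto simp: \<sigma>'_x'_y'_def intro!: restrict_in_P)
  define w where "w = d \<otimes>\<^bsub>P\<^esub> (x' \<otimes>\<^bsub>P\<^esub> inv\<^bsub>P\<^esub> d \<otimes>\<^bsub>P\<^esub> inv\<^bsub>P\<^esub> x')"
  have w: "w \<in> N" unfolding w_def using d c by (intro N.m_closed N.inv_op_closed2 N.m_inv_closed)
  then have wP: "w \<in> carrier P" using N.subset by blast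
  define v where "v = w \<otimes>\<^bsub>P\<^esub> (y' \<otimes>\<^bsub>P\<^esub> inv\<^bsub>P\<^esub> w \<otimes>\<^bsub>P\<^esub> inv\<^bsub>P\<^esub> y')"
  have v: "v \<in> N" unfolding v_def using w c by (intro N.m_closed N.inv_op_closed2 N.m_inv_closed)
  then have vP: "v \<in> carrier P" using N.subset by blast
  have "\<sigma>' \<otimes>\<^bsub>P\<^esub> v \<otimes>\<^bsub>P\<^esub> inv\<^bsub>P\<^esub> \<sigma>' \<in> N" using v c by (intro N.inv_op_closed2)
  moreover have "z = \<sigma>' \<otimes>\<^bsub>P\<^esub> v \<otimes>\<^bsub>P\<^esub> inv\<^bsub>P\<^esub> \<sigma>'"
  proof (rule eq_P[OF z])
    fix i assume i: "i \<in> I"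
    have "w i = commutator (d i) (x i)"
      using i dP c by (simp add: w_def mult_P inv_P commutator_def comp_assoc) (simp add: \<sigma>'_x'_y'_def)
    then have "v i = commutator (commutator (d i) (x i)) (y i)"
      using i wP c by (simp add: v_def mult_P inv_P commutator_def[of "w i"] comp_assoc commutator_def[of "commutator _ _"])
        (simp add: \<sigma>'_x'_y'_def)
    then show "z i = (\<sigma>' \<otimes>\<^bsub>P\<^esub> v \<otimes>\<^bsub>P\<^esub> inv\<^bsub>P\<^esub> \<sigma>') i"
      using i c zi[OF i] by (simp add: mult_P inv_P) (simp add: \<sigma>'_x'_y'_def)
  qed (use c vP in simp)
  ultimately show ?thesis by simp
qed

text \<open>The coordinates are divided according to the element of \<open>D\<close> that serves
  them, and \<open>z\<close> is the product of its restrictions to these parts. Finiteness of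
  \<open>D\<close> keeps the product finite.\<close>

lemma double_commutators_in_normal_finite:
  assumes N: "N \<lhd> P" and D: "finite D" "D \<subseteq> N" and z: "z \<in> carrier P"
    and zd: "\<And>i. i \<in> I \<Longrightarrow> z i = id \<or> (\<exists>d\<in>D. z i \<in> double_commutators {1..m i} (d i))"
  shows "z \<in> N"
  using D z zd
proof (induction D arbitrary: z rule: finite_induct)
  case empty
  interpret N: normal N P by (rule N)
  have "z = \<one>\<^bsub>P\<^esub>" using empty by (intro eq_P) (auto simp: one_P)
  then show ?case using N.one_closed by simp
next
  case (insert d D)
  interpret N: normal N P by (rule N)
  define J where "J = {i \<in> I. z i \<in> double_commutators {1..m i} (d i)}"
  define z1 where "z1 = (\<lambda>i\<in>I. if i \<in> J then z i else id)"
  define z2 where "z2 = (\<lambda>i\<in>I. if i \<in> J then id else z i)"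
  have zH: "z i \<in> carrier (H i)" "id \<in> carrier (H i)" if "i \<in> I" for i
    using insert.prems(2) that even_perms_carrier_H[OF that even_perms_id] by (auto simp: P_def)
  have zP: "z1 \<in> carrier P" "z2 \<in> carrier P"
    unfolding z1_def z2_def using zH by (auto intro!: restrict_in_P)
  have "z1 \<in> N"
    by (rule double_commutators_in_normal[OF N _ zP(1), of d])
      (use insert.prems(1) in \<open>auto simp: z1_def J_def\<close>)
  moreover have "z2 \<in> N"
  proof (rule insert.IH[OF _ zP(2)])
    show "D \<subseteq> N" using insert.prems(1) by simp
    show "z2 i = id \<or> (\<exists>d\<in>D. z2 i \<in> double_commutators {1..m i} (d i))" if "i \<in> I" for i
      using insert.prems(3)[OF that] that by (auto simp: z2_def J_def)
  qed
  ultimately have "z1 \<otimes>\<^bsub>P\<^esub> z2 \<in> N" by (rule N.m_closed)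
  moreover have "z = z1 \<otimes>\<^bsub>P\<^esub> z2"
    using insert.prems(2) zP by (intro eq_P) (auto simp: mult_P z1_def z2_def)
  ultimately show ?case by simp
qed

text \<open>One factor is removed in all coordinates at once. This works because \<open>n\<close> is
  the same for all coordinates, so that \<open>a\<close> becomes a product of \<open>n\<close>
  elements of \<open>N\<close>.\<close>

lemma double_commutator_products_in_normal:
  assumes N: "N \<lhd> P" and D: "finite D" "D \<subseteq> N" and z: "a \<in> carrier P"
    and ad: "\<And>i. i \<in> I \<Longrightarrow> a i = id \<or> (\<exists>d\<in>D. a i \<in> double_commutator_products {1..m i} (d i) n)"
  shows "a \<in> N"
  using z ad
proof (induction n arbitrary: a)
  case 0
  interpret N: normal N P by (rule N)
  have "a i = id" if "i \<in> I" for i using 0(2)[OF that] by auto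
  then have "a = \<one>\<^bsub>P\<^esub>" using 0(1) by (intro eq_P) (simp_all add: one_P)
  then show ?case using N.one_closed by simp
next
  case (Suc n)
  interpret N: normal N P by (rule N)
  have dperm: "d i permutes {1..m i}" if "d \<in> D" "i \<in> I" for d i
    using D(2) N.subset permutes_P that by blast
  \<comment> \<open>Evenness is recorded because it guarantees that the chosen families are elements
    of \<open>P\<close>.\<close>
  have "\<forall>i\<in>I. \<exists>z w. a i = z \<circ> w \<and> z \<in> even_perms {1..m i} \<and> w \<in> even_perms {1..m i} \<and>
      (z = id \<or> (\<exists>d\<in>D. z \<in> double_commutators {1..m i} (d i))) \<and>
      (w = id \<or> (\<exists>d\<in>D. w \<in> double_commutator_products {1..m i} (d i) n))"
  proof
    fix i assume i: "i \<in> I"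
    show "\<exists>z w. a i = z \<circ> w \<and> z \<in> even_perms {1..m i} \<and> w \<in> even_perms {1..m i} \<and>
      (z = id \<or> (\<exists>d\<in>D. z \<in> double_commutators {1..m i} (d i))) \<and>
      (w = id \<or> (\<exists>d\<in>D. w \<in> double_commutator_products {1..m i} (d i) n))"
    proof (cases "a i = id")
      case True
      then show ?thesis by (intro exI[of _ id]) simp
    next
      case False
      then obtain d where d: "d \<in> D" "a i \<in> double_commutator_products {1..m i} (d i) (Suc n)"
        using Suc.prems(2)[OF i] by blast
      then obtain z w where "a i = z \<circ> w" "z \<in> double_commutators {1..m i} (d i)"
        "w \<in> double_commutator_products {1..m i} (d i) n" by auto
      then show ?thesis
        using d(1) double_commutators_subset[OF _ dperm[OF d(1) i]]
          double_commutator_products_subset[OF _ dperm[OF d(1) i]] by blast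
    qed
  qed
  from bchoice[OF this] obtain z where "\<forall>i\<in>I. \<exists>w. a i = z i \<circ> w \<and>
      z i \<in> even_perms {1..m i} \<and> w \<in> even_perms {1..m i} \<and>
      (z i = id \<or> (\<exists>d\<in>D. z i \<in> double_commutators {1..m i} (d i))) \<and>
      (w = id \<or> (\<exists>d\<in>D. w \<in> double_commutator_products {1..m i} (d i) n))" ..
  from bchoice[OF this] obtain w where "\<forall>i\<in>I. a i = z i \<circ> w i \<and>
      z i \<in> even_perms {1..m i} \<and> w i \<in> even_perms {1..m i} \<and>
      (z i = id \<or> (\<exists>d\<in>D. z i \<in> double_commutators {1..m i} (d i))) \<and>
      (w i = id \<or> (\<exists>d\<in>D. w i \<in> double_commutator_products {1..m i} (d i) n))" ..
  then have zw: "\<And>i. i \<in> I \<Longrightarrow> a i = z i \<circ> w i"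
      "\<And>i. i \<in> I \<Longrightarrow> z i \<in> even_perms {1..m i}" "\<And>i. i \<in> I \<Longrightarrow> w i \<in> even_perms {1..m i}"
      "\<And>i. i \<in> I \<Longrightarrow> z i = id \<or> (\<exists>d\<in>D. z i \<in> double_commutators {1..m i} (d i))"
      "\<And>i. i \<in> I \<Longrightarrow> w i = id \<or> (\<exists>d\<in>D. w i \<in> double_commutator_products {1..m i} (d i) n)"
    by blast+
  have P: "restrict z I \<in> carrier P" "restrict w I \<in> carrier P"
    using zw(2,3) even_perms_carrier_H by (auto intro!: restrict_in_P)
  have "restrict z I \<in> N"
    by (rule double_commutators_in_normal_finite[OF N D P(1)]) (simp only: restrict_apply' zw(4))
  moreover have "restrict w I \<in> N"
    by (rule Suc.IH[OF P(2)]) (simp only: restrict_apply' zw(5))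
  ultimately have "restrict z I \<otimes>\<^bsub>P\<^esub> restrict w I \<in> N" by (rule N.m_closed)
  moreover have "a = restrict z I \<otimes>\<^bsub>P\<^esub> restrict w I"
    using Suc.prems(1) P by (intro eq_P) (auto simp: mult_P zw(1))
  ultimately show ?case by simp
qed

text \<open>Where \<open>a\<close> is nontrivial, its trivial residue says that it is even of degree
  at least 8, and then \<open>16 * K + 4\<close> factors suffice whatever the degree is. The
  contrapositive, applied with the set of all defects as \<open>D\<close>, supplies the coordinate
  to be amplified.\<close>

lemma dominated_in_normal:
  assumes N: "N \<lhd> P" and D: "finite D" "D \<subseteq> N" and a: "a \<in> carrier P"
    and res: "\<And>i. i \<in> I \<Longrightarrow> residue (m i) (a i) = id"
    and dom: "\<And>i. i \<in> I \<Longrightarrow> a i \<noteq> id \<Longrightarrow>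
      \<exists>d\<in>D. card (moved (a i)) < K * card (moved (d i))"
  shows "a \<in> N"
proof (rule double_commutator_products_in_normal[OF N D a])
  interpret N: normal N P by (rule N)
  fix i assume i: "i \<in> I"
  show "a i = id \<or> (\<exists>d\<in>D. a i \<in> double_commutator_products {1..m i} (d i) (16 * K + 4))"
  proof (rule disjCI[THEN disj_commute[THEN iffD1]])
    assume ai: "a i \<noteq> id"
    then obtain d where d: "d \<in> D" "card (moved (a i)) < K * card (moved (d i))" using dom[OF i] by blast
    have "d i permutes {1..m i}" using D(2) d(1) N.subset i permutes_P by blast
    \<comment> \<open>The strict inequality excludes a trivial \<open>d i\<close>.\<close>
    moreover have "d i \<noteq> id" using d(2) by (auto simp: moved_def)
    ultimately have "a i \<in> double_commutator_products {1..m i} (d i) (16 * K + 4)"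
      using d(2) residue_eq_idD[OF permutes_P[OF a i] res[OF i] ai]
      by (intro even_perm_double_commutator_products) auto
    then show "\<exists>d\<in>D. a i \<in> double_commutator_products {1..m i} (d i) (16 * K + 4)" using d(1) by blast
  qed
qed


text \<open>
  The preimage in \<open>P\<close> of the image of \<open>N\<close> in the product of the residue representations.
\<close>

definition residue_closure :: "('i \<Rightarrow> nat \<Rightarrow> nat) set \<Rightarrow> ('i \<Rightarrow> nat \<Rightarrow> nat) set" where
  "residue_closure N =
    {x \<in> carrier P. \<exists>n\<in>N. \<forall>i\<in>I. residue (m i) (x i) = residue (m i) (n i)}"

lemma residue_mult:
  "x \<in> carrier P \<Longrightarrow> y \<in> carrier P \<Longrightarrow> i \<in> I \<Longrightarrow>
    residue (m i) ((x \<otimes>\<^bsub>P\<^esub> y) i) = residue (m i) (x i) \<circ> residue (m i) (y i)"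
  by (simp only: mult_P residue_comp[OF permutes_P permutes_P])

lemma residue_inverse:
  "x \<in> carrier P \<Longrightarrow> i \<in> I \<Longrightarrow> residue (m i) ((inv\<^bsub>P\<^esub> x) i) = inv' (residue (m i) (x i))"
  by (simp only: inv_P residue_inv[OF permutes_P])

lemma residue_closure_normal:
  assumes "N \<lhd> P"
  shows "residue_closure N \<lhd> P"
proof -
  interpret N: normal N P by (rule assms)
  have NP: "n \<in> carrier P" if "n \<in> N" for n using that N.subset by blast
  show ?thesis
  proof (rule P.normal_invI)
    show "subgroup (residue_closure N) P"
    proof (rule P.subgroupI)
      show "residue_closure N \<subseteq> carrier P" by (auto simp: residue_closure_def)
      have "\<one>\<^bsub>P\<^esub> \<in> residue_closure N" using N.one_closed by (auto simp: residue_closure_def)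
      then show "residue_closure N \<noteq> {}" by blast
    next
      fix x assume "x \<in> residue_closure N"
      then obtain n where x: "x \<in> carrier P" "n \<in> N" "\<forall>i\<in>I. residue (m i) (x i) = residue (m i) (n i)"
        by (auto simp: residue_closure_def)
      then show "inv\<^bsub>P\<^esub> x \<in> residue_closure N"
        unfolding residue_closure_def
        by (auto simp: residue_inverse NP intro!: bexI[of _ "inv\<^bsub>P\<^esub> n"])
    next
      fix x y assume "x \<in> residue_closure N" "y \<in> residue_closure N"
      then obtain n n' where x: "x \<in> carrier P" "n \<in> N" "\<forall>i\<in>I. residue (m i) (x i) = residue (m i) (n i)"
        "y \<in> carrier P" "n' \<in> N" "\<forall>i\<in>I. residue (m i) (y i) = residue (m i) (n' i)"
        by (auto simp: residue_closure_def)
      then show "x \<otimes>\<^bsub>P\<^esub> y \<in> residue_closure N"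
        unfolding residue_closure_def
        by (auto simp: residue_mult NP intro!: bexI[of _ "n \<otimes>\<^bsub>P\<^esub> n'"])
    qed
  next
    fix x h assume x: "x \<in> carrier P" and "h \<in> residue_closure N"
    then obtain n where h: "h \<in> carrier P" "n \<in> N" "\<forall>i\<in>I. residue (m i) (h i) = residue (m i) (n i)"
      by (auto simp: residue_closure_def)
    have "x \<otimes>\<^bsub>P\<^esub> n \<otimes>\<^bsub>P\<^esub> inv\<^bsub>P\<^esub> x \<in> N" using x h(2) by (rule N.inv_op_closed2)
    then show "x \<otimes>\<^bsub>P\<^esub> h \<otimes>\<^bsub>P\<^esub> inv\<^bsub>P\<^esub> x \<in> residue_closure N"
      unfolding residue_closure_def using x h
      by (auto simp: residue_mult residue_inverse NP intro!: bexI[of _ "x \<otimes>\<^bsub>P\<^esub> n \<otimes>\<^bsub>P\<^esub> inv\<^bsub>P\<^esub> x"])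
  qed
qed

text \<open>
  The coordinates fall into finitely many types according to the residues of the finitely many
  elements \<open>s g\<close>. The cosets of the elements whose residues depend only on the type form a finite
  set, on which the \<open>s g\<close> act by multiplication.
\<close>

lemma approximable_outside_residue_closure:
  fixes G :: "('a, 'b) monoid_scheme"
  assumes N: "N \<lhd> P" and \<Phi>: "finite \<Phi>" and s: "\<And>g. g \<in> \<Phi> \<Longrightarrow> s g \<in> carrier P"
    and s_mult: "\<And>g h. g \<in> \<Phi> \<Longrightarrow> h \<in> \<Phi> \<Longrightarrow> g \<otimes>\<^bsub>G\<^esub> h \<in> \<Phi> \<Longrightarrow>
      s (g \<otimes>\<^bsub>G\<^esub> h) \<otimes>\<^bsub>P\<^esub> inv\<^bsub>P\<^esub> (s g \<otimes>\<^bsub>P\<^esub> s h) \<in> N"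
    and s_one: "s \<one>\<^bsub>G\<^esub> = \<one>\<^bsub>P\<^esub>" and g0: "g0 \<in> \<Phi>" "s g0 \<notin> residue_closure N"
  shows "approximable G \<Phi> 0 (\<lambda>g. if g = g0 then 0 else 1)"
proof -
  interpret N: normal N P by (rule N)
  let ?M = "residue_closure N"
  have M: "?M \<lhd> P" using N by (rule residue_closure_normal)
  interpret M: normal ?M P by (rule M)
  have NM: "N \<subseteq> ?M" using N.subset unfolding residue_closure_def by blast
  define type where "type i = (\<lambda>g\<in>\<Phi>. residue (m i) (s g i))" for i
  define rep where "rep t = (SOME i. i \<in> I \<and> type i = t)" for t
  define A where "A = {p \<in> carrier P. \<forall>i\<in>I. \<forall>j\<in>I. type i = type j \<longrightarrow>
    residue (m i) (p i) = residue (m j) (p j)}"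
  \<comment> \<open>One coordinate is inspected for each type. The resulting invariant takes
    finitely many values on \<open>A\<close>, and it determines the coset: elements of
    \<open>A\<close> with equal keys have equal residues everywhere, so their quotient has the
    residues of the identity and lies in the closure.\<close>
  define key where "key p = (\<lambda>t\<in>type ` I. residue (m (rep t)) (p (rep t)))" for p
  have rep: "rep (type i) \<in> I" "type (rep (type i)) = type i" if "i \<in> I" for i
  proof -
    have "rep (type i) \<in> I \<and> type (rep (type i)) = type i"
      unfolding rep_def by (rule someI[of _ i]) (simp add: that)
    then show "rep (type i) \<in> I" "type (rep (type i)) = type i" by simp_all
  qed
  have res_range: "residue (m i) (x i) \<in> {p. p permutes {1..8}}" if "x \<in> carrier P" "i \<in> I" for x i
    using residue_permutes[OF permutes_P[OF that]] by blast
  have "type i \<in> (\<Pi>\<^sub>E g\<in>\<Phi>. {p. p permutes {1..8}})" if "i \<in> I" for i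
    unfolding type_def by (intro restrict_PiE_iff[THEN iffD2] ballI res_range s that)
  then have "type ` I \<subseteq> (\<Pi>\<^sub>E g\<in>\<Phi>. {p. p permutes {1..8}})" by blast
  then have fin_type: "finite (type ` I)"
    by (rule finite_subset) (intro finite_PiE \<Phi> finite_permutations finite_atLeastAtMost)
  have "key p \<in> (\<Pi>\<^sub>E t\<in>type ` I. {p. p permutes {1..8}})" if "p \<in> A" for p
    unfolding key_def
  proof (intro restrict_PiE_iff[THEN iffD2] ballI)
    fix t assume "t \<in> type ` I"
    then have "rep t \<in> I" using rep(1) by blast
    then show "residue (m (rep t)) (p (rep t)) \<in> {p. p permutes {1..8}}"
      using that by (intro res_range) (simp_all add: A_def)
  qed
  then have "key ` A \<subseteq> (\<Pi>\<^sub>E t\<in>type ` I. {p. p permutes {1..8}})" by blast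
  then have fin_key: "finite (key ` A)"
    by (rule finite_subset) (intro finite_PiE fin_type finite_permutations finite_atLeastAtMost)
  have key_coset: "?M #>\<^bsub>P\<^esub> p = ?M #>\<^bsub>P\<^esub> q" if p: "p \<in> A" "q \<in> A" "key p = key q" for p q
  proof -
    have P: "p \<in> carrier P" "q \<in> carrier P" using p by (auto simp: A_def)
    have "residue (m i) (p i) = residue (m i) (q i)" if i: "i \<in> I" for i
    proof -
      have "key p (type i) = key q (type i)" using p(3) by simp
      then have "residue (m (rep (type i))) (p (rep (type i))) = residue (m (rep (type i))) (q (rep (type i)))"
        using i by (simp add: key_def)
      moreover have "residue (m (rep (type i))) (x (rep (type i))) = residue (m i) (x i)" if "x \<in> A" for x
        using that rep[OF i] i unfolding A_def by blast
      ultimately show ?thesis using p(1,2) by simp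
    qed
    then have "residue (m i) ((p \<otimes>\<^bsub>P\<^esub> inv\<^bsub>P\<^esub> q) i) = residue (m i) (\<one>\<^bsub>P\<^esub> i)" if "i \<in> I" for i
      using that P permutes_inv_o[OF residue_permutes[OF permutes_P[OF P(2) that]]]
      by (simp add: residue_mult residue_inverse one_P)
    then have "p \<otimes>\<^bsub>P\<^esub> inv\<^bsub>P\<^esub> q \<in> ?M"
      using P N.one_closed unfolding residue_closure_def by blast
    then show ?thesis using P by (simp add: M.rcos_eq_iff)
  qed
  have "(\<lambda>p. ?M #>\<^bsub>P\<^esub> p) ` A \<subseteq> (\<lambda>k. ?M #>\<^bsub>P\<^esub> (inv_into A key k)) ` key ` A"
  proof
    fix C assume "C \<in> (\<lambda>p. ?M #>\<^bsub>P\<^esub> p) ` A"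
    then obtain p where p: "p \<in> A" "C = ?M #>\<^bsub>P\<^esub> p" by blast
    have kp: "key p \<in> key ` A" using p(1) by blast
    have "C = ?M #>\<^bsub>P\<^esub> (inv_into A key (key p))"
      unfolding p(2)
      by (rule key_coset[OF p(1) inv_into_into[OF kp] f_inv_into_f[OF kp, symmetric]])
    then show "C \<in> (\<lambda>k. ?M #>\<^bsub>P\<^esub> (inv_into A key k)) ` key ` A" using p(1) by blast
  qed
  then have fin: "finite ((\<lambda>p. ?M #>\<^bsub>P\<^esub> p) ` A)"
    using fin_key finite_subset by blast
  have "\<one>\<^bsub>P\<^esub> \<in> A" by (auto simp: A_def one_P)
  then have A_ne: "A \<noteq> {}" by blast
  have A_closed: "s g \<otimes>\<^bsub>P\<^esub> p \<in> A" if g: "g \<in> \<Phi>" and p: "p \<in> A" for g p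
  proof -
    have P: "p \<in> carrier P" using p by (simp add: A_def)
    have "residue (m i) ((s g \<otimes>\<^bsub>P\<^esub> p) i) = residue (m j) ((s g \<otimes>\<^bsub>P\<^esub> p) j)"
      if ij: "i \<in> I" "j \<in> I" "type i = type j" for i j
    proof -
      have "residue (m i) (s g i) = residue (m j) (s g j)"
        using fun_cong[OF ij(3), of g] g by (simp add: type_def)
      moreover have "residue (m i) (p i) = residue (m j) (p j)"
        using p ij unfolding A_def by blast
      ultimately show ?thesis by (simp only: residue_mult[OF s[OF g] P] ij)
    qed
    then show ?thesis using P s[OF g] unfolding A_def by blast
  qed
  show ?thesis
  proof (rule approximable_of_coset_action[OF M s _ s_one g0 _ A_ne A_closed fin])
    show "s (g \<otimes>\<^bsub>G\<^esub> h) \<otimes>\<^bsub>P\<^esub> inv\<^bsub>P\<^esub> (s g \<otimes>\<^bsub>P\<^esub> s h) \<in> ?M"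
      if "g \<in> \<Phi>" "h \<in> \<Phi>" "g \<otimes>\<^bsub>G\<^esub> h \<in> \<Phi>" for g h using s_mult[OF that] NM by blast
    show "A \<subseteq> carrier P" by (auto simp: A_def)
  qed
qed

text \<open>Since \<open>s g0\<close> is outside \<open>N\<close>, at some coordinate it moves at
  least \<open>K\<close> times as many points as every defect. The maps \<open>s g\<close> read at
  this coordinate form an approximate action whose defect is small relative to the proportion moved
  by \<open>g0\<close>, which is the situation for amplification.\<close>

lemma approximable_of_section:
  fixes G :: "('a, 'b) monoid_scheme"
  assumes N: "N \<lhd> P" and \<Phi>: "finite \<Phi>" and \<epsilon>: "\<epsilon> > 0" and s: "\<And>g. g \<in> \<Phi> \<Longrightarrow> s g \<in> carrier P"
    and s_mult: "\<And>g h. g \<in> \<Phi> \<Longrightarrow> h \<in> \<Phi> \<Longrightarrow> g \<otimes>\<^bsub>G\<^esub> h \<in> \<Phi> \<Longrightarrow>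
      s (g \<otimes>\<^bsub>G\<^esub> h) \<otimes>\<^bsub>P\<^esub> inv\<^bsub>P\<^esub> (s g \<otimes>\<^bsub>P\<^esub> s h) \<in> N"
    and s_one: "s \<one>\<^bsub>G\<^esub> = \<one>\<^bsub>P\<^esub>" and g0: "g0 \<in> \<Phi>" "s g0 \<notin> N"
    and res: "\<And>i. i \<in> I \<Longrightarrow> residue (m i) (s g0 i) = id"
  shows "approximable G \<Phi> \<epsilon> (\<lambda>g. if g = g0 then 1 / 2 else 1)"
proof -
  interpret N: normal N P by (rule N)
  define defect where "defect g h = s (g \<otimes>\<^bsub>G\<^esub> h) \<otimes>\<^bsub>P\<^esub> inv\<^bsub>P\<^esub> (s g \<otimes>\<^bsub>P\<^esub> s h)" for g h
  define D where "D = (\<lambda>(g, h). defect g h) ` {(g, h) \<in> \<Phi> \<times> \<Phi>. g \<otimes>\<^bsub>G\<^esub> h \<in> \<Phi>}"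
  \<comment> \<open>With \<open>K\<close> at least 2/\<epsilon> the defect is at most \<epsilon>
    \<mu> / 2, the ratio that \<open>approximable_amplify\<close> asks for.\<close>
  define K where "K = nat \<lceil>2 / \<epsilon>\<rceil>"
  have K: "2 \<le> \<epsilon> * real K"
  proof -
    have "2 / \<epsilon> \<le> real K" unfolding K_def by (rule real_nat_ceiling_ge)
    then show ?thesis using \<epsilon> by (simp add: field_simps)
  qed
  have fD: "finite D" unfolding D_def
    by (intro finite_imageI finite_subset[OF _ finite_cartesian_product[OF \<Phi> \<Phi>]]) auto
  have DN: "D \<subseteq> N" using s_mult by (auto simp: D_def defect_def)
  \<comment> \<open>By the contrapositive of \<open>dominated_in_normal\<close>, a single
    \<open>i\<close> works for all defects together, and \<open>s g0\<close> is nontrivial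
    there.\<close>
  obtain i where i: "i \<in> I" "s g0 i \<noteq> id"
    and dom: "\<And>d. d \<in> D \<Longrightarrow> K * card (moved (d i)) \<le> card (moved (s g0 i))"
    using dominated_in_normal[OF N fD DN s[OF g0(1)] res, of K] g0(2) not_less by metis
  have perm: "s g i permutes {1..m i}" if "g \<in> \<Phi>" for g using permutes_P[OF s[OF that] i(1)] .
  have moved_eq: "{x \<in> {1..m i}. p x \<noteq> x} = moved p" if "p permutes {1..m i}" for p
    using moved_subset[OF that] by (auto simp: moved_def)
  define \<mu> where "\<mu> = real (card (moved (s g0 i))) / real (m i)"
  have mi: "0 < real (m i)" using m[OF i(1)] by simp
  have fm: "finite (moved (s g0 i))"
    using moved_subset[OF perm[OF g0(1)]] finite_subset by blast
  have "moved (s g0 i) \<noteq> {}" using i(2) by (auto simp: moved_def fun_eq_iff)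
  then have "0 < card (moved (s g0 i))" using fm by (simp add: card_gt_0_iff)
  moreover have cm: "card (moved (s g0 i)) \<le> m i"
    using card_mono[OF _ moved_subset[OF perm[OF g0(1)]]] by simp
  ultimately have \<mu>: "0 < \<mu>" "\<mu> \<le> 1" using mi by (auto simp: \<mu>_def)
  have def_le: "real (card {x \<in> {1..m i}. s (g \<otimes>\<^bsub>G\<^esub> h) i x \<noteq> s g i (s h i x)}) \<le> \<epsilon> * \<mu> / 2 * real (m i)"
    if g: "g \<in> \<Phi>" "h \<in> \<Phi>" "g \<otimes>\<^bsub>G\<^esub> h \<in> \<Phi>" for g h
  proof -
    have p: "s g i \<circ> s h i permutes {1..m i}" using perm g by (simp add: permutes_compose)
    have d: "defect g h i = s (g \<otimes>\<^bsub>G\<^esub> h) i \<circ> inv' (s g i \<circ> s h i)"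
      using g s i(1) by (simp add: defect_def mult_P inv_P)
    have "defect g h i permutes {1..m i}"
      unfolding d by (rule permutes_compose[OF permutes_inv[OF p] perm[OF g(3)]])
    from moved_eq[OF this]
    have "card (moved (defect g h i)) = card {x \<in> {1..m i}. s (g \<otimes>\<^bsub>G\<^esub> h) i x \<noteq> (s g i \<circ> s h i) x}"
      using card_permutes_disagree[OF perm[OF g(3)] p] by (simp only: d)
    then have "card {x \<in> {1..m i}. s (g \<otimes>\<^bsub>G\<^esub> h) i x \<noteq> s g i (s h i x)} = card (moved (defect g h i))"
      by (simp only: comp_apply)
    moreover have "K * card (moved (defect g h i)) \<le> card (moved (s g0 i))"
      by (rule dom) (use g in \<open>auto simp: D_def\<close>)
    then have "real K * real (card (moved (defect g h i))) \<le> real (card (moved (s g0 i)))"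
      by (simp only: of_nat_le_iff flip: of_nat_mult)
    then have "real K * real (card (moved (defect g h i))) \<le> \<mu> * real (m i)"
      using mi by (simp add: \<mu>_def)
    then have "\<epsilon> * (real K * real (card (moved (defect g h i)))) \<le> \<epsilon> * (\<mu> * real (m i))"
      using \<epsilon> by (intro mult_left_mono) auto
    moreover have "2 * real (card (moved (defect g h i))) \<le> \<epsilon> * real K * real (card (moved (defect g h i)))"
      using K by (intro mult_right_mono) auto
    ultimately show ?thesis by (simp add: mult.assoc)
  qed
  have fix_le: "real (card {x \<in> {1..m i}. s g0 i x = x}) \<le> (1 - \<mu>) * real (m i)"
  proof -
    have "{x \<in> {1..m i}. s g0 i x = x} = {1..m i} - moved (s g0 i)" by (auto simp: moved_def)
    then have "card {x \<in> {1..m i}. s g0 i x = x} = m i - card (moved (s g0 i))"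
      using moved_subset[OF perm[OF g0(1)]] fm by (simp add: card_Diff_subset)
    then show ?thesis using cm mi by (simp add: \<mu>_def of_nat_diff field_simps)
  qed
  have card_le: "real (card {x \<in> {1..m i}. s g i x = x}) \<le> real (m i)" for g
    using card_mono[OF finite_atLeastAtMost, of "{x \<in> {1..m i}. s g i x = x}" 1 "m i"]
    by (simp add: subset_iff)
  have "approx_on G \<Phi> (\<epsilon> * \<mu> / 2) (\<lambda>g. if g = g0 then 1 - \<mu> else 1) {1..m i} (\<lambda>g. s g i)"
    unfolding approx_on_def
    using perm def_le fix_le card_le m[OF i(1)] i(1) by (simp add: s_one one_P)
  then have "approximable G \<Phi> (\<epsilon> * \<mu> / 2) (\<lambda>g. if g = g0 then 1 - \<mu> else 1)"
    by (rule approximableI)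
  then show ?thesis using \<mu> by (rule approximable_amplify) (use \<epsilon> \<mu> in simp_all)
qed

text \<open>If \<open>s g0\<close> has the residues of some \<open>n\<close> in \<open>N\<close>,
  then dividing by \<open>n\<close> changes the representative but not the coset and makes all
  residues trivial. Otherwise the finite exact action on cosets separates \<open>g0\<close>.\<close>

lemma sofic_of_section:
  fixes G :: "('a, 'b) monoid_scheme"
  assumes G: "group G" and N: "N \<lhd> P" and s: "\<And>g. g \<in> carrier G \<Longrightarrow> s g \<in> carrier P"
    and s_mult: "\<And>g h. g \<in> carrier G \<Longrightarrow> h \<in> carrier G \<Longrightarrow>
      s (g \<otimes>\<^bsub>G\<^esub> h) \<otimes>\<^bsub>P\<^esub> inv\<^bsub>P\<^esub> (s g \<otimes>\<^bsub>P\<^esub> s h) \<in> N"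
    and s_one: "s \<one>\<^bsub>G\<^esub> = \<one>\<^bsub>P\<^esub>"
    and s_inj: "\<And>g. g \<in> carrier G \<Longrightarrow> g \<noteq> \<one>\<^bsub>G\<^esub> \<Longrightarrow> s g \<notin> N"
  shows "sofic G"
proof (rule soficI_approximable[OF G])
  interpret G: group G by (rule G)
  interpret N: normal N P by (rule N)
  fix \<Phi> and \<epsilon> :: real and g0
  assume \<Phi>: "finite \<Phi>" "\<Phi> \<subseteq> carrier G" and \<epsilon>: "\<epsilon> > 0" and g0: "g0 \<in> \<Phi>" "g0 \<noteq> \<one>\<^bsub>G\<^esub>"
  have g0G: "g0 \<in> carrier G" using \<Phi>(2) g0(1) by blast
  have sP: "s g \<in> carrier P" if "g \<in> \<Phi>" for g using s \<Phi>(2) that by blast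
  show "approximable G \<Phi> \<epsilon> (\<lambda>g. if g = g0 then 1 / 2 else 1)"
  proof (cases "s g0 \<in> residue_closure N")
    case False
    have "approximable G \<Phi> 0 (\<lambda>g. if g = g0 then 0 else 1)"
      by (rule approximable_outside_residue_closure[OF N \<Phi>(1) sP _ s_one g0(1) False])
        (assumption, intro s_mult subsetD[OF \<Phi>(2)])
    then show ?thesis by (rule approximable_mono) (use \<epsilon> in auto)
  next
    case True
    then obtain n where n: "n \<in> N" "\<And>i. i \<in> I \<Longrightarrow> residue (m i) (s g0 i) = residue (m i) (n i)"
      by (auto simp: residue_closure_def)
    have nP: "n \<in> carrier P" using n(1) N.subset by blast
    define a where "a = inv\<^bsub>P\<^esub> n \<otimes>\<^bsub>P\<^esub> s g0"
    have a: "a \<in> carrier P" using nP s[OF g0G] by (simp add: a_def)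
    have aN: "a \<notin> N"
    proof
      assume "a \<in> N"
      then have "n \<otimes>\<^bsub>P\<^esub> a \<in> N" using n(1) by (intro N.m_closed)
      moreover have "n \<otimes>\<^bsub>P\<^esub> a = s g0"
        using nP s[OF g0G] by (simp add: a_def P.m_assoc[symmetric])
      ultimately show False using s_inj[OF g0G g0(2)] by simp
    qed
    have res: "residue (m i) (a i) = id" if i: "i \<in> I" for i
      using i nP s[OF g0G] n(2)[OF i] permutes_inv_o[OF residue_permutes[OF permutes_P[OF nP i]]]
      by (simp add: a_def residue_mult residue_inverse)
    \<comment> \<open>Only the representative of \<open>g0\<close> is replaced. Multiplicativity
      modulo \<open>N\<close> depends on the cosets alone and so survives, and the value at the
      identity is untouched because \<open>g0\<close> is nontrivial.\<close>
    define s' where "s' = s(g0 := a)"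
    have s'P: "s' g \<in> carrier P" if "g \<in> carrier G" for g using that a s by (simp add: s'_def)
    have coset: "N #>\<^bsub>P\<^esub> s' g = N #>\<^bsub>P\<^esub> s g" if "g \<in> carrier G" for g
    proof (cases "g = g0")
      case True
      have "a \<otimes>\<^bsub>P\<^esub> inv\<^bsub>P\<^esub> (s g0) \<in> N"
        using nP s[OF g0G] n(1) by (simp add: a_def P.m_assoc)
      then show ?thesis using a s[OF g0G] True by (simp add: s'_def N.rcos_eq_iff)
    qed (simp add: s'_def)
    have "s' (g \<otimes>\<^bsub>G\<^esub> h) \<otimes>\<^bsub>P\<^esub> inv\<^bsub>P\<^esub> (s' g \<otimes>\<^bsub>P\<^esub> s' h) \<in> N"
      if g: "g \<in> carrier G" "h \<in> carrier G" for g h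
    proof -
      have "N #>\<^bsub>P\<^esub> s' (g \<otimes>\<^bsub>G\<^esub> h) = N #>\<^bsub>P\<^esub> (s g \<otimes>\<^bsub>P\<^esub> s h)"
        using s_mult[OF g] g s by (simp add: coset N.rcos_eq_iff)
      also have "\<dots> = (N #>\<^bsub>P\<^esub> s' g) <#>\<^bsub>P\<^esub> (N #>\<^bsub>P\<^esub> s' h)"
        using g s by (simp add: coset N.rcos_sum)
      also have "\<dots> = N #>\<^bsub>P\<^esub> (s' g \<otimes>\<^bsub>P\<^esub> s' h)" using g s'P by (simp add: N.rcos_sum)
      finally show ?thesis using g s'P by (simp add: N.rcos_eq_iff)
    qed
    note s'_mult = this
    show ?thesis
    proof (rule approximable_of_section[OF N \<Phi>(1) \<epsilon>])
      show "s' g \<in> carrier P" if "g \<in> \<Phi>" for g using that \<Phi>(2) s'P by blast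
      show "s' (g \<otimes>\<^bsub>G\<^esub> h) \<otimes>\<^bsub>P\<^esub> inv\<^bsub>P\<^esub> (s' g \<otimes>\<^bsub>P\<^esub> s' h) \<in> N"
        if "g \<in> \<Phi>" "h \<in> \<Phi>" for g h using that \<Phi>(2) s'_mult by blast
      show "s' \<one>\<^bsub>G\<^esub> = \<one>\<^bsub>P\<^esub>" using g0(2) s_one by (simp add: s'_def)
      show "g0 \<in> \<Phi>" by (rule g0(1))
      show "s' g0 \<notin> N" using aN by (simp add: s'_def)
      show "residue (m i) (s' g0 i) = id" if "i \<in> I" for i using res[OF that] by (simp add: s'_def)
    qed
  qed
qed

end

section \<open>The characterization of sofic groups\<close>

lemma sofic_if_subgroup_of_quotient_of_product:
  fixes G :: "('a, 'b) monoid_scheme" and \<K> :: "(nat \<Rightarrow> nat) monoid set"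
  assumes G: "group G"
    and \<K>: "\<K> = finite_alternating_groups \<or> \<K> = finite_symmetric_groups"
    and emb: "subgroup_of_quotient_of_product TYPE('i) \<K> G"
  shows "sofic G"
proof -
  interpret G: group G by (rule G)
  obtain I :: "'i set" and H N S where IH: "\<forall>i\<in>I. H i \<in> \<K>"
    and N: "N \<lhd> product_group I H" and S: "subgroup S (product_group I H Mod N)"
    and iso: "G \<cong> (product_group I H Mod N)\<lparr>carrier := S\<rparr>"
    using emb by (auto simp: subgroup_of_quotient_of_product_def)
  have "\<forall>i\<in>I. \<exists>m. 1 \<le> m \<and> (H i = alt_group m \<or> H i = sym_group m)"
    using IH \<K> by (auto simp: finite_alternating_groups_def finite_symmetric_groups_def)
  from bchoice[OF this] obtain m
    where "\<forall>i\<in>I. 1 \<le> m i \<and> (H i = alt_group (m i) \<or> H i = sym_group (m i))" ..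
  then interpret perm_product I H m by unfold_locales auto
  have N: "N \<lhd> P" using N by (simp add: P_def)
  interpret N: normal N P by (rule N)
  obtain \<phi> where \<phi>: "\<phi> \<in> hom G ((P Mod N)\<lparr>carrier := S\<rparr>)" "bij_betw \<phi> (carrier G) S"
    using iso by (auto simp: is_iso_def iso_def P_def)
  have SP: "S \<subseteq> carrier (P Mod N)" using subgroup.subset[OF S] by (simp add: P_def)
  have \<phi>_mult: "\<phi> (g \<otimes>\<^bsub>G\<^esub> h) = \<phi> g <#>\<^bsub>P\<^esub> \<phi> h" if "g \<in> carrier G" "h \<in> carrier G" for g h
    using hom_mult[OF \<phi>(1) that] by simp
  have ex: "\<exists>x\<in>carrier P. \<phi> g = N #>\<^bsub>P\<^esub> x" if "g \<in> carrier G" for g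
    using SP bij_betwE[OF \<phi>(2)] that unfolding carrier_FactGroup by blast
  \<comment> \<open>The coset assigned to the identity is idempotent, hence equal to
    \<open>N\<close>.\<close>
  have \<phi>_one: "\<phi> \<one>\<^bsub>G\<^esub> = N"
  proof -
    obtain x where x: "x \<in> carrier P" "\<phi> \<one>\<^bsub>G\<^esub> = N #>\<^bsub>P\<^esub> x" using ex by blast
    have "N #>\<^bsub>P\<^esub> x = N #>\<^bsub>P\<^esub> (x \<otimes>\<^bsub>P\<^esub> x)"
      using \<phi>_mult[of "\<one>\<^bsub>G\<^esub>" "\<one>\<^bsub>G\<^esub>"] x by (simp add: N.rcos_sum)
    then have "x \<otimes>\<^bsub>P\<^esub> inv\<^bsub>P\<^esub> (x \<otimes>\<^bsub>P\<^esub> x) \<in> N" using x by (simp add: N.rcos_eq_iff)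
    moreover have "x \<otimes>\<^bsub>P\<^esub> inv\<^bsub>P\<^esub> (x \<otimes>\<^bsub>P\<^esub> x) = inv\<^bsub>P\<^esub> x"
      using x by (simp add: P.inv_mult_group P.m_assoc[symmetric])
    ultimately have "inv\<^bsub>P\<^esub> x \<in> N" by simp
    then have "x \<in> N" using N.m_inv_closed[of "inv\<^bsub>P\<^esub> x"] x by simp
    then show ?thesis using x P.coset_join2[OF x(1) N.subgroup_axioms] by simp
  qed
  \<comment> \<open>The section is normalized at the identity because approximate actions have to
    send the identity to \<open>id\<close> exactly.\<close>
  define s where "s g = (if g = \<one>\<^bsub>G\<^esub> then \<one>\<^bsub>P\<^esub> else SOME x. x \<in> carrier P \<and> \<phi> g = N #>\<^bsub>P\<^esub> x)" for g
  have s: "s g \<in> carrier P \<and> \<phi> g = N #>\<^bsub>P\<^esub> s g" if g: "g \<in> carrier G" for g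
  proof (cases "g = \<one>\<^bsub>G\<^esub>")
    case True
    then show ?thesis using \<phi>_one P.coset_mult_one[OF N.subset] by (simp add: s_def)
  next
    case False
    have "\<exists>x. x \<in> carrier P \<and> \<phi> g = N #>\<^bsub>P\<^esub> x" using ex[OF g] by blast
    from someI_ex[OF this] show ?thesis using False by (simp add: s_def)
  qed
  show ?thesis
  proof (rule sofic_of_section[OF G N])
    show "s g \<in> carrier P" if "g \<in> carrier G" for g using s[OF that] by simp
    show "s (g \<otimes>\<^bsub>G\<^esub> h) \<otimes>\<^bsub>P\<^esub> inv\<^bsub>P\<^esub> (s g \<otimes>\<^bsub>P\<^esub> s h) \<in> N"
      if g: "g \<in> carrier G" "h \<in> carrier G" for g h
    proof -
      have "N #>\<^bsub>P\<^esub> s (g \<otimes>\<^bsub>G\<^esub> h) = N #>\<^bsub>P\<^esub> (s g \<otimes>\<^bsub>P\<^esub> s h)"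
        using \<phi>_mult[OF g] s[OF g(1)] s[OF g(2)] s[OF G.m_closed[OF g]] by (simp add: N.rcos_sum)
      then show ?thesis
        using s[OF g(1)] s[OF g(2)] s[OF G.m_closed[OF g]] by (simp add: N.rcos_eq_iff)
    qed
    show "s \<one>\<^bsub>G\<^esub> = \<one>\<^bsub>P\<^esub>" by (simp add: s_def)
    show "s g \<notin> N" if g: "g \<in> carrier G" "g \<noteq> \<one>\<^bsub>G\<^esub>" for g
    proof
      assume "s g \<in> N"
      then have "\<phi> g = \<phi> \<one>\<^bsub>G\<^esub>"
        using s[OF g(1)] P.coset_join2[OF _ N.subgroup_axioms] \<phi>_one by simp
      then show False
        using g \<phi>(2) G.one_closed unfolding bij_betw_def inj_on_def by blast
    qed
  qed
qed

section \<open>Invariance properties of the Hamming length\<close>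

lemma hamming_length_permutes:
  assumes "p permutes {1..m}"
  shows "hamming_length m p = real (card (moved p)) / real m"
proof -
  have "{x \<in> {1..m}. p x \<noteq> x} = moved p"
    using moved_subset[OF assms] by (auto simp: moved_def)
  then show ?thesis by (simp only: hamming_length_def)
qed

lemma hamming_length_nonneg [simp]: "0 \<le> hamming_length m p"
  by (simp add: hamming_length_def)

lemma hamming_length_id [simp]: "hamming_length m id = 0"
  by (simp add: hamming_length_def)

lemma hamming_length_comp:
  assumes "p permutes {1..m}" "q permutes {1..m}"
  shows "hamming_length m (p \<circ> q) \<le> hamming_length m p + hamming_length m q"
proof -
  have fin: "finite (moved p)" "finite (moved q)"
    using assms moved_subset finite_subset by blast+
  have "moved (p \<circ> q) \<subseteq> moved p \<union> moved q"
    by (rule subsetI, rule ccontr) (simp add: moved_def)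
  then have "card (moved (p \<circ> q)) \<le> card (moved p) + card (moved q)"
    using fin by (meson card_Un_le card_mono finite_UnI order_trans)
  then have "real (card (moved (p \<circ> q))) \<le> real (card (moved p)) + real (card (moved q))"
    by (simp flip: of_nat_add)
  then show ?thesis
    using assms by (simp add: hamming_length_permutes permutes_compose divide_right_mono
        flip: add_divide_distrib)
qed

lemma hamming_length_inv:
  assumes "p permutes {1..m}"
  shows "hamming_length m (inv' p) = hamming_length m p"
proof -
  have "moved (inv' p) = moved p"
    using permutes_inv_eq[OF assms] unfolding moved_def by metis
  then show ?thesis using assms by (simp only: hamming_length_permutes permutes_inv)
qed

lemma hamming_length_conj:
  assumes "p permutes {1..m}" "q permutes {1..m}"
  shows "hamming_length m (q \<circ> p \<circ> inv' q) = hamming_length m p"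
proof -
  note inv = permutes_inverses[OF assms(2)]
  have "moved (q \<circ> p \<circ> inv' q) = q ` moved p"
  proof (rule Set.set_eqI)
    fix x
    have "x \<in> q ` moved p \<longleftrightarrow> inv' q x \<in> moved p"
      using inv by (metis imageE imageI)
    also have "\<dots> \<longleftrightarrow> x \<in> moved (q \<circ> p \<circ> inv' q)"
      unfolding moved_def mem_Collect_eq comp_apply using inv by metis
    finally show "x \<in> moved (q \<circ> p \<circ> inv' q) \<longleftrightarrow> x \<in> q ` moved p" by simp
  qed
  then have "card (moved (q \<circ> p \<circ> inv' q)) = card (moved p)"
    using permutes_inj_on[OF assms(2)] by (simp add: card_image)
  moreover have "q \<circ> p \<circ> inv' q permutes {1..m}"
    using assms by (intro permutes_compose permutes_inv)
  ultimately show ?thesis using assms(1) by (simp only: hamming_length_permutes)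
qed

text \<open>
  Acting in the same way on two copies of \<open>{1..m}\<close> embeds the symmetric group into an alternating
  group without changing the Hamming length.
\<close>

definition double_perm :: "nat \<Rightarrow> (nat \<Rightarrow> nat) \<Rightarrow> nat \<Rightarrow> nat" where
  "double_perm m p x =
    (if x \<in> {1..m} then p x else if x \<in> {m+1..2*m} then p (x - m) + m else x)"

lemma double_perm_comp:
  assumes "q permutes {1..m}"
  shows "double_perm m (p \<circ> q) = double_perm m p \<circ> double_perm m q"
proof
  fix x
  have q: "q y \<in> {1..m} \<longleftrightarrow> y \<in> {1..m}" for y by (rule permutes_in_image[OF assms])
  consider "x \<in> {1..m}" | "x \<in> {m+1..2*m}" | "x \<notin> {1..m}" "x \<notin> {m+1..2*m}" by blast
  then show "double_perm m (p \<circ> q) x = (double_perm m p \<circ> double_perm m q) x"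
  proof cases
    case 1 then show ?thesis using q[of x] by (simp add: double_perm_def)
  next
    case 2
    then have "x - m \<in> {1..m}" "x \<notin> {1..m}" by auto
    then have "q (x - m) + m \<in> {m+1..2*m}" "q (x - m) + m \<notin> {1..m}" using q[of "x - m"] by auto
    then show ?thesis using 2 \<open>x \<notin> {1..m}\<close> by (simp only: double_perm_def comp_apply if_True if_False) simp
  next
    case 3 then show ?thesis by (simp only: double_perm_def comp_apply if_False)
  qed
qed

lemma double_perm_id [simp]: "double_perm m id = id"
  by (auto simp: double_perm_def fun_eq_iff)

lemma double_perm_eq:
  assumes p: "p permutes {1..m}"
  shows "double_perm m p = p \<circ> map_permutation {1..m} (\<lambda>x. x + m) p"
proof
  fix x
  have inj: "inj_on (\<lambda>x. x + m) {1..m}" by simp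
  have q: "p y \<in> {1..m} \<longleftrightarrow> y \<in> {1..m}" for y by (rule permutes_in_image[OF p])
  have img: "(\<lambda>x. x + m) ` {1..m} = {m+1..2*m}"
    using image_add_atLeastAtMost'[of m 1 m] by (simp add: mult_2 add.commute)
  show "double_perm m p x = (p \<circ> map_permutation {1..m} (\<lambda>x. x + m) p) x"
  proof (cases "x \<in> {m+1..2*m}")
    case True
    then have x: "x - m \<in> {1..m}" "x = (x - m) + m" "x \<notin> {1..m}" by auto
    then have "map_permutation {1..m} (\<lambda>x. x + m) p x = p (x - m) + m"
      using map_permutation_apply[OF inj x(1), of p] by simp
    moreover have "p (x - m) + m \<notin> {1..m}" using q[of "x - m"] x(1) by auto
    then have "p (p (x - m) + m) = p (x - m) + m" by (rule permutes_not_in[OF p])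
    ultimately show ?thesis
      using True x(3) by (simp only: double_perm_def comp_apply if_True if_False)
  next
    case False
    then have "x \<notin> (\<lambda>x. x + m) ` {1..m}" by (simp only: img not_False_eq_True)
    then have "map_permutation {1..m} (\<lambda>x. x + m) p x = x"
      by (simp only: map_permutation_def restrict_id_def if_False)
    then show ?thesis
      using False permutes_not_in[OF p, of x]
      by (cases "x \<in> {1..m}") (simp_all only: double_perm_def comp_apply if_True if_False not_False_eq_True)
  qed
qed

text \<open>The doubled permutation is the product of \<open>p\<close> and a shifted copy of
  \<open>p\<close>. Both have the same sign, so the product is even.\<close>

lemma double_perm_alt_group:
  assumes p: "p permutes {1..m}"
  shows "double_perm m p \<in> carrier (alt_group (2 * m))"
proof -
  let ?q = "map_permutation {1..m} (\<lambda>x. x + m) p"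
  have img: "(\<lambda>x. x + m) ` {1..m} = {m+1..2*m}"
    using image_add_atLeastAtMost'[of m 1 m] by (simp add: mult_2 add.commute)
  have q: "?q permutes {m+1..2*m}"
    by (rule map_permutation_permutes[OF _ p]) (simp only: bij_betw_def img inj_on_add')
  have "double_perm m p permutes {1..2*m}"
    unfolding double_perm_eq[OF p]
    by (intro permutes_compose permutes_subset[OF p] permutes_subset[OF q]) auto
  moreover have "evenperm (double_perm m p)"
    unfolding double_perm_eq[OF p]
    using evenperm_map_permutation[OF _ p finite_atLeastAtMost, of "\<lambda>x. x + m"]
      evenperm_comp[of p ?q] permutes_imp_permutation[OF _ p] permutes_imp_permutation[OF _ q]
    by simp
  ultimately show ?thesis by (simp add: alt_group_carrier)
qed

lemma hamming_length_double_perm: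
  assumes p: "p permutes {1..m}"
  shows "hamming_length (2 * m) (double_perm m p) = hamming_length m p"
proof -
  let ?A = "{x \<in> {1..m}. p x \<noteq> x}"
  have "{x \<in> {1..2*m}. double_perm m p x \<noteq> x} = ?A \<union> (\<lambda>x. x + m) ` ?A"
  proof (rule Set.set_eqI)
    fix x
    consider "x \<in> {1..m}" | "x \<in> {m+1..2*m}" | "x \<notin> {1..2*m}" by fastforce
    then show "x \<in> {x \<in> {1..2*m}. double_perm m p x \<noteq> x} \<longleftrightarrow> x \<in> ?A \<union> (\<lambda>x. x + m) ` ?A"
    proof cases
      case 1 then show ?thesis by (auto simp: double_perm_def)
    next
      case 2
      then have x: "x - m \<in> {1..m}" "x \<notin> {1..m}" "x \<in> {1..2*m}" by auto
      have dp: "double_perm m p x = p (x - m) + m"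
        using 2 x(2) by (simp only: double_perm_def if_True if_False)
      have "x \<in> {x \<in> {1..2*m}. double_perm m p x \<noteq> x} \<longleftrightarrow> p (x - m) + m \<noteq> x"
        using x(3) by (simp only: mem_Collect_eq dp simp_thms)
      also have "\<dots> \<longleftrightarrow> p (x - m) \<noteq> x - m" using 2 by auto
      also have "\<dots> \<longleftrightarrow> x - m \<in> ?A" using x(1) by (simp only: mem_Collect_eq simp_thms)
      also have "\<dots> \<longleftrightarrow> x \<in> (\<lambda>x. x + m) ` ?A"
        using 2 by (auto simp: image_iff intro!: exI[of _ "x - m"])
      also have "\<dots> \<longleftrightarrow> x \<in> ?A \<union> (\<lambda>x. x + m) ` ?A"
        using x(2) by (simp only: Un_iff mem_Collect_eq simp_thms)
      finally show ?thesis .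
    next
      case 3 then show ?thesis by auto
    qed
  qed
  moreover have "card (?A \<union> (\<lambda>x. x + m) ` ?A) = card ?A + card ((\<lambda>x. x + m) ` ?A)"
    by (intro card_Un_disjoint) auto
  moreover have "card ((\<lambda>x. x + m) ` ?A) = card ?A" by (intro card_image) simp
  ultimately show ?thesis by (simp add: hamming_length_def)
qed

text \<open>Both classes are brought to one form. An approximation in a symmetric group is used as
  it is; for alternating groups it is doubled, which changes the degree from \<open>m\<close> to
  \<open>2 * m\<close> but neither the lengths nor the defects.\<close>

lemma sofic_approximation_in_class:
  assumes so: "sofic G"
    and \<K>: "\<K> = finite_alternating_groups \<or> \<K> = finite_symmetric_groups"
  obtains \<alpha> :: "'a \<Rightarrow> real" where "\<And>g. g \<in> carrier G \<Longrightarrow> g \<noteq> \<one>\<^bsub>G\<^esub> \<Longrightarrow> \<alpha> g > 0"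
    "\<And>\<Phi> (\<epsilon> :: real). finite \<Phi> \<Longrightarrow> \<Phi> \<subseteq> carrier G \<Longrightarrow> \<epsilon> > 0 \<Longrightarrow>
      \<exists>L m \<phi>. L \<in> \<K> \<and> 1 \<le> m \<and> (L = alt_group m \<or> L = sym_group m) \<and> \<phi> \<in> \<Phi> \<rightarrow> carrier L \<and>
        (\<forall>g\<in>\<Phi>. \<alpha> g \<le> hamming_length m (\<phi> g)) \<and>
        (\<forall>g\<in>\<Phi>. \<forall>h\<in>\<Phi>. g \<otimes>\<^bsub>G\<^esub> h \<in> \<Phi> \<longrightarrow>
          hamming_length m (\<phi> (g \<otimes>\<^bsub>G\<^esub> h) \<circ> inv' (\<phi> g \<circ> \<phi> h)) < \<epsilon>)"
proof -
  obtain \<alpha> :: "'a \<Rightarrow> real" where \<alpha>: "\<forall>g \<in> carrier G. g \<noteq> \<one>\<^bsub>G\<^esub> \<longrightarrow> \<alpha> g > 0"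
    and approx: "\<forall>\<Phi> (\<epsilon> :: real). finite \<Phi> \<and> \<Phi> \<subseteq> carrier G \<and> \<epsilon> > 0 \<longrightarrow>
        (\<exists>m \<ge> 1. \<exists>\<phi> \<in> \<Phi> \<rightarrow> carrier (sym_group m).
          (\<one>\<^bsub>G\<^esub> \<in> \<Phi> \<longrightarrow> \<phi> \<one>\<^bsub>G\<^esub> = \<one>\<^bsub>sym_group m\<^esub>) \<and>
          (\<forall>g \<in> \<Phi>. hamming_length m (\<phi> g) \<ge> \<alpha> g) \<and>
          (\<forall>g \<in> \<Phi>. \<forall>h \<in> \<Phi>. g \<otimes>\<^bsub>G\<^esub> h \<in> \<Phi> \<longrightarrow>
            hamming_length m
              (\<phi> (g \<otimes>\<^bsub>G\<^esub> h) \<otimes>\<^bsub>sym_group m\<^esub>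
                inv\<^bsub>sym_group m\<^esub> (\<phi> g \<otimes>\<^bsub>sym_group m\<^esub> \<phi> h)) < \<epsilon>))"
    using so unfolding sofic_def by (elim exE conjE) (rule that; assumption)
  show ?thesis
  proof (rule that[of \<alpha>])
    show "\<alpha> g > 0" if "g \<in> carrier G" "g \<noteq> \<one>\<^bsub>G\<^esub>" for g using \<alpha> that by blast
    fix \<Phi> and \<epsilon> :: real
    assume \<Phi>: "finite \<Phi>" "\<Phi> \<subseteq> carrier G" "\<epsilon> > 0"
    from approx[THEN spec, THEN spec, THEN mp, OF conjI[OF \<Phi>(1) conjI[OF \<Phi>(2,3)]]]
    obtain m \<phi> where m: "1 \<le> m" and \<phi>: "\<phi> \<in> \<Phi> \<rightarrow> carrier (sym_group m)"
      and len: "\<forall>g\<in>\<Phi>. \<alpha> g \<le> hamming_length m (\<phi> g)"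
      and mult: "\<forall>g \<in> \<Phi>. \<forall>h \<in> \<Phi>. g \<otimes>\<^bsub>G\<^esub> h \<in> \<Phi> \<longrightarrow>
            hamming_length m
              (\<phi> (g \<otimes>\<^bsub>G\<^esub> h) \<otimes>\<^bsub>sym_group m\<^esub>
                inv\<^bsub>sym_group m\<^esub> (\<phi> g \<otimes>\<^bsub>sym_group m\<^esub> \<phi> h)) < \<epsilon>"
      by (elim exE bexE conjE) (rule that; assumption)
    have perm: "\<phi> g permutes {1..m}" if "g \<in> \<Phi>" for g
      using \<phi> that by (auto simp: sym_group_carrier)
    have mult': "hamming_length m (\<phi> (g \<otimes>\<^bsub>G\<^esub> h) \<circ> inv' (\<phi> g \<circ> \<phi> h)) < \<epsilon>"
      if g: "g \<in> \<Phi>" "h \<in> \<Phi>" "g \<otimes>\<^bsub>G\<^esub> h \<in> \<Phi>" for g h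
    proof -
      have "\<phi> g \<circ> \<phi> h \<in> carrier (sym_group m)"
        using perm g permutes_compose by (simp only: sym_group_carrier) blast
      from sym_group_inv_equality[OF this] show ?thesis
        using mult[rule_format, OF g] by (simp only: sym_group_mult)
    qed
    show "\<exists>L m \<phi>. L \<in> \<K> \<and> 1 \<le> m \<and> (L = alt_group m \<or> L = sym_group m) \<and> \<phi> \<in> \<Phi> \<rightarrow> carrier L \<and>
        (\<forall>g\<in>\<Phi>. \<alpha> g \<le> hamming_length m (\<phi> g)) \<and>
        (\<forall>g\<in>\<Phi>. \<forall>h\<in>\<Phi>. g \<otimes>\<^bsub>G\<^esub> h \<in> \<Phi> \<longrightarrow>
          hamming_length m (\<phi> (g \<otimes>\<^bsub>G\<^esub> h) \<circ> inv' (\<phi> g \<circ> \<phi> h)) < \<epsilon>)"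
      using \<K>
    proof
      assume K: "\<K> = finite_symmetric_groups"
      show ?thesis
        by (intro exI[of _ "sym_group m"] exI[of _ m] exI[of _ \<phi>])
          (use K m \<phi> len mult' in \<open>auto simp: finite_symmetric_groups_def\<close>)
    next
      assume K: "\<K> = finite_alternating_groups"
      have "alt_group (2 * m) \<in> \<K>" using K m by (auto simp: finite_alternating_groups_def)
      moreover have "(\<lambda>g. double_perm m (\<phi> g)) \<in> \<Phi> \<rightarrow> carrier (alt_group (2 * m))"
        using perm double_perm_alt_group by blast
      moreover have "\<forall>g\<in>\<Phi>. \<alpha> g \<le> hamming_length (2 * m) (double_perm m (\<phi> g))"
        using len perm hamming_length_double_perm by metis
      moreover have "hamming_length (2 * m) (double_perm m (\<phi> (g \<otimes>\<^bsub>G\<^esub> h)) \<circ>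
          inv' (double_perm m (\<phi> g) \<circ> double_perm m (\<phi> h))) < \<epsilon>"
        if g: "g \<in> \<Phi>" "h \<in> \<Phi>" "g \<otimes>\<^bsub>G\<^esub> h \<in> \<Phi>" for g h
      proof -
        have p: "\<phi> g \<circ> \<phi> h permutes {1..m}" using perm g by (simp only: permutes_compose)
        have "inv' (double_perm m (\<phi> g \<circ> \<phi> h)) = double_perm m (inv' (\<phi> g \<circ> \<phi> h))"
          by (rule inv_unique_comp)
            (simp_all only: double_perm_comp[OF p, symmetric] double_perm_comp[OF permutes_inv[OF p], symmetric]
              permutes_inv_o[OF p] double_perm_id)
        then have "double_perm m (\<phi> (g \<otimes>\<^bsub>G\<^esub> h)) \<circ> inv' (double_perm m (\<phi> g) \<circ> double_perm m (\<phi> h)) =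
            double_perm m (\<phi> (g \<otimes>\<^bsub>G\<^esub> h) \<circ> inv' (\<phi> g \<circ> \<phi> h))"
          by (simp only: double_perm_comp[OF perm[OF g(2)]] double_perm_comp[OF permutes_inv[OF p]])
        moreover have "\<phi> (g \<otimes>\<^bsub>G\<^esub> h) \<circ> inv' (\<phi> g \<circ> \<phi> h) permutes {1..m}"
          by (rule permutes_compose[OF permutes_inv[OF p] perm[OF g(3)]])
        ultimately show ?thesis
          using mult'[OF g] by (simp only: hamming_length_double_perm)
      qed
      moreover have "1 \<le> 2 * m" using m by simp
      ultimately show ?thesis by blast
    qed
  qed
qed

section \<open>Null sequences along a filter and the embedding\<close>

context perm_product
begin

text \<open>The quotient by this subgroup resembles a metric ultraproduct. An arbitrary filter is
  enough, since the embedding only compares lengths tending to zero with lengths eventually bounded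
  below.\<close>

definition null_sequences :: "'i filter \<Rightarrow> ('i \<Rightarrow> nat \<Rightarrow> nat) set" where
  "null_sequences F = {x \<in> carrier P. ((\<lambda>i. hamming_length (m i) (x i)) \<longlongrightarrow> 0) F}"

text \<open>The length is subadditive and invariant under inversion and conjugation. The filter
  lives on the whole index type, whereas coordinates have a meaning only in \<open>I\<close>; hence
  the hypothesis.\<close>

lemma null_sequences_normal:
  assumes F: "\<forall>\<^sub>F i in F. i \<in> I"
  shows "null_sequences F \<lhd> P"
proof (rule P.normal_invI)
  show "subgroup (null_sequences F) P"
  proof (rule P.subgroupI)
    show "null_sequences F \<subseteq> carrier P" by (auto simp: null_sequences_def)
    have "((\<lambda>i. hamming_length (m i) (\<one>\<^bsub>P\<^esub> i)) \<longlongrightarrow> 0) F"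
      by (rule tendsto_eventually, rule eventually_mono[OF F]) (simp only: one_P hamming_length_id)
    then have "\<one>\<^bsub>P\<^esub> \<in> null_sequences F" by (simp add: null_sequences_def)
    then show "null_sequences F \<noteq> {}" by blast
  next
    fix x assume x: "x \<in> null_sequences F"
    then have xP: "x \<in> carrier P" by (simp add: null_sequences_def)
    have "\<forall>\<^sub>F i in F. hamming_length (m i) (x i) = hamming_length (m i) ((inv\<^bsub>P\<^esub> x) i)"
      by (rule eventually_mono[OF F]) (simp only: inv_P[OF xP] hamming_length_inv[OF permutes_P[OF xP]])
    from tendsto_cong[OF this, of 0]
    have "((\<lambda>i. hamming_length (m i) ((inv\<^bsub>P\<^esub> x) i)) \<longlongrightarrow> 0) F"
      using x by (simp add: null_sequences_def)
    then show "inv\<^bsub>P\<^esub> x \<in> null_sequences F" using xP by (simp add: null_sequences_def)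
  next
    fix x y assume x: "x \<in> null_sequences F" and y: "y \<in> null_sequences F"
    then have xP: "x \<in> carrier P" "y \<in> carrier P" by (simp_all add: null_sequences_def)
    have le: "\<forall>\<^sub>F i in F. hamming_length (m i) ((x \<otimes>\<^bsub>P\<^esub> y) i) \<le>
        hamming_length (m i) (x i) + hamming_length (m i) (y i)"
      by (rule eventually_mono[OF F])
        (simp only: mult_P hamming_length_comp[OF permutes_P[OF xP(1)] permutes_P[OF xP(2)]])
    have lim: "((\<lambda>i. hamming_length (m i) (x i) + hamming_length (m i) (y i)) \<longlongrightarrow> 0) F"
      using x y by (auto simp: null_sequences_def intro: tendsto_add_zero)
    have "((\<lambda>i. hamming_length (m i) ((x \<otimes>\<^bsub>P\<^esub> y) i)) \<longlongrightarrow> 0) F"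
      by (rule tendsto_sandwich[OF _ le tendsto_const lim]) (simp only: hamming_length_nonneg eventually_True)
    then show "x \<otimes>\<^bsub>P\<^esub> y \<in> null_sequences F" using xP by (simp add: null_sequences_def)
  qed
next
  fix x h assume xP: "x \<in> carrier P" and h: "h \<in> null_sequences F"
  then have hP: "h \<in> carrier P" by (simp add: null_sequences_def)
  have "\<forall>\<^sub>F i in F. hamming_length (m i) (h i) = hamming_length (m i) ((x \<otimes>\<^bsub>P\<^esub> h \<otimes>\<^bsub>P\<^esub> inv\<^bsub>P\<^esub> x) i)"
    by (rule eventually_mono[OF F])
      (simp only: mult_P inv_P[OF xP] hamming_length_conj[OF permutes_P[OF hP] permutes_P[OF xP]])
  from tendsto_cong[OF this, of 0]
  have "((\<lambda>i. hamming_length (m i) ((x \<otimes>\<^bsub>P\<^esub> h \<otimes>\<^bsub>P\<^esub> inv\<^bsub>P\<^esub> x) i)) \<longlongrightarrow> 0) F"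
    using h by (simp add: null_sequences_def)
  then show "x \<otimes>\<^bsub>P\<^esub> h \<otimes>\<^bsub>P\<^esub> inv\<^bsub>P\<^esub> x \<in> null_sequences F"
    using xP hP by (simp add: null_sequences_def)
qed

lemma embeds_if_section:
  fixes G :: "('a, 'b) monoid_scheme"
  assumes G: "group G" and N: "N \<lhd> P" and s: "\<And>g. g \<in> carrier G \<Longrightarrow> s g \<in> carrier P"
    and s_mult: "\<And>g h. g \<in> carrier G \<Longrightarrow> h \<in> carrier G \<Longrightarrow>
      s (g \<otimes>\<^bsub>G\<^esub> h) \<otimes>\<^bsub>P\<^esub> inv\<^bsub>P\<^esub> (s g \<otimes>\<^bsub>P\<^esub> s h) \<in> N"
    and s_inj: "\<And>g. g \<in> carrier G \<Longrightarrow> g \<noteq> \<one>\<^bsub>G\<^esub> \<Longrightarrow> s g \<notin> N"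
  shows "\<exists>S. subgroup S (P Mod N) \<and> G \<cong> (P Mod N)\<lparr>carrier := S\<rparr>"
proof -
  interpret G: group G by (rule G)
  interpret N: normal N P by (rule N)
  define \<theta> where "\<theta> g = N #>\<^bsub>P\<^esub> s g" for g
  have hom: "\<theta> \<in> hom G (P Mod N)"
  proof (rule homI)
    show "\<theta> g \<in> carrier (P Mod N)" if "g \<in> carrier G" for g
      using s[OF that] by (auto simp: \<theta>_def carrier_FactGroup)
    show "\<theta> (g \<otimes>\<^bsub>G\<^esub> h) = \<theta> g \<otimes>\<^bsub>P Mod N\<^esub> \<theta> h" if g: "g \<in> carrier G" "h \<in> carrier G" for g h
      using s_mult[OF g] s g by (simp add: \<theta>_def N.rcos_sum N.rcos_eq_iff)
  qed
  interpret \<theta>: group_hom G "P Mod N" \<theta>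
    using hom by (intro group_hom.intro G N.factorgroup_is_group group_hom_axioms.intro)
  have "g = \<one>\<^bsub>G\<^esub>" if g: "g \<in> carrier G" "\<theta> g = \<one>\<^bsub>P Mod N\<^esub>" for g
  proof -
    have "s g \<in> N"
      using g s[OF g(1)] P.coset_join1[OF _ _ N.subgroup_axioms, of "s g"] by (simp add: \<theta>_def)
    then show ?thesis using s_inj g(1) by blast
  qed
  then have "inj_on \<theta> (carrier G)" using \<theta>.inj_on_one_iff by blast
  then have "\<theta> \<in> iso G ((P Mod N)\<lparr>carrier := \<theta> ` carrier G\<rparr>)"
    using hom by (auto simp: iso_def hom_def bij_betw_def)
  moreover have "subgroup (\<theta> ` carrier G) (P Mod N)"
    using \<theta>.subgroup_img_is_subgroup[OF G.subgroup_self] .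
  ultimately show ?thesis by (auto simp: is_iso_def)
qed

end

lemma subgroup_of_quotient_of_product_if_sofic:
  fixes G :: "('a, 'b) monoid_scheme" and \<K> :: "(nat \<Rightarrow> nat) monoid set"
  assumes G: "group G" and so: "sofic G"
    and \<K>: "\<K> = finite_alternating_groups \<or> \<K> = finite_symmetric_groups"
  shows "subgroup_of_quotient_of_product TYPE('a set \<times> nat) \<K> G"
proof -
  interpret G: group G by (rule G)
  obtain \<alpha> :: "'a \<Rightarrow> real" where \<alpha>: "\<And>g. g \<in> carrier G \<Longrightarrow> g \<noteq> \<one>\<^bsub>G\<^esub> \<Longrightarrow> \<alpha> g > 0"
    and approx: "\<And>\<Phi> (\<epsilon> :: real). finite \<Phi> \<Longrightarrow> \<Phi> \<subseteq> carrier G \<Longrightarrow> \<epsilon> > 0 \<Longrightarrow>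
      \<exists>L m \<phi>. L \<in> \<K> \<and> 1 \<le> m \<and> (L = alt_group m \<or> L = sym_group m) \<and> \<phi> \<in> \<Phi> \<rightarrow> carrier L \<and>
        (\<forall>g\<in>\<Phi>. \<alpha> g \<le> hamming_length m (\<phi> g)) \<and>
        (\<forall>g\<in>\<Phi>. \<forall>h\<in>\<Phi>. g \<otimes>\<^bsub>G\<^esub> h \<in> \<Phi> \<longrightarrow>
          hamming_length m (\<phi> (g \<otimes>\<^bsub>G\<^esub> h) \<circ> inv' (\<phi> g \<circ> \<phi> h)) < \<epsilon>)"
    using sofic_approximation_in_class[OF so \<K>] by blast
  \<comment> \<open>An index is a finite set to be approximated together with a number
    \<open>n\<close> that stands for the tolerance 1/(n + 1).\<close>
  define I where "I = {i :: 'a set \<times> nat. finite (fst i) \<and> fst i \<subseteq> carrier G}"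
  \<comment> \<open>Along \<open>F\<close> the finite sets eventually contain any given one and the
    tolerances tend to 0. Since the group may be uncountable, the finite sets are directed by
    inclusion instead of being arranged in a sequence.\<close>
  define F where "F = finite_subsets_at_top (carrier G) \<times>\<^sub>F sequentially"
  have "\<forall>i\<in>I. \<exists>L m \<phi>. L \<in> \<K> \<and> 1 \<le> m \<and> (L = alt_group m \<or> L = sym_group m) \<and>
        \<phi> \<in> fst i \<rightarrow> carrier L \<and> (\<forall>g\<in>fst i. \<alpha> g \<le> hamming_length m (\<phi> g)) \<and>
        (\<forall>g\<in>fst i. \<forall>h\<in>fst i. g \<otimes>\<^bsub>G\<^esub> h \<in> fst i \<longrightarrow>
          hamming_length m (\<phi> (g \<otimes>\<^bsub>G\<^esub> h) \<circ> inv' (\<phi> g \<circ> \<phi> h)) < 1 / real (Suc (snd i)))"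
    by (intro ballI approx) (auto simp: I_def)
  from bchoice[OF this] obtain H where "\<forall>i\<in>I. \<exists>m \<phi>. H i \<in> \<K> \<and> 1 \<le> m \<and> (H i = alt_group m \<or> H i = sym_group m) \<and>
        \<phi> \<in> fst i \<rightarrow> carrier (H i) \<and> (\<forall>g\<in>fst i. \<alpha> g \<le> hamming_length m (\<phi> g)) \<and>
        (\<forall>g\<in>fst i. \<forall>h\<in>fst i. g \<otimes>\<^bsub>G\<^esub> h \<in> fst i \<longrightarrow>
          hamming_length m (\<phi> (g \<otimes>\<^bsub>G\<^esub> h) \<circ> inv' (\<phi> g \<circ> \<phi> h)) < 1 / real (Suc (snd i)))" ..
  from bchoice[OF this] obtain m where "\<forall>i\<in>I. \<exists>\<phi>. H i \<in> \<K> \<and> 1 \<le> m i \<and> (H i = alt_group (m i) \<or> H i = sym_group (m i)) \<and>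
        \<phi> \<in> fst i \<rightarrow> carrier (H i) \<and> (\<forall>g\<in>fst i. \<alpha> g \<le> hamming_length (m i) (\<phi> g)) \<and>
        (\<forall>g\<in>fst i. \<forall>h\<in>fst i. g \<otimes>\<^bsub>G\<^esub> h \<in> fst i \<longrightarrow>
          hamming_length (m i) (\<phi> (g \<otimes>\<^bsub>G\<^esub> h) \<circ> inv' (\<phi> g \<circ> \<phi> h)) < 1 / real (Suc (snd i)))" ..
  from bchoice[OF this] obtain \<phi> where all: "\<forall>i\<in>I. H i \<in> \<K> \<and> 1 \<le> m i \<and> (H i = alt_group (m i) \<or> H i = sym_group (m i)) \<and>
        \<phi> i \<in> fst i \<rightarrow> carrier (H i) \<and> (\<forall>g\<in>fst i. \<alpha> g \<le> hamming_length (m i) (\<phi> i g)) \<and>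
        (\<forall>g\<in>fst i. \<forall>h\<in>fst i. g \<otimes>\<^bsub>G\<^esub> h \<in> fst i \<longrightarrow>
          hamming_length (m i) (\<phi> i (g \<otimes>\<^bsub>G\<^esub> h) \<circ> inv' (\<phi> i g \<circ> \<phi> i h)) < 1 / real (Suc (snd i)))" ..
  then interpret perm_product I H m by unfold_locales auto
  have \<phi>: "\<phi> i g \<in> carrier (H i)" if "i \<in> I" "g \<in> fst i" for i g
    using all that by blast
  \<comment> \<open>The value \<open>id\<close> is a filler that keeps \<open>s g\<close> in the
    product; for each \<open>g\<close> it eventually does not occur along \<open>F\<close>.\<close>
  define s where "s g = (\<lambda>i\<in>I. if g \<in> fst i then \<phi> i g else id)" for g
  have sP: "s g \<in> carrier P" for g
    unfolding s_def using \<phi> even_perms_carrier_H[OF _ even_perms_id] by (intro restrict_in_P) auto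
  have fst_lim: "filterlim fst (finite_subsets_at_top (carrier G)) (finite_subsets_at_top (carrier G) \<times>\<^sub>F sequentially)"
    and snd_lim: "filterlim snd sequentially (finite_subsets_at_top (carrier G) \<times>\<^sub>F sequentially)"
    by (simp_all add: filterlim_def filtermap_fst_prod_filter filtermap_snd_prod_filter)
  have ev: "\<forall>\<^sub>F i in F. i \<in> I \<and> \<Phi> \<subseteq> fst i" if \<Phi>: "finite \<Phi>" "\<Phi> \<subseteq> carrier G" for \<Phi>
  proof -
    have "\<forall>\<^sub>F Y in finite_subsets_at_top (carrier G). finite Y \<and> \<Phi> \<subseteq> Y \<and> Y \<subseteq> carrier G"
      unfolding eventually_finite_subsets_at_top using \<Phi> by blast
    then have "\<forall>\<^sub>F i in F. finite (fst i) \<and> \<Phi> \<subseteq> fst i \<and> fst i \<subseteq> carrier G"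
      unfolding F_def by (rule eventually_compose_filterlim[OF _ fst_lim])
    then show ?thesis by (rule eventually_mono) (simp add: I_def)
  qed
  have F_I: "\<forall>\<^sub>F i in F. i \<in> I" using ev[of "{}"] by simp
  have F_nontrivial: "F \<noteq> bot" by (simp add: F_def prod_filter_eq_bot)
  have lim: "((\<lambda>i. 1 / real (Suc (snd i))) \<longlongrightarrow> 0) F"
    unfolding F_def by (rule filterlim_compose[OF LIMSEQ_Suc[OF lim_1_over_n] snd_lim])
  let ?N = "null_sequences F"
  have N: "?N \<lhd> P" using F_I by (rule null_sequences_normal)
  have "\<exists>S. subgroup S (P Mod ?N) \<and> G \<cong> (P Mod ?N)\<lparr>carrier := S\<rparr>"
  proof (rule embeds_if_section[OF G N])
    show "s g \<in> carrier P" for g by (rule sP)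
  next
    fix g h assume g: "g \<in> carrier G" "h \<in> carrier G"
    let ?d = "s (g \<otimes>\<^bsub>G\<^esub> h) \<otimes>\<^bsub>P\<^esub> inv\<^bsub>P\<^esub> (s g \<otimes>\<^bsub>P\<^esub> s h)"
    have dP: "?d \<in> carrier P" using sP by simp
    have "\<forall>\<^sub>F i in F. hamming_length (m i) (?d i) \<le> 1 / real (Suc (snd i))"
    proof (rule eventually_mono[OF ev[of "{g, h, g \<otimes>\<^bsub>G\<^esub> h}"]])
      fix i assume i: "i \<in> I \<and> {g, h, g \<otimes>\<^bsub>G\<^esub> h} \<subseteq> fst i"
      then have iI: "i \<in> I" "g \<in> fst i" "h \<in> fst i" "g \<otimes>\<^bsub>G\<^esub> h \<in> fst i" by auto
      then have "?d i = \<phi> i (g \<otimes>\<^bsub>G\<^esub> h) \<circ> inv' (\<phi> i g \<circ> \<phi> i h)"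
        using sP by (simp add: mult_P inv_P) (simp add: s_def)
      moreover have "hamming_length (m i) (\<phi> i (g \<otimes>\<^bsub>G\<^esub> h) \<circ> inv' (\<phi> i g \<circ> \<phi> i h)) < 1 / real (Suc (snd i))"
        using all[THEN bspec, OF iI(1)] iI(2-4) by (elim conjE) blast
      ultimately show "hamming_length (m i) (?d i) \<le> 1 / real (Suc (snd i))" by simp
    qed (use g in auto)
    from tendsto_sandwich[OF _ this tendsto_const lim]
    have "((\<lambda>i. hamming_length (m i) (?d i)) \<longlongrightarrow> 0) F"
      by (simp only: hamming_length_nonneg eventually_True)
    then show "?d \<in> ?N" using dP by (simp only: null_sequences_def mem_Collect_eq)
  next
    fix g assume g: "g \<in> carrier G" "g \<noteq> \<one>\<^bsub>G\<^esub>"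
    show "s g \<notin> ?N"
    proof
      assume "s g \<in> ?N"
      then have "((\<lambda>i. hamming_length (m i) (s g i)) \<longlongrightarrow> 0) F" by (simp add: null_sequences_def)
      \<comment> \<open>The length cannot tend to zero, because it is eventually at least the
        positive number \<open>\<alpha> g\<close>, and the filter is proper.\<close>
      then have "\<forall>\<^sub>F i in F. hamming_length (m i) (s g i) < \<alpha> g"
        using \<alpha>[OF g] by (rule order_tendstoD)
      moreover have "\<forall>\<^sub>F i in F. \<alpha> g \<le> hamming_length (m i) (s g i)"
      proof (rule eventually_mono[OF ev[of "{g}"]])
        fix i assume "i \<in> I \<and> {g} \<subseteq> fst i"
        then show "\<alpha> g \<le> hamming_length (m i) (s g i)" using all by (simp add: s_def)
      qed (use g in auto)
      ultimately have "\<forall>\<^sub>F i in F. False" by eventually_elim simp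
      then show False using F_nontrivial by (simp add: trivial_limit_def)
    qed
  qed
  then show ?thesis
    using N all unfolding subgroup_of_quotient_of_product_def P_def by blast
qed

(* The index type 'a set * nat (finite subsets of G paired with tolerances 1/n) is large enough
   for the forward direction; the second conjunct gives the backward direction for products
   indexed by sets of an arbitrary type 'i. *)
theorem mainTheorem1:
  fixes G :: "('a, 'b) monoid_scheme"
    and \<K> :: "(nat \<Rightarrow> nat) monoid set"
  assumes "group G"
    and "\<K> = finite_alternating_groups \<or> \<K> = finite_symmetric_groups"
  shows "(sofic G \<longleftrightarrow> subgroup_of_quotient_of_product TYPE('a set \<times> nat) \<K> G) \<and>
         (subgroup_of_quotient_of_product TYPE('i) \<K> G \<longrightarrow> sofic G)"
  by (intro conjI iffI impI subgroup_of_quotient_of_product_if_sofic[OF assms(1) _ assms(2)])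
    (erule sofic_if_subgroup_of_quotient_of_product[OF assms] | assumption)+

end
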